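(* Let $d>1$, let $\mathbb B_d$ be the open unit ball of $\mathbb C^d$ for the $\ell^2$-norm, let $\Omega\subset\mathbb C^d$ be a domain and let $\boldsymbol F:\mathbb B_d\to\Omega$ be a proper holomorphic mapping. Let $G$ be the finite complex reflection group and $\boldsymbol\Psi\in\mathrm{Aut}(\mathbb B_d)$ the automorphism in Rudin's factorization $\boldsymbol F=\boldsymbol\Phi\circ\boldsymbol\theta\circ\boldsymbol\Psi$. Then the Bergman kernel $\mathcal B_\Omega$ of $\Omega$ is given by $$\mathcal B_\Omega\big(\boldsymbol F(\boldsymbol z),\boldsymbol F(\boldsymbol w)\big)=\frac{1}{J_{\boldsymbol F}(\boldsymbol z)\,\overline{J_{\boldsymbol F}(\boldsymbol w)}}\sum_{\sigma\in G}\frac{J_{\boldsymbol\Psi_\sigma}(\boldsymbol z)}{\big(1-\langle\boldsymbol\Psi_\sigma(\boldsymbol z),\boldsymbol w\rangle\big)^{d+1}},\qquad\boldsymbol z,\boldsymbol w\in\mathbb B_d,$$ where $\boldsymbol\Psi_\sigma=\boldsymbol\Psi^{-1}\circ\sigma^{-1}\circ\boldsymbol\Psi$ for $\sigma\in G$.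
   Context: A complex reflection on $\mathbb C^d$ is a linear map $\sigma$ of finite order in $GL(d,\mathbb C)$ such that $\mathrm{id}-\sigma$ has rank $1$. A finite complex reflection group is a finite group generated by complex reflections; here, as in the paper, it is taken to be a subgroup of the group of unitary operators on $\mathbb C^d$, so it preserves $\mathbb B_d$. It acts by $\sigma\cdot\boldsymbol z=\sigma^{-1}\boldsymbol z$; in $\boldsymbol\Psi_\sigma$, $\sigma^{-1}$ stands for the map $\boldsymbol z\mapsto\sigma^{-1}\cdot\boldsymbol z$. A basic polynomial map associated to $G$ is $\boldsymbol\theta=(\theta_1,\dots,\theta_d):\mathbb C^d\to\mathbb C^d$, where $\theta_1,\dots,\theta_d$ are algebraically independent homogeneous polynomials with $\mathbb C[z_1,\dots,z_d]^G=\mathbb C[\theta_1,\dots,\theta_d]$. Rudin's theorem (known result): if $d>1$ and $\boldsymbol F:\mathbb B_d\to\Omega$ is a proper holomorphic map onto a domain $\Omega\subset\mathbb C^d$ with multiplicity $m>1$, then there is a unique finite complex reflection group $G$ of order $m$ such that $\boldsymbol F=\boldsymbol\Phi\circ\boldsymbol\theta\circ\boldsymbol\Psi$, where $\boldsymbol\Psi\in\mathrm{Aut}(\mathbb B_d)$ is an automorphism (biholomorphic self-map), $\boldsymbol\theta$ is a basic polynomial map associated to $G$ and $\boldsymbol\Phi:\boldsymbol\theta(\mathbb B_d)\to\Omega$ is biholomorphic. (For $m=1$, take $G$ trivial.) $\langle\cdot,\cdot\rangle$ is the standard inner product of $\mathbb C^d$, and $J_{\boldsymbol g}$ is the determinant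 of the complex Jacobian matrix of $\boldsymbol g$. The Bergman kernel of a domain is the reproducing kernel of its space of holomorphic functions square integrable with respect to $dV$, where $dV$ is the multiple of Lebesgue measure with $V(\mathbb B_d)=1$ (used also on $\Omega$), so that $\mathcal B_{\mathbb B_d}(\boldsymbol z,\boldsymbol w)=(1-\langle\boldsymbol z,\boldsymbol w\rangle)^{-(d+1)}$. At zeros of $J_{\boldsymbol F}$ the right-hand side is understood as its extension, holomorphic in $\boldsymbol z$ and antiholomorphic in $\boldsymbol w$. *)

theory Defs
  imports
    "HOL-Analysis.Analysis"
    "HOL-Algebra.Generated_Groups"
    "HOL-Library.Poly_Mapping"
begin

section \<open>Holomorphic maps in several variables\<close>

definition hermitian_inner :: "complex^'n \<Rightarrow> complex^'n \<Rightarrow> complex" where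
  "hermitian_inner z w = (\<Sum>i\<in>UNIV. z $ i * cnj (w $ i))"

text \<open>The norm of the library on \<^typ>\<open>complex^'n\<close> is the Euclidean one, so this is the
  open unit ball for the \<open>\<ell>\<^sup>2\<close>-norm.\<close>

abbreviation unit_ball :: "(complex^'n) set" where
  "unit_ball \<equiv> ball 0 1"

text \<open>Complex Frechet differentiability at every point of an open set: the derivative is
  required to be complex linear.\<close>

definition holo_on :: "(complex^'n \<Rightarrow> complex) \<Rightarrow> (complex^'n) set \<Rightarrow> bool" where
  "holo_on f U \<longleftrightarrow> open U \<and>
     (\<forall>z\<in>U. \<exists>a::complex^'n. (f has_derivative (\<lambda>h. \<Sum>j\<in>UNIV. a $ j * h $ j)) (at z))"

definition holo_map_on :: "(complex^'n \<Rightarrow> complex^'m) \<Rightarrow> (complex^'n) set \<Rightarrow> bool" where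
  "holo_map_on f U \<longleftrightarrow> (\<forall>i. holo_on (\<lambda>z. f z $ i) U)"

definition biholomorphic :: "(complex^'n \<Rightarrow> complex^'n) \<Rightarrow> (complex^'n) set \<Rightarrow> (complex^'n) set \<Rightarrow> bool" where
  "biholomorphic f U V \<longleftrightarrow> bij_betw f U V \<and> holo_map_on f U \<and> holo_map_on (inv_into U f) V"

definition proper_on :: "(complex^'n \<Rightarrow> complex^'n) \<Rightarrow> (complex^'n) set \<Rightarrow> (complex^'n) set \<Rightarrow> bool" where
  "proper_on f U V \<longleftrightarrow> f ` U \<subseteq> V \<and> (\<forall>K. compact K \<and> K \<subseteq> V \<longrightarrow> compact (U \<inter> f -` K))"

text \<open>The \<open>(i,j)\<close> entry of the matrix is \<open>\<partial>f\<^sub>i/\<partial>z\<^sub>j\<close>.\<close>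

definition complex_jacobian :: "(complex^'n \<Rightarrow> complex^'n) \<Rightarrow> complex^'n \<Rightarrow> complex" where
  "complex_jacobian f z = det (\<chi> i j. deriv (\<lambda>t. f (z + axis j t) $ i) 0)"

text \<open>\<open>H\<close> is holomorphic in the first and antiholomorphic in the second variable on \<open>U \<times> U\<close>, and
  coincides with \<open>R\<close> on the part \<open>P \<times> P\<close> of it where \<open>R\<close> is given by a formula.\<close>

definition sesquiholo_extension ::
  "(complex^'n) set \<Rightarrow> (complex^'n) set \<Rightarrow> (complex^'n \<Rightarrow> complex^'n \<Rightarrow> complex) \<Rightarrow>
   (complex^'n \<Rightarrow> complex^'n \<Rightarrow> complex) \<Rightarrow> bool" where
  "sesquiholo_extension U P R H \<longleftrightarrow>
     (\<forall>w\<in>U. holo_on (\<lambda>z. H z w) U) \<and>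
     (\<forall>z\<in>U. holo_on (\<lambda>w. cnj (H z w)) U) \<and>
     (\<forall>z\<in>U \<inter> P. \<forall>w\<in>U \<inter> P. H z w = R z w)"


section \<open>The Bergman kernel\<close>

definition normalized_volume :: "(complex^'n) measure" where
  "normalized_volume = scale_measure (1 / emeasure lborel (unit_ball :: (complex^'n) set)) lborel"

definition bergman_space :: "(complex^'n) set \<Rightarrow> (complex^'n \<Rightarrow> complex) set" where
  "bergman_space D =
     {f. holo_on f D \<and> set_integrable normalized_volume D (\<lambda>z. (cmod (f z))\<^sup>2)}"

definition bergman_reproducing :: "(complex^'n) set \<Rightarrow> (complex^'n \<Rightarrow> complex^'n \<Rightarrow> complex) \<Rightarrow> bool" where
  "bergman_reproducing D K \<longleftrightarrow>
     (\<forall>w\<in>D. (\<lambda>z. K z w) \<in> bergman_space D \<and>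
        (\<forall>f\<in>bergman_space D. f w = (LINT z:D|normalized_volume. f z * cnj (K z w))))"

text \<open>The reproducing property determines the kernel on \<open>D \<times> D\<close> only; the value \<open>0\<close> elsewhere
  is a convention making the kernel unique as a total function.\<close>

definition bergman_kernel :: "(complex^'n) set \<Rightarrow> complex^'n \<Rightarrow> complex^'n \<Rightarrow> complex" where
  "bergman_kernel D =
     (THE K. bergman_reproducing D K \<and> (\<forall>z w. z \<notin> D \<or> w \<notin> D \<longrightarrow> K z w = 0))"


section \<open>Finite complex reflection groups\<close>

text \<open>Linear operators on \<open>\<complex>\<^sup>d\<close> are represented by their matrices.\<close>

definition conj_transpose :: "complex^'n^'n \<Rightarrow> complex^'n^'n" where
  "conj_transpose A = (\<chi> i j. cnj (A $ j $ i))"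

definition unitary_group :: "(complex^'n^'n) monoid" where
  "unitary_group = \<lparr>carrier = {A. conj_transpose A ** A = mat 1}, mult = (**), one = mat 1\<rparr>"

text \<open>The operator \<open>*\<close> on the type of matrices is the entrywise product, hence powers are
  iterates of \<open>**\<close>. Finite order implies invertibility.\<close>

definition complex_reflection :: "complex^'n^'n \<Rightarrow> bool" where
  "complex_reflection A \<longleftrightarrow> (\<exists>k>0. (((**) A) ^^ k) (mat 1) = mat 1) \<and> rank (mat 1 - A) = 1"

definition finite_complex_reflection_group :: "(complex^'n^'n) set \<Rightarrow> bool" where
  "finite_complex_reflection_group G \<longleftrightarrow> finite G \<and>
     (\<exists>S. S \<subseteq> carrier unitary_group \<and> (\<forall>A\<in>S. complex_reflection A) \<and>
          G = generate unitary_group S)"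

text \<open>The action \<open>\<sigma> \<cdot> z = \<sigma>\<^sup>-\<^sup>1 z\<close>.\<close>

definition refl_act :: "complex^'n^'n \<Rightarrow> complex^'n \<Rightarrow> complex^'n" where
  "refl_act \<sigma> z = matrix_inv \<sigma> *v z"


section \<open>Basic polynomial maps\<close>

text \<open>The polynomial ring \<open>\<complex>[z\<^sub>i | i \<in> 'n]\<close>: finitely supported maps from exponent vectors to
  coefficients, with the convolution product.\<close>

type_synonym 'n cpoly = "('n \<Rightarrow>\<^sub>0 nat) \<Rightarrow>\<^sub>0 complex"

definition cpoly_eval :: "('n::finite) cpoly \<Rightarrow> complex^'n \<Rightarrow> complex" where
  "cpoly_eval p z =
     (\<Sum>m\<in>Poly_Mapping.keys p. Poly_Mapping.lookup p m * (\<Prod>i\<in>UNIV. (z $ i) ^ Poly_Mapping.lookup m i))"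

text \<open>The polynomial \<open>q(\<theta>\<^sub>1, \<dots>, \<theta>\<^sub>d)\<close>; the factor \<open>single 0 c\<close> is the constant polynomial \<open>c\<close>.\<close>

definition cpoly_subst :: "('n::finite) cpoly \<Rightarrow> ('n \<Rightarrow> 'n cpoly) \<Rightarrow> 'n cpoly" where
  "cpoly_subst q \<theta> =
     (\<Sum>m\<in>Poly_Mapping.keys q.
        Poly_Mapping.single 0 (Poly_Mapping.lookup q m) * (\<Prod>i\<in>UNIV. \<theta> i ^ Poly_Mapping.lookup m i))"

definition cpoly_homogeneous :: "('n::finite) cpoly \<Rightarrow> bool" where
  "cpoly_homogeneous p \<longleftrightarrow>
     (\<exists>k. \<forall>m\<in>Poly_Mapping.keys p. (\<Sum>i\<in>UNIV. Poly_Mapping.lookup m i) = k)"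

definition algebraically_independent :: "(('n::finite) \<Rightarrow> 'n cpoly) \<Rightarrow> bool" where
  "algebraically_independent \<theta> \<longleftrightarrow> (\<forall>q. cpoly_subst q \<theta> = 0 \<longrightarrow> q = 0)"

definition invariant_cpolys :: "(complex^'n^'n) set \<Rightarrow> ('n::finite) cpoly set" where
  "invariant_cpolys G = {p. \<forall>\<sigma>\<in>G. \<forall>z. cpoly_eval p (refl_act \<sigma> z) = cpoly_eval p z}"

definition basic_polynomial_map :: "(complex^'n^'n) set \<Rightarrow> (complex^'n \<Rightarrow> complex^'n) \<Rightarrow> bool" where
  "basic_polynomial_map G \<theta> \<longleftrightarrow>
     (\<exists>p. (\<forall>i. cpoly_homogeneous (p i)) \<and> algebraically_independent p \<and>
          invariant_cpolys G = range (\<lambda>q. cpoly_subst q p) \<and>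
          \<theta> = (\<lambda>z. \<chi> i. cpoly_eval (p i) z))"


section \<open>Rudin's factorization\<close>

text \<open>That \<open>G\<close> has order equal to the multiplicity of \<open>F\<close> is a consequence of the factorization
  (the generic fibres of \<open>\<theta>\<close> are the free orbits of \<open>G\<close>), so it is not listed.\<close>

definition rudin_factorization ::
  "(complex^'n \<Rightarrow> complex^'n) \<Rightarrow> (complex^'n) set \<Rightarrow> (complex^'n^'n) set \<Rightarrow>
   (complex^'n \<Rightarrow> complex^'n) \<Rightarrow> (complex^'n \<Rightarrow> complex^'n) \<Rightarrow> (complex^'n \<Rightarrow> complex^'n) \<Rightarrow> bool" where
  "rudin_factorization F D G \<Phi> \<theta> \<Psi> \<longleftrightarrow>
     finite_complex_reflection_group G \<and>
     biholomorphic \<Psi> unit_ball unit_ball \<and>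
     basic_polynomial_map G \<theta> \<and>
     biholomorphic \<Phi> (\<theta> ` unit_ball) D \<and>
     (\<forall>z\<in>unit_ball. F z = \<Phi> (\<theta> (\<Psi> z)))"

text \<open>\<open>\<Psi>\<^sub>\<sigma> = \<Psi>\<^sup>-\<^sup>1 \<circ> \<sigma>\<^sup>-\<^sup>1 \<circ> \<Psi>\<close>, where \<open>\<sigma>\<^sup>-\<^sup>1\<close> stands for \<open>z \<mapsto> \<sigma>\<^sup>-\<^sup>1 \<cdot> z\<close>.\<close>

definition conj_aut ::
  "(complex^'n \<Rightarrow> complex^'n) \<Rightarrow> complex^'n^'n \<Rightarrow> complex^'n \<Rightarrow> complex^'n" where
  "conj_aut \<Psi> \<sigma> = inv_into unit_ball \<Psi> \<circ> refl_act (matrix_inv \<sigma>) \<circ> \<Psi>"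

end

theory Submission
  imports Defs "HOL-Complex_Analysis.Complex_Analysis"
begin

text \<open>
  Let \<open>k\<^sub>w\<close> be the Bergman kernel of the ball at \<open>w\<close> and
  \<open>J\<close> the Jacobian of \<open>F\<close>. In Rudin's factorization the automorphisms
  \<open>\<Psi>\<^sub>\<sigma>\<close> form a finite group of deck transformations of
  \<open>F\<close>: the fibres of \<open>F\<close> are its orbits, and it acts freely off the
  critical points. The operator \<open>u \<mapsto> J \<cdot> (u \<circ> F)\<close> takes square
  integrable holomorphic functions on \<open>\<Omega>\<close> to such functions on the ball. Its
  adjoint is a descent: for \<open>h\<close> on the ball, the sum \<open>T h =
  \<Sum>\<^sub>\<sigma> J\<^bsub>\<Psi>\<sigma>\<^esub> \<cdot> (h \<circ>
  \<Psi>\<^sub>\<sigma>)\<close> transforms under the group like \<open>J\<close>, so \<open>T h /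
  J\<close> is constant on fibres and equals \<open>f \<circ> F\<close> for a function
  \<open>f\<close> on \<open>\<Omega>\<close>. Integrating over a Borel set of representatives of
  the orbits (\<open>fundamental_domain\<close>) and unfolding the sum gives \<open>\<langle>u,
  f\<rangle>\<^sub>\<Omega> = \<langle>J \<cdot> (u \<circ> F), h\<rangle>\<^sub>B\<close>; this
  is the lemma \<open>descent\<close>. With \<open>h = k\<^sub>w\<close> the right-hand side is
  \<open>J(w) u(F w)\<close> for the normalized volume, so \<open>f\<close> divided by the
  conjugate of \<open>J(w)\<close> is the reproducing function of \<open>\<Omega>\<close> at
  \<open>F w\<close>, and \<open>J \<cdot> (f \<circ> F) = T k\<^sub>w\<close> is the asserted
  formula (\<open>kernel_formula\<close>). If \<open>J(w) = 0\<close>, a reproducing function at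
  \<open>F w\<close> is obtained as an average over a circle around \<open>w\<close> that avoids
  the zeros of \<open>J\<close> (\<open>reproducing_exists\<close>). Hence the kernel of
  \<open>\<Omega>\<close> exists, and \<open>K(F z, F w)\<close> is holomorphic in
  \<open>z\<close> and antiholomorphic in \<open>w\<close>; an extension of the right-hand side is
  unique because the zeros of \<open>J\<close> are a null set.

  The analytic tools behind this are the following. The volume form changes by the squared modulus
  of the complex Jacobian, because the real determinant of a complex linear map is the squared
  modulus of the complex one (\<open>abs_rdet_matrix\<close>). The function \<open>f\<close> is
  first defined off an analytic set containing the critical values, and extends because square
  integrable holomorphic functions have no singularities along the zeros of a holomorphic function
  (\<open>square_integrable_extension\<close>). The kernel of the ball is found by the mean value
  property at the centre and by transport with automorphisms that move one coordinate at a time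
  (\<open>ball_kernel_reproduces\<close>).

  The factorization enters in \<open>rudin_deck_group\<close>. Invariant polynomials of a finite
  group separate its orbits (\<open>separating_invariant\<close>), so the fibres of
  \<open>\<theta>\<close> are exactly the orbits of \<open>G\<close>. The Jacobian of
  \<open>\<theta>\<close> is not identically zero by Sard's theorem; the product of its translates
  under \<open>G\<close> is invariant, hence a polynomial in \<open>\<theta>\<close>, and this
  polynomial defines the analytic set in \<open>\<Omega>\<close> outside of which the covering is
  unramified.
\<close>

unbundle no Formal_Power_Series.fps_syntax

section \<open>Change of variables in Euclidean spaces\<close>

text \<open>The change of variables formula is first proved for \<open>real^'m\<close> with a well-ordered
  finite index type \<open>'m\<close>. The canonical basis of a Euclidean space, made into such an
  index type by an arbitrary numbering, gives an isometry of the space with one of this form,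
  along which the formula is transported to spaces such as \<open>complex^'n\<close>.\<close>

typedef (overloaded) ('a::euclidean_space) basis_index = "Basis :: 'a set"
  using nonempty_Basis by blast

instance basis_index :: (euclidean_space) finite
proof
  have "(UNIV :: 'a basis_index set) = Abs_basis_index ` (Basis :: 'a set)"
    by (rule type_definition.Abs_image[OF type_definition_basis_index, symmetric])
  then show "finite (UNIV :: 'a basis_index set)"
    by (metis finite_Basis finite_imageI)
qed

definition basis_rank :: "('a::euclidean_space) basis_index \<Rightarrow> nat" where
  "basis_rank = (SOME f. inj f)"

lemma inj_basis_rank: "inj (basis_rank :: 'a::euclidean_space basis_index \<Rightarrow> nat)"
proof -
  have "\<exists>f :: 'a basis_index \<Rightarrow> nat. inj f"
    using finite_imp_inj_to_nat_seg[OF finite_class.finite_UNIV] by (rule exE) (elim exE conjE, rule exI)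
  then show ?thesis unfolding basis_rank_def by (rule someI_ex)
qed

instantiation basis_index :: (euclidean_space) wellorder
begin
definition less_eq_basis_index :: "'a basis_index \<Rightarrow> 'a basis_index \<Rightarrow> bool" where
  "less_eq_basis_index i j \<longleftrightarrow> basis_rank i \<le> basis_rank j"
definition less_basis_index :: "'a basis_index \<Rightarrow> 'a basis_index \<Rightarrow> bool" where
  "less_basis_index i j \<longleftrightarrow> basis_rank i < basis_rank j"
instance
proof
  fix P :: "'a basis_index \<Rightarrow> bool" and a
  assume step: "\<And>x. (\<And>y. y < x \<Longrightarrow> P y) \<Longrightarrow> P x"
  show "P a"
  proof (induction "basis_rank a" arbitrary: a rule: less_induct)
    case less
    then show ?case using step unfolding less_basis_index_def by blast
  qed
next
  fix x y :: "'a basis_index"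
  assume "x \<le> y" "y \<le> x"
  then show "x = y" using inj_basis_rank by (auto simp: less_eq_basis_index_def inj_def)
qed (auto simp: less_eq_basis_index_def less_basis_index_def)
end

definition coord :: "'a::euclidean_space \<Rightarrow> real^('a basis_index)" where
  "coord x = (\<chi> i. x \<bullet> Rep_basis_index i)"

definition uncoord :: "real^('a basis_index) \<Rightarrow> 'a::euclidean_space" where
  "uncoord v = (\<Sum>i\<in>UNIV. v $ i *\<^sub>R Rep_basis_index i)"

lemma bij_Rep_basis_index: "bij_betw Rep_basis_index UNIV (Basis :: 'a::euclidean_space set)"
  unfolding bij_betw_def inj_on_def
  using type_definition.Rep_range[OF type_definition_basis_index] by (auto simp: Rep_basis_index_inject)

lemma sum_basis_index: "(\<Sum>i\<in>UNIV. f (Rep_basis_index i)) = (\<Sum>b\<in>(Basis :: 'a::euclidean_space set). f b)"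
  using sum.reindex_bij_betw[OF bij_Rep_basis_index] .

lemma uncoord_coord [simp]: "uncoord (coord x) = x"
  unfolding uncoord_def coord_def
  using sum_basis_index[of "\<lambda>b. (x \<bullet> b) *\<^sub>R b"] by (simp add: euclidean_representation)

lemma uncoord_inner: "uncoord v \<bullet> Rep_basis_index i = v $ i"
proof -
  have "uncoord v \<bullet> Rep_basis_index i = (\<Sum>j\<in>UNIV. if j = i then v $ j else 0)"
    unfolding uncoord_def inner_sum_left
    by (intro sum.cong) (auto simp: inner_Basis Rep_basis_index Rep_basis_index_inject)
  then show ?thesis by simp
qed

lemma coord_uncoord [simp]: "coord (uncoord v) = v"
  by (simp add: coord_def uncoord_inner vec_eq_iff)

lemma linear_coord: "linear coord"
  by (rule linearI) (auto simp: coord_def vec_eq_iff inner_add_left)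

lemma linear_uncoord: "linear uncoord"
  by (rule linearI) (auto simp: uncoord_def scaleR_add_left sum.distrib scaleR_sum_right)

lemma bounded_linear_coord: "bounded_linear coord"
  and bounded_linear_uncoord: "bounded_linear uncoord"
  by (simp_all add: linear_linear linear_coord linear_uncoord)

lemma continuous_on_coord: "continuous_on S coord"
  by (intro linear_continuous_on bounded_linear_coord)

lemma continuous_on_uncoord: "continuous_on S uncoord"
  by (intro linear_continuous_on bounded_linear_uncoord)

lemma measurable_coord [measurable]: "coord \<in> borel_measurable borel"
  and measurable_uncoord [measurable]: "uncoord \<in> borel_measurable borel"
  by (intro borel_measurable_continuous_onI continuous_on_coord continuous_on_uncoord)+

lemma coord_image: "coord ` S = uncoord -` S"
  by (auto simp: image_iff) (metis coord_uncoord)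

text \<open>Both measures give a box the product of its side lengths.\<close>

lemma distr_coord: "distr lborel borel (coord :: 'a::euclidean_space \<Rightarrow> _) = lborel"
proof (rule lborel_eqI[symmetric])
  fix l u :: "real^('a basis_index)"
  assume le: "\<And>b. b \<in> Basis \<Longrightarrow> l \<bullet> b \<le> u \<bullet> b"
  then have le': "l $ i \<le> u $ i" for i
    using le[of "axis i 1"] by (simp add: inner_axis axis_in_Basis_iff)
  have iff: "(\<forall>b\<in>Basis. P b) \<longleftrightarrow> (\<forall>i. P (Rep_basis_index i))" for P :: "'a \<Rightarrow> bool"
    by (metis Rep_basis_index Rep_basis_index_cases)
  have eq: "coord -` box l u = (box (uncoord l) (uncoord u) :: 'a set)"
    by (auto simp: box_def[of "uncoord l"] iff uncoord_inner mem_box_cart coord_def)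
  have leb: "\<forall>b\<in>Basis. uncoord l \<bullet> b \<le> (uncoord u :: 'a) \<bullet> b"
    by (simp add: iff uncoord_inner le')
  have "emeasure (distr lborel borel coord) (box l u) = emeasure lborel (box (uncoord l) (uncoord u) :: 'a set)"
    by (subst emeasure_distr) (auto simp: eq)
  also have "\<dots> = (\<Prod>b\<in>Basis. (uncoord u - uncoord l :: 'a) \<bullet> b)"
    using leb by (subst emeasure_lborel_box) auto
  also have "(\<Prod>b\<in>Basis. (uncoord u - uncoord l :: 'a) \<bullet> b) = (\<Prod>i\<in>UNIV. (u - l) $ i)"
    by (subst prod.reindex_bij_betw[OF bij_Rep_basis_index, symmetric])
       (simp add: inner_diff_left uncoord_inner)
  also have "\<dots> = (\<Prod>b\<in>Basis. (u - l) \<bullet> b)"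
    by (simp add: Basis_vec_def cart_eq_inner_axis axis_eq_axis prod.UNION_disjoint)
  finally show "emeasure (distr lborel borel coord) (box l u) = (\<Prod>b\<in>Basis. (u - l) \<bullet> b)" .
qed simp

lemma distr_uncoord: "distr lborel borel uncoord = (lborel :: 'a::euclidean_space measure)"
proof -
  have "distr lborel borel uncoord = distr (distr (lborel :: 'a measure) borel coord) borel uncoord"
    by (simp add: distr_coord)
  also have "\<dots> = distr lborel borel (\<lambda>x. x)"
    by (subst distr_distr) (auto simp: o_def)
  finally show ?thesis by (simp add: distr_id2)
qed

text \<open>For a complex linear map of \<open>complex^'n\<close> this is a determinant of twice the size of
  the complex one.\<close>

definition rdet :: "('a::euclidean_space \<Rightarrow> 'a) \<Rightarrow> real" where
  "rdet L = det (matrix (\<lambda>v. coord (L (uncoord v))))"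

text \<open>The image has finite measure if and only if the determinant is integrable
  (\<open>has_measure_differentiable_image\<close>); the direction from left to right shows that
  both sides are infinite together.\<close>

lemma emeasure_injective_image_cart:
  fixes h :: "real^'m::{finite,wellorder} \<Rightarrow> real^'m::_"
  assumes S: "S \<in> sets borel" "h ` S \<in> sets borel"
    and h: "\<And>x. x \<in> S \<Longrightarrow> (h has_derivative h' x) (at x within S)" "inj_on h S"
    and meas: "(\<lambda>x. indicator S x *\<^sub>R \<bar>det (matrix (h' x))\<bar>) \<in> borel_measurable borel"
  shows "emeasure lborel (h ` S) = (\<integral>\<^sup>+x. indicator S x * ennreal \<bar>det (matrix (h' x))\<bar> \<partial>lborel)"
proof -
  let ?D = "\<lambda>x. \<bar>det (matrix (h' x))\<bar>"
  have iff: "h ` S \<in> lmeasurable \<and> measure lebesgue (h ` S) = m \<longleftrightarrow> (?D has_integral m) S" for m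
    using S h by (intro has_measure_differentiable_image) auto
  have eq: "(\<integral>\<^sup>+x. indicator S x * ennreal (?D x) \<partial>lborel) = (\<integral>\<^sup>+x. ennreal (indicator S x *\<^sub>R ?D x) \<partial>lborel)"
    by (intro nn_integral_cong) (auto simp: indicator_def)
  have sets: "h ` S \<in> sets lebesgue" using S by auto
  show ?thesis
  proof (cases "(\<integral>\<^sup>+x. ennreal (indicator S x *\<^sub>R ?D x) \<partial>lborel) = \<infinity>")
    case False
    have "integrable lborel (\<lambda>x. indicator S x *\<^sub>R ?D x)"
      using False meas by (intro integrableI_nonneg) (auto simp: top.not_eq_extremum)
    then have int: "set_integrable lborel S ?D" by (simp add: set_integrable_def)
    have "(?D has_integral (LINT x:S|lborel. ?D x)) S"
      using set_borel_integral_eq_integral[OF int] by (simp add: has_integral_iff)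
    with iff have m: "h ` S \<in> lmeasurable" "measure lebesgue (h ` S) = (LINT x:S|lborel. ?D x)" by auto
    have "emeasure lborel (h ` S) = emeasure lebesgue (h ` S)" using S by simp
    also have "\<dots> = ennreal (LINT x:S|lborel. ?D x)"
      using m by (metis emeasure_eq_measure2)
    also have "\<dots> = (\<integral>\<^sup>+x. ennreal (indicator S x *\<^sub>R ?D x) \<partial>lborel)"
      unfolding set_lebesgue_integral_def
      using int unfolding set_integrable_def by (subst nn_integral_eq_integral) auto
    finally show ?thesis using eq by simp
  next
    case True
    have "h ` S \<notin> lmeasurable"
    proof
      assume "h ` S \<in> lmeasurable"
      then have "(?D has_integral (measure lebesgue (h ` S))) S" using iff by blast
      then have "?D absolutely_integrable_on S"
        by (intro nonnegative_absolutely_integrable_1) (auto simp: has_integral_iff)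
      then have "set_integrable lebesgue S ?D" by simp
      then have "integrable lebesgue (\<lambda>x. indicator S x *\<^sub>R ?D x)" by (simp add: set_integrable_def)
      then have "integrable lborel (\<lambda>x. indicator S x *\<^sub>R ?D x)"
        using meas by (simp add: integrable_completion)
      then show False using True by (auto simp: integrable_iff_bounded)
    qed
    then have "emeasure lebesgue (h ` S) = \<infinity>"
      using sets fmeasurableI[of "h ` S" lebesgue] by (metis infinity_ennreal_def less_top)
    then show ?thesis using True eq S by simp
  qed
qed

lemma emeasure_injective_image:
  fixes g :: "'a::euclidean_space \<Rightarrow> 'a"
  assumes S: "S \<in> sets borel" "g ` S \<in> sets borel"
    and g: "\<And>x. x \<in> S \<Longrightarrow> (g has_derivative g' x) (at x within S)" "inj_on g S"
    and meas: "(\<lambda>x. indicator S x *\<^sub>R \<bar>rdet (g' x)\<bar>) \<in> borel_measurable borel"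
  shows "emeasure lborel (g ` S) = (\<integral>\<^sup>+x. indicator S x * ennreal \<bar>rdet (g' x)\<bar> \<partial>lborel)"
proof -
  define h where "h v = coord (g (uncoord v))" for v
  define h' where "h' v = (\<lambda>u. coord (g' (uncoord v) (uncoord u)))" for v
  let ?T = "coord ` S"
  have img: "h ` ?T = coord ` (g ` S)" by (auto simp: h_def image_image)
  have T: "?T \<in> sets borel" "h ` ?T \<in> sets borel"
    unfolding img unfolding coord_image
    using S measurable_sets[OF measurable_uncoord] by auto
  have T_eq: "uncoord -` (g ` S) = h ` ?T"
    using coord_image[of "g ` S"] img by simp
  have der: "(h has_derivative h' v) (at v within ?T)" if "v \<in> ?T" for v
  proof -
    have 1: "(uncoord has_derivative uncoord) (at v within ?T)"
      by (intro bounded_linear_imp_has_derivative bounded_linear_uncoord)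
    have "uncoord ` ?T = S" by (auto simp: image_image)
    moreover have "uncoord v \<in> S" using that by auto
    ultimately have 2: "(g has_derivative g' (uncoord v)) (at (uncoord v) within uncoord ` ?T)"
      using g by auto
    show ?thesis
      using bounded_linear.has_derivative[OF bounded_linear_coord diff_chain_within[OF 1 2]]
      unfolding o_def h_def[abs_def] h'_def .
  qed
  have inj: "inj_on h ?T"
    using g(2) by (auto simp: inj_on_def h_def) (metis uncoord_coord)
  have rd: "rdet (g' x) = det (matrix (h' (coord x)))" for x
    by (simp add: rdet_def h'_def)
  have ind: "indicator ?T v = (indicator S (uncoord v) :: 'b::zero_neq_one)" for v
    by (auto simp: indicator_def) (metis coord_uncoord imageI)
  have meas': "(\<lambda>v. indicator ?T v *\<^sub>R \<bar>det (matrix (h' v))\<bar>) \<in> borel_measurable borel"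
    using measurable_compose[OF measurable_uncoord meas] by (simp add: rd ind)
  have "emeasure lborel (g ` S) = emeasure (distr lborel borel uncoord) (g ` S)"
    by (simp add: distr_uncoord)
  also have "\<dots> = emeasure lborel (h ` ?T)"
    using S by (subst emeasure_distr) (auto simp: T_eq)
  also have "\<dots> = (\<integral>\<^sup>+v. indicator ?T v * ennreal \<bar>det (matrix (h' v))\<bar> \<partial>lborel)"
    by (rule emeasure_injective_image_cart[OF T der inj meas'])
  also have "\<dots> = (\<integral>\<^sup>+v. (indicator ?T v *\<^sub>R \<bar>det (matrix (h' v))\<bar>) \<partial>distr lborel borel coord)"
    unfolding distr_coord by (intro nn_integral_cong) (auto simp: indicator_def)
  also have "\<dots> = (\<integral>\<^sup>+x. (indicator ?T (coord x) *\<^sub>R \<bar>det (matrix (h' (coord x)))\<bar>) \<partial>lborel)"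
    using meas' by (subst nn_integral_distr) auto
  also have "\<dots> = (\<integral>\<^sup>+x. indicator S x * ennreal \<bar>rdet (g' x)\<bar> \<partial>lborel)"
    unfolding ind rd by (intro nn_integral_cong) (simp split: split_indicator)
  finally show ?thesis .
qed

lemma rdet_compose:
  assumes "linear L" "linear M"
  shows "rdet (L \<circ> M) = rdet L * rdet M"
proof -
  let ?c = "\<lambda>L v. coord (L (uncoord v))"
  have lin: "linear (?c L)" if "linear L" for L :: "'a \<Rightarrow> 'a"
    using linear_compose[OF linear_compose[OF linear_uncoord that] linear_coord] by (simp add: o_def)
  have "?c (L \<circ> M) = ?c L \<circ> ?c M" by (auto simp: fun_eq_iff)
  then show ?thesis
    unfolding rdet_def using matrix_compose[OF lin[OF assms(2)] lin[OF assms(1)]] by (simp add: det_mul)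
qed

lemma rdet_id: "rdet (\<lambda>x. x) = 1"
  by (simp add: rdet_def matrix_id_mat_1[unfolded id_def])

lemma rdet_eq_0:
  assumes "linear L" "\<not> inj L"
  shows "rdet L = 0"
proof -
  let ?c = "\<lambda>v. coord (L (uncoord v))"
  have lin: "linear ?c"
    using linear_compose[OF linear_compose[OF linear_uncoord assms(1)] linear_coord] by (simp add: o_def)
  have "\<not> inj ?c"
  proof
    assume "inj ?c"
    then have "inj (\<lambda>x. L x)" by (auto simp: inj_def) (metis coord_uncoord uncoord_coord)
    with assms show False by simp
  qed
  then show ?thesis using lin det_nz_iff_inj unfolding rdet_def by blast
qed

lemma emeasure_linear_image:
  fixes L :: "'a::euclidean_space \<Rightarrow> 'a"
  assumes "linear L" "inj L" "S \<in> sets borel" "L ` S \<in> sets borel"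
  shows "emeasure lborel (L ` S) = ennreal \<bar>rdet L\<bar> * emeasure lborel S"
proof -
  have "emeasure lborel (L ` S) = (\<integral>\<^sup>+x. indicator S x * ennreal \<bar>rdet L\<bar> \<partial>lborel)"
    using assms by (intro emeasure_injective_image)
      (auto simp: inj_on_def inj_def intro!: bounded_linear_imp_has_derivative linear_linear[THEN iffD2])
  also have "\<dots> = ennreal \<bar>rdet L\<bar> * emeasure lborel S"
    using assms by (simp add: nn_integral_multc nn_integral_cmult mult.commute)
  finally show ?thesis .
qed

text \<open>An isometry maps the unit ball onto itself, and the unit ball has positive finite measure.\<close>

lemma abs_rdet_isometry:
  fixes L :: "'a::euclidean_space \<Rightarrow> 'a"
  assumes L: "linear L" and norm: "\<And>x. norm (L x) = norm x"
  shows "\<bar>rdet L\<bar> = 1"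
proof -
  have inj: "inj L" using L norm by (metis linear_injective_0 norm_eq_zero)
  then have surj: "surj L" using L linear_injective_imp_surjective by blast
  have "x \<in> L ` ball 0 1" if "norm x < 1" for x
  proof -
    obtain y where "x = L y" using surj by (meson surjD)
    with that norm show ?thesis by auto
  qed
  then have "L ` ball 0 1 = ball 0 1" using norm by auto
  then have "emeasure lborel (ball (0::'a) 1) = ennreal \<bar>rdet L\<bar> * emeasure lborel (ball (0::'a) 1)"
    using emeasure_linear_image[OF L inj, of "ball 0 1"] by simp
  moreover have "emeasure lborel (ball (0::'a) 1) \<noteq> 0" "emeasure lborel (ball (0::'a) 1) \<noteq> \<infinity>"
    using emeasure_lborel_ball_finite[of "0::'a" 1] content_ball_pos[of 1 "0::'a"]
    by (auto simp: measure_def)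
  ultimately have "ennreal \<bar>rdet L\<bar> = 1"
    by (metis ennreal_mult_divide_eq ennreal_divide_self mult.commute infinity_ennreal_def top.not_eq_extremum)
  then show ?thesis by (simp add: ennreal_eq_1)
qed

lemma lborel_isometry:
  fixes L :: "'a::euclidean_space \<Rightarrow> 'a"
  assumes L: "linear L" and norm: "\<And>x. norm (L x) = norm x"
  shows "distr lborel borel L = lborel"
proof (rule measure_eqI)
  fix A assume "A \<in> sets (distr lborel borel L)"
  then have A: "A \<in> sets borel" by simp
  have inj: "inj L" using L norm by (metis linear_injective_0 norm_eq_zero)
  then have surj: "surj L" using L linear_injective_imp_surjective by blast
  have meas: "L \<in> borel_measurable borel"
    using L by (intro borel_measurable_continuous_onI linear_continuous_on) (simp add: linear_linear)
  have img: "L ` (L -` A) = A" using surj by (rule surj_image_vimage_eq)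
  have "emeasure (distr lborel borel L) A = emeasure lborel (L -` A)"
    using A meas by (subst emeasure_distr) auto
  also have "\<dots> = emeasure lborel (L ` (L -` A))"
    using A img measurable_sets[OF meas A]
    by (subst emeasure_linear_image[OF L inj]) (auto simp: abs_rdet_isometry[OF L norm])
  finally show "emeasure (distr lborel borel L) A = emeasure lborel A" unfolding img .
qed simp

text \<open>The formula for measures of images, restated as an equality of measures, from which the formula
  for integrals follows by the rules for image measures and densities. The indicator in front of
  \<open>g\<close> makes the map Borel measurable on the whole space; the densities do not see it.\<close>

lemma distr_injective_image:
  fixes g :: "'a::euclidean_space \<Rightarrow> 'a"
  assumes S: "S \<in> sets borel" "g ` S \<in> sets borel"
    and g: "\<And>x. x \<in> S \<Longrightarrow> (g has_derivative g' x) (at x within S)" "inj_on g S"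
    and meas: "(\<lambda>x. indicator S x *\<^sub>R \<bar>rdet (g' x)\<bar>) \<in> borel_measurable borel"
  shows "distr (density lborel (\<lambda>x. ennreal (indicator S x *\<^sub>R \<bar>rdet (g' x)\<bar>))) borel
           (\<lambda>x. indicator S x *\<^sub>R g x) = density lborel (\<lambda>y. ennreal (indicator (g ` S) y))"
    (is "distr ?M borel ?g = ?N")
proof (rule measure_eqI)
  fix A assume "A \<in> sets (distr ?M borel ?g)"
  then have A: "A \<in> sets borel" by simp
  have cont: "continuous_on S g"
    using g(1) has_derivative_continuous_on by blast
  then have mg: "?g \<in> borel_measurable borel"
    by (rule borel_measurable_continuous_on_indicator[OF S(1)])
  let ?T = "S \<inter> ?g -` A"
  have T: "?T \<in> sets borel" using S(1) measurable_sets[OF mg A] by auto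
  have img: "g ` ?T = g ` S \<inter> A" by (auto simp: indicator_def)
  have T': "g ` ?T \<in> sets borel" unfolding img using S A by auto
  have meas': "(\<lambda>x. indicator ?T x *\<^sub>R \<bar>rdet (g' x)\<bar>) \<in> borel_measurable borel"
  proof -
    have "(\<lambda>x. indicator ?T x *\<^sub>R (indicator S x *\<^sub>R \<bar>rdet (g' x)\<bar>)) \<in> borel_measurable borel"
      using meas T by measurable
    moreover have "(\<lambda>x. indicator ?T x *\<^sub>R (indicator S x *\<^sub>R \<bar>rdet (g' x)\<bar>)) = (\<lambda>x. indicator ?T x *\<^sub>R \<bar>rdet (g' x)\<bar>)"
      by (auto simp: indicator_def)
    ultimately show ?thesis by simp
  qed
  have "emeasure (distr ?M borel ?g) A = emeasure ?M (?g -` A)"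
    using A mg by (subst emeasure_distr) auto
  also have "\<dots> = (\<integral>\<^sup>+x. ennreal (indicator S x *\<^sub>R \<bar>rdet (g' x)\<bar>) * indicator (?g -` A) x \<partial>lborel)"
    using meas measurable_sets[OF mg A] by (subst emeasure_density) auto
  also have "\<dots> = (\<integral>\<^sup>+x. indicator ?T x * ennreal \<bar>rdet (g' x)\<bar> \<partial>lborel)"
    by (intro nn_integral_cong) (auto simp: indicator_def)
  also have "\<dots> = emeasure lborel (g ` ?T)"
    using g by (intro emeasure_injective_image[symmetric, OF T T' _ _ meas'])
      (auto intro: has_derivative_subset inj_on_subset)
  also have "\<dots> = emeasure ?N A"
    unfolding img using S A by (subst emeasure_density) (auto simp: ennreal_indicator indicator_inter_arith[symmetric] nn_integral_indicator)
  finally show "emeasure (distr ?M borel ?g) A = emeasure ?N A" .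
qed simp

lemma integral_injective_image:
  fixes g :: "'a::euclidean_space \<Rightarrow> 'a" and f :: "'a \<Rightarrow> 'b::{banach, second_countable_topology}"
  assumes S: "S \<in> sets borel" "g ` S \<in> sets borel"
    and g: "\<And>x. x \<in> S \<Longrightarrow> (g has_derivative g' x) (at x within S)" "inj_on g S"
    and meas: "(\<lambda>x. indicator S x *\<^sub>R \<bar>rdet (g' x)\<bar>) \<in> borel_measurable borel"
    and f: "set_borel_measurable borel (g ` S) f"
  shows "set_integrable lborel (g ` S) f \<longleftrightarrow> set_integrable lborel S (\<lambda>x. \<bar>rdet (g' x)\<bar> *\<^sub>R f (g x))"
    and "(LINT y:g ` S|lborel. f y) = (LINT x:S|lborel. \<bar>rdet (g' x)\<bar> *\<^sub>R f (g x))"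
proof -
  let ?f = "\<lambda>y. indicator (g ` S) y *\<^sub>R f y"
  let ?M = "density lborel (\<lambda>x. ennreal (indicator S x *\<^sub>R \<bar>rdet (g' x)\<bar>))"
  let ?g = "\<lambda>x. indicator S x *\<^sub>R g x"
  let ?N = "density lborel (\<lambda>y. ennreal (indicator (g ` S) y))"
  have f': "?f \<in> borel_measurable borel" using f by (simp add: set_borel_measurable_def)
  have "continuous_on S g" using g(1) has_derivative_continuous_on by blast
  then have mg: "?g \<in> borel_measurable borel"
    by (rule borel_measurable_continuous_on_indicator[OF S(1)])
  have eq: "distr ?M borel ?g = ?N" by (rule distr_injective_image[OF S g meas])
  have fg: "(\<lambda>x. ?f (?g x)) \<in> borel_measurable borel"
    using measurable_compose[OF mg f'] .
  have pt: "(indicator S x * \<bar>rdet (g' x)\<bar> * indicator (g ` S) (?g x)) *\<^sub>R f (?g x) = (indicator S x * \<bar>rdet (g' x)\<bar>) *\<^sub>R f (g x)" for x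
    by (auto simp: indicator_def)
  have "set_integrable lborel (g ` S) f \<longleftrightarrow> integrable ?N ?f"
    unfolding set_integrable_def using S f' by (subst integrable_density) (auto simp: indicator_inter_arith[symmetric])
  also have "\<dots> \<longleftrightarrow> integrable ?M (\<lambda>x. ?f (?g x))"
    unfolding eq[symmetric] using mg f' by (subst integrable_distr_eq) auto
  also have "\<dots> \<longleftrightarrow> set_integrable lborel S (\<lambda>x. \<bar>rdet (g' x)\<bar> *\<^sub>R f (g x))"
    unfolding set_integrable_def using fg meas by (subst integrable_density) (auto simp: pt)
  finally show "set_integrable lborel (g ` S) f \<longleftrightarrow> set_integrable lborel S (\<lambda>x. \<bar>rdet (g' x)\<bar> *\<^sub>R f (g x))" .
  have "(LINT y:g ` S|lborel. f y) = integral\<^sup>L ?N ?f"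
    unfolding set_lebesgue_integral_def using S f' by (subst integral_density) (auto simp: indicator_inter_arith[symmetric])
  also have "\<dots> = integral\<^sup>L ?M (\<lambda>x. ?f (?g x))"
    unfolding eq[symmetric] using mg f' by (subst integral_distr) auto
  also have "\<dots> = (LINT x:S|lborel. \<bar>rdet (g' x)\<bar> *\<^sub>R f (g x))"
    unfolding set_lebesgue_integral_def using fg meas by (subst integral_density) (auto simp: pt)
  finally show "(LINT y:g ` S|lborel. f y) = (LINT x:S|lborel. \<bar>rdet (g' x)\<bar> *\<^sub>R f (g x))" .
qed

section \<open>Complex linear maps and their real determinant\<close>

text \<open>Multiplying by this matrix from the left is one step of Gauss-Jordan elimination: row
  \<open>k\<close> is scaled and multiples of it are added to the other rows.\<close>

definition column_matrix :: "'n \<Rightarrow> 'a::field^'n \<Rightarrow> 'a^'n^'n" where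
  "column_matrix k v = (\<chi> i j. if j = k then v $ i else if i = j then 1 else 0)"

lemma column_matrix_nth: "column_matrix k v $ i $ j = (if j = k then v $ i else if i = j then 1 else 0)"
  by (simp add: column_matrix_def)

lemma column_matrix_mult:
  "(column_matrix k v ** A) $ i $ j = v $ i * A $ k $ j + (if i = k then 0 else A $ i $ j)"
proof -
  have "(column_matrix k v ** A) $ i $ j =
      (\<Sum>l\<in>UNIV. (if l = k then v $ i * A $ k $ j else 0) + (if l = i then (if i = k then 0 else A $ i $ j) else 0))"
    unfolding matrix_matrix_mult_def vec_lambda_beta by (rule sum.cong) (auto simp: column_matrix_nth)
  then show ?thesis by (simp add: sum.distrib)
qed

lemma column_matrix_vec:
  "(column_matrix k v *v z) $ i = v $ i * z $ k + (if i = k then 0 else z $ i)"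
proof -
  have "(column_matrix k v *v z) $ i =
      (\<Sum>l\<in>UNIV. (if l = k then v $ i * z $ k else 0) + (if l = i then (if i = k then 0 else z $ i) else 0))"
    unfolding matrix_vector_mult_def vec_lambda_beta by (rule sum.cong) (auto simp: column_matrix_nth)
  then show ?thesis by (simp add: sum.distrib)
qed

text \<open>Gauss-Jordan elimination: every invertible matrix is a product of matrices that differ from the
  identity in one column.\<close>

lemma invertible_matrix_induct:
  fixes A :: "'a::field^'n^'n"
  assumes A: "invertible A"
    and one: "P (mat 1)"
    and step: "\<And>k v A. v $ k \<noteq> 0 \<Longrightarrow> P A \<Longrightarrow> P (column_matrix k v ** A)"
  shows "P A"
proof -
  \<comment> \<open>Induction on the number of columns that are not yet unit vectors;
    \<open>K\<close> is the set of those that are.\<close>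
  have "P A" if "invertible A" "\<And>i j. j \<in> K \<Longrightarrow> A $ i $ j = (if i = j then 1 else 0)" for K and A :: "'a^'n^'n"
    using that
  proof (induction "card (- K)" arbitrary: K A)
    case 0
    then have "K = UNIV" by auto
    then have "A $ i $ j = (if i = j then 1 else 0)" for i j using 0(3)[of j i] by blast
    then have "A = mat 1" by (simp add: vec_eq_iff mat_def)
    then show ?case using one by simp
  next
    case (Suc c)
    have "- K \<noteq> {}" using Suc(2) by (metis card.empty nat.simps(3))
    then obtain k where k: "k \<notin> K" by blast
    have c: "c = card (- insert k K)"
      using Suc(2) k by (simp add: Compl_insert)
    have inv: "invertible (column_matrix m v ** B)" if "invertible B" "v $ m \<noteq> 0" for m v and B :: "'a^'n^'n"
    proof -
      let ?w = "\<chi> i. if i = m then 1 / v $ m else - v $ i / v $ m"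
      have "column_matrix m v ** column_matrix m ?w = mat 1" "column_matrix m ?w ** column_matrix m v = mat 1"
        using that(2) by (auto simp: vec_eq_iff column_matrix_mult mat_def column_matrix_nth field_simps)
      then have "invertible (column_matrix m v)" by (auto simp: invertible_def)
      then show ?thesis using that(1) by (simp add: invertible_mult)
    qed
    have pivot: "P B" if B: "invertible B" "\<And>i j. j \<in> K \<Longrightarrow> B $ i $ j = (if i = j then 1 else 0)" "B $ k $ k \<noteq> 0"
      for B :: "'a^'n^'n"
    proof -
      let ?w = "\<chi> i. if i = k then 1 / B $ k $ k else - B $ i $ k / B $ k $ k"
      let ?v = "\<chi> i. B $ i $ k"
      have "P (column_matrix k ?w ** B)"
      proof (rule Suc(1)[OF c])
        show "invertible (column_matrix k ?w ** B)" by (rule inv) (use B in auto)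
        fix i j assume "j \<in> insert k K"
        then show "(column_matrix k ?w ** B) $ i $ j = (if i = j then 1 else 0)"
          using B k by (auto simp: column_matrix_mult)
      qed
      then have "P (column_matrix k ?v ** (column_matrix k ?w ** B))"
        by (rule step[rotated]) (use B in auto)
      also have "column_matrix k ?v ** (column_matrix k ?w ** B) = B"
        using B by (auto simp: vec_eq_iff column_matrix_mult field_simps)
      finally show ?thesis .
    qed
    show ?case
    proof (cases "A $ k $ k = 0")
      case False
      then show ?thesis using pivot Suc by blast
    next
      case True
      \<comment> \<open>A pivot in column \<open>k\<close> exists outside the finished rows:
        otherwise that column is a combination of finished columns, which produces a kernel
        vector.\<close>
      have "\<exists>i. i \<notin> K \<and> A $ i $ k \<noteq> 0"
      proof (rule ccontr)
        assume no: "\<nexists>i. i \<notin> K \<and> A $ i $ k \<noteq> 0"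
        define x :: "'a^'n" where "x = (\<chi> j. if j = k then 1 else if j \<in> K then - A $ j $ k else 0)"
        have "(A *v x) $ i = 0" for i
        proof -
          have "(A *v x) $ i = (\<Sum>j\<in>UNIV. (if j = k then A $ i $ k else 0) + (if j = i then (if i \<in> K then - A $ i $ k else 0) else 0))"
            unfolding matrix_vector_mult_def vec_lambda_beta
          proof (rule sum.cong)
            fix j
            show "A $ i $ j * x $ j = (if j = k then A $ i $ k else 0) + (if j = i then (if i \<in> K then - A $ i $ k else 0) else 0)"
              using Suc(4)[of j i] k by (auto simp: x_def)
          qed simp
          then show ?thesis using no by (auto simp: sum.distrib)
        qed
        then have "A *v x = 0" by (simp add: vec_eq_iff)
        then have "x = 0" using Suc(3) by (metis invertible_def matrix_left_invertible_ker)
        then have "x $ k = 0" by simp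
        then show False by (simp add: x_def)
      qed
      then obtain i where i: "i \<notin> K" "A $ i $ k \<noteq> 0" by blast
      with True have ik: "i \<noteq> k" by auto
      \<comment> \<open>Adding row \<open>i\<close> to row \<open>k\<close> makes the diagonal entry
        nonzero; \<open>?v\<close> undoes this.\<close>
      let ?u = "\<chi> l. if l = i \<or> l = k then 1 else (0::'a)"
      let ?v = "\<chi> l. if l = i then 1 else if l = k then - 1 else (0::'a)"
      have "P (column_matrix i ?u ** A)"
      proof (rule pivot)
        show "invertible (column_matrix i ?u ** A)" by (rule inv) (use Suc in auto)
        show "(column_matrix i ?u ** A) $ k $ k \<noteq> 0" using True i ik by (simp add: column_matrix_mult)
        fix l j assume "j \<in> K"
        then show "(column_matrix i ?u ** A) $ l $ j = (if l = j then 1 else 0)"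
          using Suc(4)[of j] i k ik by (auto simp: column_matrix_mult)
      qed
      then have "P (column_matrix i ?v ** (column_matrix i ?u ** A))"
        by (rule step[rotated]) simp
      also have "column_matrix i ?v ** (column_matrix i ?u ** A) = A"
        using ik by (auto simp: vec_eq_iff column_matrix_mult)
      finally show ?thesis .
    qed
  qed
  from this[OF A, of "{}"] show ?thesis by auto
qed

text \<open>A nonnegative multiplicative function of matrices does not see shears: with \<open>D\<close> the
  diagonal reflection in coordinate \<open>k\<close>, the shear \<open>U\<close> satisfies
  \<open>D U D = U\<^sup>-\<^sup>1\<close>, so its value squares to one. Hence only the diagonal
  entry of the column counts.\<close>

lemma multiplicative_column_matrix:
  fixes \<phi> :: "'a::field^'n^'n \<Rightarrow> real"
  assumes mult: "\<And>A B. \<phi> (A ** B) = \<phi> A * \<phi> B" and nonneg: "\<And>A. \<phi> A \<ge> 0" and one: "\<phi> (mat 1) = 1"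
    and v: "v $ k \<noteq> 0"
  shows "\<phi> (column_matrix k v) = \<phi> (column_matrix k (axis k (v $ k)))"
proof -
  let ?u = "\<chi> i. v $ i / v $ k" and ?D = "column_matrix k (axis k (- 1))"
  let ?U = "column_matrix k ?u"
  have "?D ** ?D = mat 1"
    by (auto simp: vec_eq_iff column_matrix_mult mat_def column_matrix_nth axis_def)
  from arg_cong[OF this, of \<phi>] have D: "\<phi> ?D * \<phi> ?D = 1" by (simp only: mult one)
  have "?D ** (?U ** (?D ** ?U)) = mat 1"
    using v by (auto simp: vec_eq_iff column_matrix_mult mat_def column_matrix_nth axis_def)
  from arg_cong[OF this, of \<phi>] have "\<phi> ?D * (\<phi> ?U * (\<phi> ?D * \<phi> ?U)) = 1" by (simp only: mult one)
  then have "(\<phi> ?D * \<phi> ?D) * (\<phi> ?U)\<^sup>2 = 1" by (simp only: power2_eq_square mult_ac)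
  then have "(\<phi> ?U)\<^sup>2 = 1" using D by simp
  then have "\<phi> ?U = 1" using nonneg[of ?U] by (simp add: power2_eq_1_iff)
  moreover have "column_matrix k v = ?U ** column_matrix k (axis k (v $ k))"
    using v by (auto simp: vec_eq_iff column_matrix_mult column_matrix_nth axis_def)
  ultimately show ?thesis using mult by simp
qed

lemma Basis_cvec: "(Basis :: (complex^'n) set) = (\<lambda>i. axis i 1) ` UNIV \<union> (\<lambda>i. axis i \<i>) ` UNIV"
  by (auto simp: Basis_vec_def Basis_complex_def)

lemma ball_Basis_cvec: "(\<forall>b\<in>(Basis :: (complex^'n) set). P b) \<longleftrightarrow> (\<forall>i. P (axis i 1) \<and> P (axis i \<i>))"
  unfolding Basis_cvec by auto

lemma prod_Basis_cvec:
  "(\<Prod>b\<in>(Basis :: (complex^'n) set). f b) = (\<Prod>i\<in>UNIV. f (axis i 1) * f (axis i \<i>))"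
proof -
  have "(\<Prod>b\<in>(Basis :: (complex^'n) set). f b) = prod f ((\<lambda>i. axis i 1) ` UNIV) * prod f ((\<lambda>i. axis i \<i>) ` UNIV)"
    unfolding Basis_cvec by (rule prod.union_disjoint) (auto simp: axis_eq_axis)
  also have "\<dots> = (\<Prod>i\<in>UNIV. f (axis i 1)) * (\<Prod>i\<in>UNIV. f (axis i \<i>))"
    by (simp add: prod.reindex inj_on_def axis_eq_axis)
  finally show ?thesis by (simp add: prod.distrib)
qed

lemma linear_matrix_cvec: "linear ((*v) (A :: complex^'n^'m))"
  by (rule linearI) (auto simp: vec_eq_iff matrix_vector_mult_def scaleR_sum_right sum.distrib algebra_simps)

text \<open>Multiplication of one coordinate by \<open>c\<close> is a rotation, which is an isometry, after
  a scaling by \<open>\<bar>c\<bar>\<close>, which stretches a unit box in two real directions.\<close>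

lemma abs_rdet_column_matrix_axis:
  fixes c :: complex
  assumes "c \<noteq> 0"
  shows "\<bar>rdet ((*v) (column_matrix k (axis k c) :: complex^'n^'n))\<bar> = (cmod c)\<^sup>2"
proof -
  have L: "column_matrix k (axis k c) *v z = (\<chi> i. if i = k then c * z $ i else z $ i)" for z :: "complex^'n" and c
    by (auto simp: vec_eq_iff column_matrix_vec axis_def)
  define \<rho> where "\<rho> = cmod c"
  have \<rho>: "\<rho> > 0" using assms by (simp add: \<rho>_def)
  let ?R = "column_matrix k (axis k (c / \<rho>)) :: complex^'n^'n"
  let ?T = "column_matrix k (axis k (of_real \<rho>)) :: complex^'n^'n"
  have "(*v) (column_matrix k (axis k c) :: complex^'n^'n) = (*v) ?R \<circ> (*v) ?T"
    using \<rho> by (auto simp: fun_eq_iff L vec_eq_iff)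
  then have "rdet ((*v) (column_matrix k (axis k c) :: complex^'n^'n)) = rdet ((*v) ?R) * rdet ((*v) ?T)"
    by (simp add: rdet_compose linear_matrix_cvec)
  moreover have "\<bar>rdet ((*v) ?R)\<bar> = 1"
  proof (rule abs_rdet_isometry[OF linear_matrix_cvec])
    show "norm (?R *v z) = norm z" for z :: "complex^'n"
      unfolding L norm_vec_def using \<rho> by (intro arg_cong[where f="\<lambda>x. L2_set x UNIV"]) (auto simp: fun_eq_iff \<rho>_def norm_mult norm_divide)
  qed
  moreover have "\<bar>rdet ((*v) ?T)\<bar> = \<rho>\<^sup>2"
  proof -
    define w :: "complex^'n" where "w = (\<chi> i. if i = k then Complex \<rho> \<rho> else Complex 1 1)"
    define e :: "complex^'n" where "e = (\<chi> i. Complex 1 1)"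
    have box: "z \<in> box a b \<longleftrightarrow> (\<forall>i. Re (a $ i) < Re (z $ i) \<and> Re (z $ i) < Re (b $ i) \<and> Im (a $ i) < Im (z $ i) \<and> Im (z $ i) < Im (b $ i))"
      for z a b :: "complex^'n"
      by (auto simp: box_def ball_Basis_cvec inner_axis inner_complex_def)
    have "?T *v z \<in> box 0 w" if "z \<in> box 0 e" for z
      using that \<rho> unfolding box L by (auto simp: w_def e_def)
    moreover have "z \<in> (*v) ?T ` box 0 e" if "z \<in> box 0 w" for z
    proof (rule image_eqI)
      show "z = ?T *v (\<chi> i. if i = k then z $ i / \<rho> else z $ i)" using \<rho> by (auto simp: L vec_eq_iff)
      show "(\<chi> i. if i = k then z $ i / \<rho> else z $ i) \<in> box 0 e"
        using that \<rho> unfolding box by (auto simp: w_def e_def Re_divide_of_real Im_divide_of_real split: if_splits)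
    qed
    ultimately have img: "(*v) ?T ` box 0 e = box 0 w" by auto
    have inj: "inj ((*v) ?T)" using \<rho> by (auto simp: inj_def L vec_eq_iff split: if_splits)
    have "\<forall>b\<in>Basis. 0 \<bullet> b \<le> e \<bullet> b" "\<forall>b\<in>Basis. 0 \<bullet> b \<le> w \<bullet> b"
      using \<rho> unfolding ball_Basis_cvec by (auto simp: e_def w_def inner_axis inner_complex_def)
    then have le: "0 \<bullet> b \<le> e \<bullet> b" "0 \<bullet> b \<le> w \<bullet> b" if "b \<in> Basis" for b using that by blast+
    have e: "emeasure lborel (box 0 e) = 1"
      by (subst emeasure_lborel_box[OF le(1)]) (auto simp: prod_Basis_cvec inner_axis inner_complex_def e_def)
    have "(\<Prod>i\<in>UNIV. Re (w $ i) * Im (w $ i)) = (\<Prod>i\<in>UNIV. if i = k then \<rho>\<^sup>2 else 1)"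
      by (intro prod.cong) (auto simp: w_def power2_eq_square)
    then have w: "emeasure lborel (box 0 w) = ennreal (\<rho>\<^sup>2)"
      using \<rho> by (subst emeasure_lborel_box[OF le(2)]) (auto simp: prod_Basis_cvec inner_axis inner_complex_def)
    have "emeasure lborel ((*v) ?T ` box 0 e) = ennreal \<bar>rdet ((*v) ?T)\<bar> * emeasure lborel (box 0 e)"
      by (rule emeasure_linear_image[OF linear_matrix_cvec inj]) (auto simp: img)
    then show ?thesis unfolding img e w by simp
  qed
  ultimately show ?thesis by (simp add: abs_mult \<rho>_def)
qed

text \<open>The real determinant of a complex linear map is the squared modulus of its complex determinant.
  Both sides are multiplicative, so by Gauss-Jordan elimination it suffices to compare them on
  scalings of one coordinate; no real matrix has to be written down.\<close>

lemma abs_rdet_matrix: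
  fixes A :: "complex^'n^'n"
  shows "\<bar>rdet ((*v) A)\<bar> = (cmod (det A))\<^sup>2"
proof (cases "invertible A")
  case False
  then have "\<not> inj ((*v) A)"
    by (metis invertible_left_inverse matrix_left_invertible_injective)
  then have "rdet ((*v) A) = 0" by (intro rdet_eq_0 linear_matrix_cvec)
  then show ?thesis using False by (simp add: invertible_det_nz)
next
  case True
  let ?\<phi> = "\<lambda>A :: complex^'n^'n. \<bar>rdet ((*v) A)\<bar>" and ?\<psi> = "\<lambda>A :: complex^'n^'n. (cmod (det A))\<^sup>2"
  have comp: "(*v) (A ** B) = (*v) A \<circ> (*v) B" for A B :: "complex^'n^'n"
    by (auto simp: fun_eq_iff matrix_vector_mul_assoc)
  have \<phi>: "?\<phi> (A ** B) = ?\<phi> A * ?\<phi> B" for A B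
    unfolding comp by (simp add: rdet_compose linear_matrix_cvec abs_mult)
  have \<phi>1: "?\<phi> (mat 1) = 1"
    using rdet_id[where 'a="complex^'n"] by (simp add: matrix_vector_mul_lid[abs_def])
  have \<psi>: "?\<psi> (A ** B) = ?\<psi> A * ?\<psi> B" for A B
    by (simp add: det_mul norm_mult power_mult_distrib)
  have d: "det (column_matrix k (axis k c) :: complex^'n^'n) = c" for k c
  proof -
    have "(column_matrix k (axis k c) :: complex^'n^'n) $ i $ i = (if i = k then c else 1)" for i
      by (auto simp: column_matrix_nth)
    then show ?thesis
      by (subst det_diagonal) (auto simp: column_matrix_nth axis_def)
  qed
  have eq: "?\<phi> (column_matrix k v) = ?\<psi> (column_matrix k v)" if v: "v $ k \<noteq> 0" for k and v :: "complex^'n"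
  proof -
    have "?\<phi> (column_matrix k v) = ?\<phi> (column_matrix k (axis k (v $ k)))"
      by (rule multiplicative_column_matrix[of ?\<phi> v k, OF \<phi> _ \<phi>1 v]) simp
    also have "\<dots> = ?\<psi> (column_matrix k (axis k (v $ k)))"
      using v by (simp add: abs_rdet_column_matrix_axis d)
    also have "\<dots> = ?\<psi> (column_matrix k v)"
      by (rule multiplicative_column_matrix[of ?\<psi> v k, OF \<psi> _ _ v, symmetric]) (simp_all add: det_I)
    finally show ?thesis .
  qed
  show ?thesis
  proof (rule invertible_matrix_induct[OF True, where P="\<lambda>A. ?\<phi> A = ?\<psi> A"])
    show "?\<phi> (mat 1) = ?\<psi> (mat 1)" using \<phi>1 by (simp add: det_I)
  next
    fix k and v :: "complex^'n" and A :: "complex^'n^'n"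
    assume "v $ k \<noteq> 0" "?\<phi> A = ?\<psi> A"
    then show "?\<phi> (column_matrix k v ** A) = ?\<psi> (column_matrix k v ** A)"
      unfolding \<phi> \<psi> using eq by simp
  qed
qed

section \<open>Holomorphic functions of several variables\<close>

lemma norm_vector_smult: "norm (c *s (v::complex^'n)) = cmod c * norm v"
proof -
  have "norm (c *s v) = L2_set (\<lambda>i. cmod c * norm (v $ i)) UNIV"
    by (simp add: norm_vec_def norm_mult)
  also have "\<dots> = cmod c * norm v"
    by (simp add: norm_vec_def L2_set_right_distrib)
  finally show ?thesis .
qed

lemma bounded_linear_smult_left: "bounded_linear (\<lambda>t. t *s (v::complex^'n))"
  by (rule bounded_linear_intro[where K="norm v"])
     (auto simp: norm_vector_smult vec_eq_iff algebra_simps)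

lemma bounded_linear_smult_right: "bounded_linear (\<lambda>v. c *s (v::complex^'n))"
  by (rule bounded_linear_intro[where K="cmod c"])
     (auto simp: norm_vector_smult vec_eq_iff algebra_simps)

lemma continuous_on_smult [continuous_intros]:
  "continuous_on S f \<Longrightarrow> continuous_on S (\<lambda>x. f x *s (v::complex^'n))"
  by (rule bounded_linear.continuous_on[OF bounded_linear_smult_left])

lemma axis_eq_smult: "axis j t = t *s (axis j 1 :: complex^'n)"
  by (auto simp: vec_eq_iff axis_def)

lemma cvec_expansion: "(v::complex^'n) = (\<Sum>j\<in>UNIV. (v $ j) *s axis j 1)"
  by (simp add: vec_eq_iff axis_def if_distrib cong: if_cong)

lemma has_derivative_cvecI:
  fixes f :: "'a::real_normed_vector \<Rightarrow> complex^'n"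
  assumes "\<And>i. ((\<lambda>x. f x $ i) has_derivative (\<lambda>h. f' h $ i)) F"
  shows "(f has_derivative f') F"
proof -
  have "((\<lambda>x. \<Sum>i\<in>UNIV. (f x $ i) *s axis i 1) has_derivative (\<lambda>h. \<Sum>i\<in>UNIV. (f' h $ i) *s axis i 1)) F"
    by (intro has_derivative_sum bounded_linear.has_derivative[OF bounded_linear_smult_left] assms)
  then show ?thesis by (simp add: cvec_expansion[symmetric])
qed

lemma has_derivative_cvec_nth:
  fixes f :: "'a::real_normed_vector \<Rightarrow> complex^'n"
  assumes "(f has_derivative f') F"
  shows "((\<lambda>x. f x $ i) has_derivative (\<lambda>h. f' h $ i)) F"
  using bounded_linear.has_derivative[OF bounded_linear_vec_nth assms] .

lemma holo_on_open: "holo_on f U \<Longrightarrow> open U"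
  by (simp add: holo_on_def)

text \<open>Complex homogeneity of the derivative is easier to carry through compositions than the explicit
  form as a sum over the coordinates.\<close>

lemma holo_onI:
  fixes f :: "complex^'n \<Rightarrow> complex"
  assumes "open U"
    and "\<And>z. z \<in> U \<Longrightarrow> \<exists>f'. (f has_derivative f') (at z) \<and> (\<forall>c h. f' (c *s h) = c * f' h)"
  shows "holo_on f U"
  unfolding holo_on_def
proof (intro conjI ballI)
  fix z assume "z \<in> U"
  then obtain f' where f': "(f has_derivative f') (at z)" "\<And>c h. f' (c *s h) = c * f' h"
    using assms(2) by blast
  have lin: "linear f'" using f'(1) has_derivative_linear by blast
  have "f' h = (\<Sum>j\<in>UNIV. (\<chi> j. f' (axis j 1)) $ j * h $ j)" for h
  proof -
    have "f' h = f' (\<Sum>j\<in>UNIV. (h $ j) *s axis j 1)" using cvec_expansion[of h] by simp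
    also have "\<dots> = (\<Sum>j\<in>UNIV. h $ j * f' (axis j 1))"
      by (simp add: linear_sum[OF lin] f'(2))
    finally show ?thesis by (simp add: mult.commute)
  qed
  then have "f' = (\<lambda>h. \<Sum>j\<in>UNIV. (\<chi> j. f' (axis j 1)) $ j * h $ j)" by blast
  then show "\<exists>a::complex^'n. (f has_derivative (\<lambda>h. \<Sum>j\<in>UNIV. a $ j * h $ j)) (at z)"
    using f'(1) by metis
qed (rule assms(1))

lemma holo_onE:
  fixes f :: "complex^'n \<Rightarrow> complex"
  assumes "holo_on f U" "z \<in> U"
  obtains f' where "(f has_derivative f') (at z)" "\<And>c h. f' (c *s h) = c * f' h"
proof -
  obtain a :: "complex^'n" where a: "(f has_derivative (\<lambda>h. \<Sum>j\<in>UNIV. a $ j * h $ j)) (at z)"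
    using assms unfolding holo_on_def by blast
  show ?thesis by (rule that[OF a]) (simp add: sum_distrib_left mult.left_commute)
qed

lemma holo_on_continuous_on: "holo_on f U \<Longrightarrow> continuous_on U f"
  by (meson continuous_at_imp_continuous_on has_derivative_continuous holo_onE)

lemma holo_map_onE:
  fixes f :: "complex^'n \<Rightarrow> complex^'m"
  assumes "holo_map_on f U" "z \<in> U"
  obtains f' where "(f has_derivative f') (at z)" "\<And>c h. f' (c *s h) = c *s f' h"
proof -
  have "\<forall>i. \<exists>g. ((\<lambda>x. f x $ i) has_derivative g) (at z) \<and> (\<forall>c h. g (c *s h) = c * g h)"
    using assms unfolding holo_map_on_def by (meson holo_onE)
  then obtain g where g: "\<And>i. ((\<lambda>x. f x $ i) has_derivative g i) (at z)" "\<And>i c h. g i (c *s h) = c * g i h"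
    by metis
  show ?thesis
  proof (rule that)
    show "(f has_derivative (\<lambda>h. \<chi> i. g i h)) (at z)" by (rule has_derivative_cvecI) (simp add: g)
    show "(\<chi> i. g i (c *s h)) = c *s (\<chi> i. g i h)" for c h by (simp add: g vec_eq_iff)
  qed
qed

lemma holo_map_on_open: "holo_map_on f U \<Longrightarrow> open U"
  by (auto simp: holo_map_on_def holo_on_def)

lemma holo_map_on_continuous_on:
  assumes "holo_map_on f U" shows "continuous_on U f"
  by (meson assms continuous_at_imp_continuous_on has_derivative_continuous holo_map_onE)

lemma holo_map_onI:
  fixes f :: "complex^'n \<Rightarrow> complex^'m"
  assumes "open U"
    and "\<And>z. z \<in> U \<Longrightarrow> \<exists>f'. (f has_derivative f') (at z) \<and> (\<forall>c h. f' (c *s h) = c *s f' h)"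
  shows "holo_map_on f U"
  unfolding holo_map_on_def
proof (intro allI holo_onI assms(1))
  fix i z assume "z \<in> U"
  then obtain f' where "(f has_derivative f') (at z)" "\<And>c h. f' (c *s h) = c *s f' h"
    using assms(2) by blast
  then show "\<exists>g. ((\<lambda>x. f x $ i) has_derivative g) (at z) \<and> (\<forall>c h. g (c *s h) = c * g h)"
    by (intro exI[of _ "\<lambda>h. f' h $ i"]) (simp add: has_derivative_cvec_nth)
qed

lemma holo_on_subset: "holo_on f U \<Longrightarrow> open V \<Longrightarrow> V \<subseteq> U \<Longrightarrow> holo_on f V"
  by (auto simp: holo_on_def)

lemma holo_map_on_subset: "holo_map_on f U \<Longrightarrow> open V \<Longrightarrow> V \<subseteq> U \<Longrightarrow> holo_map_on f V"
  by (auto simp: holo_map_on_def intro: holo_on_subset)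

lemma holo_on_cong:
  assumes "holo_on f U" "\<And>z. z \<in> U \<Longrightarrow> g z = f z"
  shows "holo_on g U"
proof (rule holo_onI)
  show "open U" using assms by (simp add: holo_on_def)
  fix z assume z: "z \<in> U"
  with assms obtain f' where f': "(f has_derivative f') (at z)" "\<And>c h. f' (c *s h) = c * f' h"
    using holo_onE by blast
  have "(g has_derivative f') (at z)"
    by (rule has_derivative_transform_within_open[OF f'(1) \<open>open U\<close> z]) (simp add: assms)
  with f'(2) show "\<exists>f'. (g has_derivative f') (at z) \<and> (\<forall>c h. f' (c *s h) = c * f' h)" by blast
qed

lemma holo_map_on_cong:
  "holo_map_on f U \<Longrightarrow> (\<And>z. z \<in> U \<Longrightarrow> g z = f z) \<Longrightarrow> holo_map_on g U"
  unfolding holo_map_on_def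
proof
  fix i assume "\<forall>i. holo_on (\<lambda>z. f z $ i) U" "\<And>z. z \<in> U \<Longrightarrow> g z = f z"
  then show "holo_on (\<lambda>z. g z $ i) U" using holo_on_cong[of "\<lambda>z. f z $ i" U "\<lambda>z. g z $ i"] by simp
qed

lemma holo_on_local:
  assumes "open U" "\<And>z. z \<in> U \<Longrightarrow> \<exists>V. z \<in> V \<and> holo_on f V"
  shows "holo_on f U"
  using assms by (meson holo_onE holo_onI)

lemma holo_on_const: "open U \<Longrightarrow> holo_on (\<lambda>z. c) U"
  by (rule holo_onI) (auto intro!: exI[of _ "\<lambda>h. 0"])

lemma holo_on_nth: "open U \<Longrightarrow> holo_on (\<lambda>z. z $ i) U"
  by (rule holo_onI) (auto intro!: exI[of _ "\<lambda>h. h $ i"] bounded_linear_imp_has_derivative bounded_linear_vec_nth)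

lemma holo_on_add:
  assumes "holo_on f U" "holo_on g U"
  shows "holo_on (\<lambda>z. f z + g z) U"
proof (rule holo_onI)
  show "open U" using assms holo_on_open by blast
  fix z assume z: "z \<in> U"
  obtain f' where f': "(f has_derivative f') (at z)" "\<And>c h. f' (c *s h) = c * f' h"
    using holo_onE[OF assms(1) z] by blast
  obtain g' where g': "(g has_derivative g') (at z)" "\<And>c h. g' (c *s h) = c * g' h"
    using holo_onE[OF assms(2) z] by blast
  show "\<exists>k. ((\<lambda>z. f z + g z) has_derivative k) (at z) \<and> (\<forall>c h. k (c *s h) = c * k h)"
    by (rule exI[of _ "\<lambda>h. f' h + g' h"]) (auto simp: f' g' algebra_simps intro!: derivative_intros)
qed

lemma holo_on_mult:
  assumes "holo_on f U" "holo_on g U"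
  shows "holo_on (\<lambda>z. f z * g z) U"
proof (rule holo_onI)
  show "open U" using assms holo_on_open by blast
  fix z assume z: "z \<in> U"
  obtain f' where f': "(f has_derivative f') (at z)" "\<And>c h. f' (c *s h) = c * f' h"
    using holo_onE[OF assms(1) z] by blast
  obtain g' where g': "(g has_derivative g') (at z)" "\<And>c h. g' (c *s h) = c * g' h"
    using holo_onE[OF assms(2) z] by blast
  show "\<exists>k. ((\<lambda>z. f z * g z) has_derivative k) (at z) \<and> (\<forall>c h. k (c *s h) = c * k h)"
    by (rule exI[of _ "\<lambda>h. f z * g' h + f' h * g z"])
       (auto simp: f' g' algebra_simps intro!: has_derivative_mult)
qed

lemma holo_on_cmult: "holo_on f U \<Longrightarrow> holo_on (\<lambda>z. c * f z) U"
  by (rule holo_on_mult) (auto intro: holo_on_const holo_on_open)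

lemma holo_on_diff: "holo_on f U \<Longrightarrow> holo_on g U \<Longrightarrow> holo_on (\<lambda>z. f z - g z) U"
  using holo_on_add[of f U "\<lambda>z. (-1) * g z"] holo_on_cmult[of g U "-1"] by simp

lemma holo_on_sum:
  assumes "open U" "\<And>i. i \<in> I \<Longrightarrow> holo_on (f i) U"
  shows "holo_on (\<lambda>z. \<Sum>i\<in>I. f i z) U"
  using assms(2) by (induction I rule: infinite_finite_induct) (auto intro: holo_on_const holo_on_add assms(1))

lemma holo_on_prod:
  assumes "open U" "\<And>i. i \<in> I \<Longrightarrow> holo_on (f i) U"
  shows "holo_on (\<lambda>z. \<Prod>i\<in>I. f i z) U"
  using assms(2) by (induction I rule: infinite_finite_induct) (auto intro: holo_on_const holo_on_mult assms(1))

lemma holo_on_power: "holo_on f U \<Longrightarrow> holo_on (\<lambda>z. f z ^ n) U"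
  by (induction n) (auto intro: holo_on_const holo_on_mult holo_on_open)

lemma holo_on_compose_field:
  assumes f: "holo_on f U" and \<phi>: "\<And>z. z \<in> U \<Longrightarrow> (\<phi> has_field_derivative \<phi>' z) (at (f z))"
  shows "holo_on (\<lambda>z. \<phi> (f z)) U"
proof (rule holo_onI)
  show "open U" using assms holo_on_open by blast
  fix z assume z: "z \<in> U"
  obtain f' where f': "(f has_derivative f') (at z)" "\<And>c h. f' (c *s h) = c * f' h"
    using holo_onE[OF assms(1) z] by blast
  have "((\<lambda>z. \<phi> (f z)) has_derivative (\<lambda>h. \<phi>' z * f' h)) (at z)"
    using has_derivative_compose[OF f'(1) \<phi>[OF z, unfolded has_field_derivative_def]] .
  then show "\<exists>k. ((\<lambda>z. \<phi> (f z)) has_derivative k) (at z) \<and> (\<forall>c h. k (c *s h) = c * k h)"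
    using f'(2) by (auto intro!: exI[of _ "\<lambda>h. \<phi>' z * f' h"])
qed

lemma holo_on_inverse:
  assumes "holo_on f U" "\<And>z. z \<in> U \<Longrightarrow> f z \<noteq> 0"
  shows "holo_on (\<lambda>z. inverse (f z)) U"
  by (rule holo_on_compose_field[OF assms(1) DERIV_inverse]) (use assms in auto)

lemma holo_on_divide:
  "holo_on f U \<Longrightarrow> holo_on g U \<Longrightarrow> (\<And>z. z \<in> U \<Longrightarrow> g z \<noteq> 0) \<Longrightarrow> holo_on (\<lambda>z. f z / g z) U"
  unfolding divide_inverse by (intro holo_on_mult holo_on_inverse)

lemma holo_on_compose:
  assumes f: "holo_on f V" and g: "holo_map_on g U" and im: "g ` U \<subseteq> V"
  shows "holo_on (\<lambda>z. f (g z)) U"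
proof (rule holo_onI)
  show "open U" using g holo_map_on_open by blast
  fix z assume z: "z \<in> U"
  obtain g' where g': "(g has_derivative g') (at z)" "\<And>c h. g' (c *s h) = c *s g' h"
    using holo_map_onE[OF g z] by blast
  obtain f' where f': "(f has_derivative f') (at (g z))" "\<And>c h. f' (c *s h) = c * f' h"
    using holo_onE[OF f, of "g z"] im z by blast
  show "\<exists>k. ((\<lambda>z. f (g z)) has_derivative k) (at z) \<and> (\<forall>c h. k (c *s h) = c * k h)"
    using has_derivative_compose[OF g'(1) f'(1)] f'(2) g'(2) by (auto intro!: exI[of _ "\<lambda>h. f' (g' h)"])
qed

lemma holo_map_on_compose:
  "holo_map_on f V \<Longrightarrow> holo_map_on g U \<Longrightarrow> g ` U \<subseteq> V \<Longrightarrow> holo_map_on (\<lambda>z. f (g z)) U"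
  unfolding holo_map_on_def[of f] holo_map_on_def[of "\<lambda>z. f (g z)"]
  by (auto intro: holo_on_compose[where f="\<lambda>w. f w $ _"])

lemma holo_map_on_matrix: "open U \<Longrightarrow> holo_map_on ((*v) (A :: complex^'n^'m)) U"
  unfolding holo_map_on_def matrix_vector_mult_def
  by (auto intro!: holo_on_sum holo_on_cmult holo_on_nth)

lemma holo_map_on_id: "open U \<Longrightarrow> holo_map_on (\<lambda>z. z) U"
  unfolding holo_map_on_def by (auto intro: holo_on_nth)

lemma holo_on_line:
  fixes f :: "complex^'n \<Rightarrow> complex"
  assumes f: "holo_on f U" and T: "\<And>t. t \<in> T \<Longrightarrow> z + t *s v \<in> U"
  shows "(\<lambda>t. f (z + t *s v)) holomorphic_on T"
  unfolding holomorphic_on_def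
proof
  fix t assume t: "t \<in> T"
  obtain f' where f': "(f has_derivative f') (at (z + t *s v))" "\<And>c h. f' (c *s h) = c * f' h"
    using holo_onE[OF f T[OF t]] by blast
  have "((\<lambda>t. z + t *s v) has_derivative (\<lambda>t. t *s v)) (at t)"
    using has_derivative_add[OF has_derivative_const bounded_linear_imp_has_derivative[OF bounded_linear_smult_left]]
    by simp
  from has_derivative_compose[OF this f'(1)]
  have "((\<lambda>t. f (z + t *s v)) has_derivative (\<lambda>s. s * f' v)) (at t)" by (simp add: f'(2))
  then have "((\<lambda>t. f (z + t *s v)) has_field_derivative f' v) (at t)"
    unfolding has_field_derivative_def mult_commute_abs .
  then show "(\<lambda>t. f (z + t *s v)) field_differentiable at t within T"
    using field_differentiable_at_within field_differentiable_def by blast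
qed

section \<open>Integrals depending on a holomorphic parameter\<close>

text \<open>On a complex line through \<open>z\<close> the Cauchy inequality bounds the derivative of
  \<open>f\<close> on the disc of half the radius by \<open>2 B / r\<close>. The resulting
  Lipschitz bound, linear in \<open>B\<close>, is what dominates difference quotients under an
  integral.\<close>

lemma holo_lipschitz:
  fixes f :: "complex^'n \<Rightarrow> complex"
  assumes f: "holo_on f (ball z r)" and r: "r > 0" and B: "\<And>y. y \<in> ball z r \<Longrightarrow> cmod (f y) \<le> B"
    and h: "norm h \<le> r / 4"
  shows "cmod (f (z + h) - f z) \<le> 2 * B / r * norm h"
    and "(f has_derivative f') (at z) \<Longrightarrow> cmod (f' h) \<le> 2 * B / r * norm h"
proof -
  have lip: "cmod (f (z + h) - f z) \<le> 2 * B / r * norm h" if h: "norm h \<le> r / 4" for h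
  proof (cases "h = 0")
    case False
    define u where "u = inverse (complex_of_real (norm h)) *s h"
    have u: "norm u = 1" using False by (simp add: u_def norm_vector_smult norm_inverse)
    have hu: "h = complex_of_real (norm h) *s u" using False by (simp add: u_def vec_eq_iff)
    let ?g = "\<lambda>t. f (z + t *s u)"
    have in_ball: "z + t *s u \<in> ball z r" if "cmod t < r" for t
      using that u by (simp add: dist_norm norm_vector_smult)
    have hol: "?g holomorphic_on ball 0 r"
      using in_ball by (intro holo_on_line[OF f]) simp
    have der: "(?g has_field_derivative deriv ?g t) (at t within ball 0 (r / 2))" if "t \<in> ball 0 (r / 2)" for t
      by (rule has_field_derivative_at_within, rule holomorphic_derivI[OF hol]) (use that r in auto)
    have bnd: "cmod (deriv ?g t) \<le> 2 * B / r" if t: "t \<in> ball 0 (r / 2)" for t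
    proof -
      have le: "cmod s < r" if s: "cmod (t - s) \<le> r / 2" for s
      proof -
        have "cmod s - cmod t \<le> cmod (t - s)" by (metis norm_minus_commute norm_triangle_ineq2)
        moreover have "cmod t < r / 2" using t by simp
        ultimately show ?thesis using s by linarith
      qed
      have "cmod ((deriv ^^ 1) ?g t) \<le> fact 1 * B / (r / 2) ^ 1"
      proof (rule Cauchy_inequality)
        show "?g holomorphic_on ball t (r / 2)"
          by (rule holomorphic_on_subset[OF hol]) (use le in \<open>auto simp: dist_norm\<close>)
        show "continuous_on (cball t (r / 2)) ?g"
          by (rule continuous_on_subset[OF holomorphic_on_imp_continuous_on[OF hol]])
             (use le in \<open>auto simp: dist_norm\<close>)
        show "cmod (?g x) \<le> B" if "cmod (t - x) = r / 2" for x
          using B[OF in_ball[OF le[of x]]] that by simp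
      qed (use r in auto)
      then show ?thesis by (simp add: mult.commute)
    qed
    have "cmod (?g (of_real (norm h)) - ?g 0) \<le> 2 * B / r * cmod (of_real (norm h) - 0)"
      by (rule field_differentiable_bound[OF convex_ball der bnd]) (use h r in auto)
    then show ?thesis using hu by simp
  qed simp
  show "cmod (f (z + h) - f z) \<le> 2 * B / r * norm h" by (rule lip[OF h])
  assume f': "(f has_derivative f') (at z)"
  have lin: "linear f'" using f' has_derivative_linear by blast
  show "cmod (f' h) \<le> 2 * B / r * norm h"
  proof (cases "h = 0")
    case False
    have "cmod (f' h) \<le> 2 * B / r * norm h + e" if e: "e > 0" for e
    proof -
      define e' where "e' = e / norm h"
      have "e' > 0" using e False by (simp add: e'_def)
      with f' obtain d where d: "d > 0" "\<And>y. norm (y - z) < d \<Longrightarrow> cmod (f y - f z - f' (y - z)) \<le> e' * norm (y - z)"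
        unfolding has_derivative_at_alt by blast
      define s where "s = min 1 (d / (2 * norm h))"
      have s: "0 < s" "s \<le> 1" "s * norm h < d"
      proof -
        show "0 < s" "s \<le> 1" using d(1) False by (auto simp: s_def)
        have "s * norm h \<le> d / (2 * norm h) * norm h" by (intro mult_right_mono) (auto simp: s_def)
        also have "\<dots> < d" using d(1) False by simp
        finally show "s * norm h < d" .
      qed
      let ?k = "s *\<^sub>R h"
      have nk: "norm ?k = s * norm h" using s by simp
      have "s * norm h \<le> 1 * norm h" using s by (intro mult_right_mono) auto
      then have "norm ?k \<le> r / 4" using h nk by linarith
      then have 1: "cmod (f (z + ?k) - f z) \<le> 2 * B / r * (s * norm h)" using lip[of ?k] by (simp only: nk)
      have 2: "cmod (f (z + ?k) - f z - f' ?k) \<le> e' * (s * norm h)" using d(2)[of "z + ?k"] s nk by simp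
      have "s * cmod (f' h) = cmod (f' ?k)" using s by (simp add: linear_scale[OF lin])
      also have "\<dots> \<le> cmod (f (z + ?k) - f z) + cmod (f (z + ?k) - f z - f' ?k)"
        by (metis norm_minus_commute norm_triangle_sub norm_triangle_ineq4 diff_diff_eq2 add_diff_cancel_left')
      also have "\<dots> \<le> s * (2 * B / r * norm h + e)"
        using 1 2 False by (simp add: e'_def algebra_simps)
      finally show ?thesis using s by simp
    qed
    then show ?thesis by (rule field_le_epsilon)
  qed (use linear_0[OF lin] in simp)
qed

text \<open>Differentiation under the integral sign. Only the integrand itself has to be dominated, locally
  uniformly in \<open>z\<close>: by \<open>holo_lipschitz\<close> the difference quotients are
  then dominated too.\<close>

lemma holo_on_integral:
  fixes f :: "complex^'n \<Rightarrow> 'a \<Rightarrow> complex"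
  assumes U: "open U" and hol: "\<And>x. x \<in> space M \<Longrightarrow> holo_on (\<lambda>z. f z x) U"
    and meas: "\<And>z. z \<in> U \<Longrightarrow> f z \<in> borel_measurable M"
    and bound: "\<And>z. z \<in> U \<Longrightarrow> \<exists>r>0. \<exists>w. integrable M w \<and> ball z r \<subseteq> U \<and> (\<forall>y\<in>ball z r. \<forall>x\<in>space M. cmod (f y x) \<le> w x)"
  shows "holo_on (\<lambda>z. \<integral>x. f z x \<partial>M) U"
proof (rule holo_onI[OF U])
  fix z assume z: "z \<in> U"
  obtain r w where r: "r > 0" and w: "integrable M w" and sub: "ball z r \<subseteq> U"
    and le: "\<And>y x. y \<in> ball z r \<Longrightarrow> x \<in> space M \<Longrightarrow> cmod (f y x) \<le> w x"
    using bound[OF z] by blast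
  have "\<forall>x\<in>space M. \<exists>D. ((\<lambda>z. f z x) has_derivative D) (at z) \<and> (\<forall>c h. D (c *s h) = c * D h)"
    using hol z by (meson holo_onE)
  then obtain D where D: "\<And>x. x \<in> space M \<Longrightarrow> ((\<lambda>z. f z x) has_derivative D x) (at z)"
    "\<And>x c h. x \<in> space M \<Longrightarrow> D x (c *s h) = c * D x h" by metis
  have lin: "linear (D x)" if "x \<in> space M" for x
    using D(1)[OF that] has_derivative_linear by blast
  have hol': "holo_on (\<lambda>z. f z x) (ball z r)" if "x \<in> space M" for x
    using holo_on_subset[OF hol[OF that] _ sub] by simp
  have lip: "cmod (f (z + h) x - f z x) \<le> 2 * w x / r * norm h" if "x \<in> space M" "norm h \<le> r / 4" for x h
    by (rule holo_lipschitz(1)[OF hol'[OF that(1)] r le that(2)]) (use that in auto)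
  have lipD: "cmod (D x h) \<le> 2 * w x / r * norm h" if "x \<in> space M" "norm h \<le> r / 4" for x h
    by (rule holo_lipschitz(2)[OF hol'[OF that(1)] r le that(2) D(1)]) (use that in auto)
  have lipD': "cmod (D x h) \<le> 2 * w x / r * norm h" if x: "x \<in> space M" for x h
  proof (cases "h = 0")
    case False
    define s where "s = r / (4 * norm h)"
    have s: "s > 0" "norm (s *\<^sub>R h) = r / 4" using r False by (auto simp: s_def)
    have "s * cmod (D x h) = cmod (D x (s *\<^sub>R h))" using s by (simp add: linear_scale[OF lin[OF x]])
    also have "\<dots> \<le> 2 * w x / r * norm (s *\<^sub>R h)" by (rule lipD[OF x]) (use s(2) in linarith)
    also have "\<dots> = s * (2 * w x / r * norm h)" using s by simp
    finally have "s * cmod (D x h) \<le> s * (2 * w x / r * norm h)" .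
    from mult_left_le_imp_le[OF this s(1)] show ?thesis .
  qed (use linear_0[OF lin[OF x]] in simp)
  have quot: "(\<lambda>i. (f (z + X i) x - f z x - D x (X i)) / norm (X i)) \<longlonglongrightarrow> 0"
    if x: "x \<in> space M" and X: "X \<longlonglongrightarrow> 0" "\<And>i. X i \<noteq> 0" for X x
  proof -
    have "((\<lambda>h. cmod (f (z + h) x - f z x - D x h) / norm h) \<longlongrightarrow> 0) (at 0)"
      using D(1)[OF x] unfolding has_derivative_at by blast
    then have "(\<lambda>i. cmod (f (z + X i) x - f z x - D x (X i)) / norm (X i)) \<longlonglongrightarrow> 0"
      unfolding tendsto_at_iff_sequentially using X by (auto simp: o_def)
    then have "(\<lambda>i. cmod ((f (z + X i) x - f z x - D x (X i)) / norm (X i))) \<longlonglongrightarrow> 0"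
      by (simp add: norm_divide)
    then show ?thesis by (rule tendsto_norm_zero_cancel)
  qed
  have int_f: "integrable M (f y)" if y: "y \<in> ball z r" for y
  proof (rule Bochner_Integration.integrable_bound[OF w meas])
    show "y \<in> U" using y sub by blast
    show "AE x in M. norm (f y x) \<le> norm (w x)"
      unfolding real_norm_def by (rule AE_I2) (rule order_trans[OF le[OF y] abs_ge_self])
  qed
  \<comment> \<open>The derivative in a fixed direction is measurable in \<open>x\<close> as a limit
    of difference quotients.\<close>
  have measD: "(\<lambda>x. D x h) \<in> borel_measurable M" for h
  proof (cases "h = 0")
    case False
    define s where "s i = r / (2 * norm h * (Suc i))" for i
    have s: "s i > 0" for i using r False by (simp add: s_def)
    have s0: "s \<longlonglongrightarrow> 0"
    proof -
      have "(\<lambda>i. r / (2 * norm h) * (1 / real (Suc i))) \<longlonglongrightarrow> r / (2 * norm h) * 0"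
        by (intro tendsto_mult tendsto_const LIMSEQ_Suc lim_1_over_n)
      then show ?thesis by (simp add: s_def[abs_def] divide_simps)
    qed
    have inU: "z + s i *\<^sub>R h \<in> U" for i
    proof -
      have "norm (s i *\<^sub>R h) = r / (2 * Suc i)" using s[of i] False r by (simp add: s_def)
      also have "\<dots> < r" using r by (simp add: divide_simps)
      finally show ?thesis using sub by (auto simp: dist_norm)
    qed
    show ?thesis
    proof (rule borel_measurable_LIMSEQ_metric)
      show "(\<lambda>x. (f (z + s i *\<^sub>R h) x - f z x) / s i) \<in> borel_measurable M" for i
        using meas[OF inU] meas[OF z] by measurable
      fix x assume x: "x \<in> space M"
      have "(\<lambda>i. s i *\<^sub>R h) \<longlonglongrightarrow> 0 *\<^sub>R h" by (intro tendsto_scaleR s0 tendsto_const)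
      then have "(\<lambda>i. (f (z + s i *\<^sub>R h) x - f z x - D x (s i *\<^sub>R h)) / norm (s i *\<^sub>R h)) \<longlonglongrightarrow> 0"
        using s False by (intro quot[OF x]) (auto simp: less_imp_neq[OF s, symmetric])
      from tendsto_mult[OF this tendsto_const[of "complex_of_real (norm h)"]]
      have "(\<lambda>i. (f (z + s i *\<^sub>R h) x - f z x - D x (s i *\<^sub>R h)) / norm (s i *\<^sub>R h) * norm h) \<longlonglongrightarrow> 0" by simp
      also have "(\<lambda>i. (f (z + s i *\<^sub>R h) x - f z x - D x (s i *\<^sub>R h)) / norm (s i *\<^sub>R h) * norm h)
          = (\<lambda>i. (f (z + s i *\<^sub>R h) x - f z x) / s i - D x h)"
      proof
        fix i
        show "(f (z + s i *\<^sub>R h) x - f z x - D x (s i *\<^sub>R h)) / norm (s i *\<^sub>R h) * norm h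
          = (f (z + s i *\<^sub>R h) x - f z x) / s i - D x h"
        proof -
          have "D x (s i *\<^sub>R h) = s i * D x h"
            by (simp only: linear_scale[OF lin[OF x]] scaleR_conv_of_real[of _ "D x h"])
          moreover have "norm (s i *\<^sub>R h) = s i * norm h" using s[of i] by simp
          ultimately show ?thesis using s[of i] False by (simp add: field_simps del: norm_scaleR)
        qed
      qed
      finally show "(\<lambda>i. (f (z + s i *\<^sub>R h) x - f z x) / s i) \<longlonglongrightarrow> D x h" by (simp add: LIM_zero_iff)
    qed
  next
    case True
    then show ?thesis using linear_0[OF lin] by (subst measurable_cong[of _ _ "\<lambda>x. 0"]) auto
  qed
  have intD: "integrable M (\<lambda>x. D x h)" for h
  proof (rule Bochner_Integration.integrable_bound[OF _ measD])
    show "integrable M (\<lambda>x. 2 * w x / r * norm h)" using w by simp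
    show "AE x in M. norm (D x h) \<le> norm (2 * w x / r * norm h)"
      unfolding real_norm_def by (rule AE_I2) (rule order_trans[OF lipD' abs_ge_self])
  qed
  define F where "F h = (\<integral>x. D x h \<partial>M)" for h
  have F_lin: "bounded_linear F"
  proof (rule bounded_linear_intro)
    show "F (x + y) = F x + F y" for x y
    proof -
      have "F (x + y) = (\<integral>u. D u x + D u y \<partial>M)"
        unfolding F_def by (rule Bochner_Integration.integral_cong[OF refl]) (rule linear_add[OF lin])
      also have "\<dots> = F x + F y"
        unfolding F_def by (rule Bochner_Integration.integral_add[OF intD intD])
      finally show ?thesis .
    qed
    show "F (c *\<^sub>R x) = c *\<^sub>R F x" for c x
    proof -
      have "F (c *\<^sub>R x) = (\<integral>u. c *\<^sub>R D u x \<partial>M)"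
        unfolding F_def by (rule Bochner_Integration.integral_cong[OF refl]) (rule linear_scale[OF lin])
      also have "\<dots> = c *\<^sub>R F x" unfolding F_def by simp
      finally show ?thesis .
    qed
    show "norm (F h) \<le> norm h * (\<integral>x. 2 * w x / r \<partial>M)" for h
    proof -
      have "norm (F h) \<le> (\<integral>x. norm (D x h) \<partial>M)" unfolding F_def by (rule integral_norm_bound)
      also have "\<dots> \<le> (\<integral>x. 2 * w x / r * norm h \<partial>M)"
        using intD w lipD' by (intro integral_mono) auto
      finally show ?thesis by (simp add: mult.commute)
    qed
  qed
  have "((\<lambda>z. \<integral>x. f z x \<partial>M) has_derivative F) (at z)"
    unfolding has_derivative_at
  proof (intro conjI F_lin)
    show "((\<lambda>h. cmod ((\<integral>x. f (z + h) x \<partial>M) - (\<integral>x. f z x \<partial>M) - F h) / norm h) \<longlongrightarrow> 0) (at 0)"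
      unfolding tendsto_at_iff_sequentially
    proof safe
      fix X :: "nat \<Rightarrow> complex^'n" assume X: "\<forall>i. X i \<in> UNIV - {0}" "X \<longlonglongrightarrow> 0"
      have "\<forall>\<^sub>F i in sequentially. norm (X i) < r / 4"
        using tendstoD[OF X(2), of "r / 4"] r by (simp add: dist_norm)
      then obtain N where N: "\<And>i. i \<ge> N \<Longrightarrow> norm (X i) < r / 4" by (auto simp: eventually_sequentially)
      define Y where "Y i = X (i + N)" for i
      have Y: "Y \<longlonglongrightarrow> 0" "\<And>i. Y i \<noteq> 0" "\<And>i. norm (Y i) \<le> r / 4"
        using X N LIMSEQ_ignore_initial_segment[OF X(2), of N] by (auto simp: Y_def[abs_def] less_imp_le)
      have inb: "z + Y i \<in> ball z r" for i using Y(3)[of i] r by (simp add: dist_norm)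
      let ?q = "\<lambda>i x. (f (z + Y i) x - f z x - D x (Y i)) / norm (Y i)"
      have int_q: "integrable M (?q i)" for i
        using int_f[OF inb] int_f[of z] r intD by auto
      have "(\<lambda>i. \<integral>x. ?q i x \<partial>M) \<longlonglongrightarrow> (\<integral>x. 0 \<partial>M)"
      proof (rule integral_dominated_convergence)
        show "integrable M (\<lambda>x. 4 * w x / r)" using w by simp
        show "?q i \<in> borel_measurable M" for i by (rule borel_measurable_integrable[OF int_q])
        show "AE x in M. (\<lambda>i. ?q i x) \<longlonglongrightarrow> 0" by (rule AE_I2) (rule quot[OF _ Y(1,2)])
        show "AE x in M. norm (?q i x) \<le> 4 * w x / r" for i
        proof (rule AE_I2)
          fix x assume x: "x \<in> space M"
          have "cmod (f (z + Y i) x - f z x - D x (Y i)) \<le> 4 * w x / r * norm (Y i)"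
            using norm_triangle_ineq4[of "f (z + Y i) x - f z x" "D x (Y i)"] lip[OF x Y(3)[of i]] lipD'[OF x, of "Y i"] by linarith
          then show "norm (?q i x) \<le> 4 * w x / r"
            using Y(2)[of i] unfolding norm_divide by (subst pos_divide_le_eq) auto
        qed
      qed simp
      then have lim: "(\<lambda>i. cmod (\<integral>x. ?q i x \<partial>M)) \<longlonglongrightarrow> 0"
        using tendsto_norm_zero by fastforce
      have "cmod (\<integral>x. ?q i x \<partial>M) = cmod ((\<integral>x. f (z + Y i) x \<partial>M) - (\<integral>x. f z x \<partial>M) - F (Y i)) / norm (Y i)" for i
      proof -
        have "(\<integral>x. ?q i x \<partial>M) = (\<integral>x. f (z + Y i) x - f z x - D x (Y i) \<partial>M) / norm (Y i)"
          by simp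
        also have "(\<integral>x. f (z + Y i) x - f z x - D x (Y i) \<partial>M) = (\<integral>x. f (z + Y i) x \<partial>M) - (\<integral>x. f z x \<partial>M) - F (Y i)"
          unfolding F_def using int_f[OF inb] int_f[of z] r intD by simp
        finally show ?thesis using Y(2)[of i] by (simp add: norm_divide)
      qed
      with lim have "(\<lambda>i. cmod ((\<integral>x. f (z + X (i + N)) x \<partial>M) - (\<integral>x. f z x \<partial>M) - F (X (i + N))) / norm (X (i + N))) \<longlonglongrightarrow> 0"
        by (simp add: Y_def)
      then show "((\<lambda>h. cmod ((\<integral>x. f (z + h) x \<partial>M) - (\<integral>x. f z x \<partial>M) - F h) / norm h) \<circ> X) \<longlonglongrightarrow> 0"
        unfolding o_def by (rule LIMSEQ_offset)
    qed
  qed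
  moreover have "F (c *s h) = c * F h" for c h
  proof -
    have "F (c *s h) = (\<integral>u. c * D u h \<partial>M)"
      unfolding F_def by (rule Bochner_Integration.integral_cong[OF refl]) (rule D(2))
    also have "\<dots> = c * F h" unfolding F_def by simp
    finally show ?thesis .
  qed
  ultimately show "\<exists>f'. ((\<lambda>z. \<integral>x. f z x \<partial>M) has_derivative f') (at z) \<and> (\<forall>c h. f' (c *s h) = c * f' h)"
    by blast
qed

lemma holo_on_integral_interval:
  fixes f :: "complex^'n \<Rightarrow> real \<Rightarrow> complex"
  assumes V: "open V" and cont: "continuous_on (V \<times> {0..1}) (\<lambda>(z, t). f z t)"
    and hol: "\<And>t. t \<in> {0..1} \<Longrightarrow> holo_on (\<lambda>z. f z t) V"
  shows "holo_on (\<lambda>z. LINT t:{0..1}|lborel. f z t) V"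
  unfolding set_lebesgue_integral_def
proof (rule holo_on_integral[OF V])
  fix t :: real
  show "holo_on (\<lambda>z. indicator {0..1} t *\<^sub>R f z t) V"
    using hol[of t] V by (cases "t \<in> {0..1}") (auto intro: holo_on_const)
next
  fix z assume z: "z \<in> V"
  have "continuous_on {0..1} (\<lambda>t. f z t)"
    using continuous_on_compose2[OF cont, of "{0..1}" "Pair z"] continuous_on_Pair[OF continuous_on_const continuous_on_id, of "{0..1}" z] z
    by auto
  then show "(\<lambda>t. indicator {0..1} t *\<^sub>R f z t) \<in> borel_measurable lborel"
    using borel_measurable_continuous_on_indicator[of "{0..1::real}" "f z"] by simp
  obtain r where r: "r > 0" "cball z r \<subseteq> V" using V z open_contains_cball by blast
  have "compact ((\<lambda>(z, t). f z t) ` (cball z r \<times> {0..1}))"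
    by (intro compact_continuous_image continuous_on_subset[OF cont] compact_Times) (use r in auto)
  then have "bounded ((\<lambda>(z, t). f z t) ` (cball z r \<times> {0..1}))" by (rule compact_imp_bounded)
  then obtain B where "\<forall>x\<in>(\<lambda>(z, t). f z t) ` (cball z r \<times> {0..1}). norm x \<le> B"
    unfolding bounded_iff by blast
  then have B: "cmod (f y t) \<le> B" if "y \<in> cball z r" "t \<in> {0..1}" for y t using that by auto
  show "\<exists>r>0. \<exists>w. integrable lborel w \<and> ball z r \<subseteq> V \<and>
      (\<forall>y\<in>ball z r. \<forall>t\<in>space lborel. cmod (indicator {0..1} t *\<^sub>R f y t) \<le> w t)"
  proof (intro exI conjI ballI)
    show "integrable lborel (\<lambda>t::real. B * indicator {0..1} t)" by simp
    show "cmod (indicator {0..1} t *\<^sub>R f y t) \<le> B * indicator {0..1} t" if "y \<in> ball z r" for y t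
      using B[of y t] that by (auto simp: indicator_def)
    show "ball z r \<subseteq> V" using r ball_subset_cball by blast
  qed (use r in auto)
qed

text \<open>Cauchy's integral formulas for a function and its derivative at the centre, as averages with
  respect to the angle \<open>2 \<pi> t\<close>.\<close>

lemma circle_mean:
  assumes cont: "continuous_on (cball 0 R) f" and hol: "f holomorphic_on ball 0 R" and R: "R > 0"
  shows "(LINT t:{0..1}|lborel. f (R * cis (2 * pi * t))) = f 0"
    and "(LINT t:{0..1}|lborel. f (R * cis (2 * pi * t)) / (R * cis (2 * pi * t))) = deriv f 0"
proof -
  have cp: "circlepath 0 R = (\<lambda>t. R * cis (2 * pi * t))"
    by (auto simp: circlepath cis_conv_exp mult_ac)
  have vd: "vector_derivative (circlepath 0 R) (at t within {0..1}) = 2 * pi * \<i> * (R * cis (2 * pi * t))" if "t \<in> {0..1}" for t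
    using vector_derivative_circlepath01[of t 0 R] that by (simp add: cis_conv_exp mult_ac)
  have nz: "R * cis (2 * pi * t) \<noteq> 0" for t using R by simp
  have int: "set_integrable lborel {0..1} (\<lambda>t. g (R * cis (2 * pi * t)))" if "continuous_on (sphere 0 R) g" for g :: "complex \<Rightarrow> complex"
    unfolding set_integrable_def
    using R by (intro borel_integrable_compact continuous_on_compose2[OF that])
      (auto intro!: continuous_intros simp: norm_mult)
  have eq: "(LINT t:{0..1}|lborel. g (R * cis (2 * pi * t))) = I"
    if "continuous_on (sphere 0 R) g" "((\<lambda>t. g (R * cis (2 * pi * t))) has_integral I) {0..1}" for I :: complex and g :: "complex \<Rightarrow> complex"
    using set_borel_integral_eq_integral(2)[OF int[OF that(1)]] that(2) by (simp add: integral_unique)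
  have conts: "continuous_on (sphere 0 R) f" by (rule continuous_on_subset[OF cont]) auto
  have "((\<lambda>u. f u / (u - 0)) has_contour_integral (2 * pi * \<i> * f 0)) (circlepath 0 R)"
    using Cauchy_integral_circlepath[OF cont hol, of 0] R by simp
  then have "((\<lambda>t. f (R * cis (2 * pi * t)) / (R * cis (2 * pi * t)) * (2 * pi * \<i> * (R * cis (2 * pi * t))))
      has_integral (2 * pi * \<i> * f 0)) {0..1}"
    unfolding has_contour_integral_def by (rule has_integral_eq[rotated]) (simp add: vd, simp add: cp)
  then have "((\<lambda>t. (f (R * cis (2 * pi * t)) * (2 * pi * \<i>))) has_integral (f 0 * (2 * pi * \<i>))) {0..1}"
    by (rule has_integral_eq_rhs[OF has_integral_eq[rotated]]) (use nz in \<open>simp_all add: mult_ac\<close>)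
  then have "((\<lambda>t. f (R * cis (2 * pi * t)) * (2 * pi * \<i>) / (2 * pi * \<i>)) has_integral (f 0 * (2 * pi * \<i>) / (2 * pi * \<i>))) {0..1}"
    by (rule has_integral_divide)
  then have "((\<lambda>t. f (R * cis (2 * pi * t))) has_integral f 0) {0..1}" by simp
  from eq[OF conts this] show "(LINT t:{0..1}|lborel. f (R * cis (2 * pi * t))) = f 0" .
  have w: "(0::complex) \<in> ball 0 R" using R by simp
  let ?I = "contour_integral (circlepath 0 R) (\<lambda>u. f u / (u - 0)\<^sup>2)"
  note C = Cauchy_derivative_integral_circlepath[OF cont hol w]
  have d: "deriv f 0 = 1 / (2 * pi * \<i>) * ?I" using DERIV_imp_deriv[OF C(2)] by simp
  have "((\<lambda>u. f u / (u - 0)\<^sup>2) has_contour_integral ?I) (circlepath 0 R)"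
    using C(1) by (rule has_contour_integral_integral)
  then have "((\<lambda>t. f (R * cis (2 * pi * t)) / (R * cis (2 * pi * t))\<^sup>2 * (2 * pi * \<i> * (R * cis (2 * pi * t))))
      has_integral ?I) {0..1}"
    unfolding has_contour_integral_def by (rule has_integral_eq[rotated]) (simp add: vd, simp add: cp)
  then have "((\<lambda>t. (f (R * cis (2 * pi * t)) / (R * cis (2 * pi * t))) * (2 * pi * \<i>)) has_integral ?I) {0..1}"
    by (rule has_integral_eq[rotated]) (use nz in \<open>simp add: power2_eq_square mult_ac\<close>)
  then have "((\<lambda>t. (f (R * cis (2 * pi * t)) / (R * cis (2 * pi * t))) * (2 * pi * \<i>) / (2 * pi * \<i>)) has_integral (?I / (2 * pi * \<i>))) {0..1}"
    by (rule has_integral_divide)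
  then have I: "((\<lambda>t. f (R * cis (2 * pi * t)) / (R * cis (2 * pi * t))) has_integral deriv f 0) {0..1}"
    unfolding d by simp
  have "continuous_on (sphere 0 R) (\<lambda>u. f u / u)" using conts R by (intro continuous_intros) auto
  from eq[OF this I]
  show "(LINT t:{0..1}|lborel. f (R * cis (2 * pi * t)) / (R * cis (2 * pi * t))) = deriv f 0" .
qed

section \<open>Partial derivatives and the complex Jacobian\<close>

definition partial_deriv :: "(complex^'n \<Rightarrow> complex) \<Rightarrow> 'n \<Rightarrow> complex^'n \<Rightarrow> complex" where
  "partial_deriv f j z = deriv (\<lambda>t. f (z + axis j t)) 0"

lemma partial_deriv_eq:
  assumes "(f has_derivative (\<lambda>h. \<Sum>j\<in>UNIV. a $ j * h $ j)) (at z)"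
  shows "partial_deriv f j z = (a::complex^'n) $ j"
proof -
  have line: "((\<lambda>t. z + t *s axis j 1) has_derivative (\<lambda>t. t *s axis j 1)) (at 0)"
    using has_derivative_add[OF has_derivative_const bounded_linear_imp_has_derivative[OF bounded_linear_smult_left]]
    by simp
  have f: "(f has_derivative (\<lambda>h. \<Sum>j\<in>UNIV. a $ j * h $ j)) (at (z + 0 *s axis j 1))"
    using assms by simp
  have "((\<lambda>t. f (z + t *s axis j 1)) has_derivative (\<lambda>t. \<Sum>l\<in>UNIV. a $ l * (t *s axis j 1) $ l)) (at 0)"
    by (rule has_derivative_compose[OF line f])
  moreover have "(\<lambda>t. \<Sum>l\<in>UNIV. a $ l * (t *s axis j 1) $ l) = (*) (a $ j)"
  proof
    fix t
    have e: "(\<lambda>l. a $ l * (t *s axis j 1) $ l) = (\<lambda>l. if l = j then a $ j * t else 0)"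
      by (auto simp: axis_def)
    show "(\<Sum>l\<in>UNIV. a $ l * (t *s axis j 1) $ l) = a $ j * t" unfolding e by simp
  qed
  ultimately have "((\<lambda>t. f (z + axis j t)) has_field_derivative a $ j) (at 0)"
    by (simp add: has_field_derivative_def axis_eq_smult[symmetric])
  then show ?thesis unfolding partial_deriv_def by (rule DERIV_imp_deriv)
qed

lemma holo_on_has_derivative:
  assumes "holo_on f U" "z \<in> U"
  shows "(f has_derivative (\<lambda>h. \<Sum>j\<in>UNIV. partial_deriv f j z * h $ j)) (at z)"
proof -
  obtain a :: "complex^'a" where a: "(f has_derivative (\<lambda>h. \<Sum>j\<in>UNIV. a $ j * h $ j)) (at z)"
    using assms unfolding holo_on_def by blast
  have eq: "partial_deriv f j z = a $ j" for j by (rule partial_deriv_eq[OF a])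
  show ?thesis unfolding eq by (rule a)
qed

lemma norm_axis_cvec: "norm (axis j 1 :: complex^'n) = 1"
  by (rule norm_Basis) (simp add: Basis_cvec)

text \<open>By \<open>circle_mean\<close> the partial derivative is locally a weighted average of values of
  \<open>f\<close> over a circle of fixed radius, which depends holomorphically on the centre.\<close>

lemma holo_on_partial_deriv:
  fixes f :: "complex^'n \<Rightarrow> complex"
  assumes f: "holo_on f U"
  shows "holo_on (partial_deriv f j) U"
proof (rule holo_on_local[OF holo_on_open[OF f]])
  fix z0 assume "z0 \<in> U"
  then obtain r where r: "r > 0" "cball z0 r \<subseteq> U" using holo_on_open[OF f] open_contains_cball by blast
  define R where "R = r / 2"
  have R: "R > 0" using r by (simp add: R_def)
  have inU: "z + t *s axis j 1 \<in> U" if "z \<in> ball z0 R" "cmod t \<le> R" for z t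
  proof -
    have "norm (z0 - (z + t *s axis j 1)) \<le> norm (z0 - z) + norm (t *s (axis j 1 :: complex^'n))"
      using norm_triangle_ineq4[of "z0 - z" "t *s axis j 1"] by (simp add: algebra_simps)
    also have "\<dots> \<le> r" using that by (simp add: norm_vector_smult R_def dist_norm norm_axis_cvec)
    finally show ?thesis using r by (auto simp: dist_norm)
  qed
  let ?c = "\<lambda>t. R * cis (2 * pi * t)"
  have eq: "partial_deriv f j z = (LINT t:{0..1}|lborel. f (z + ?c t *s axis j 1) / ?c t)" if z: "z \<in> ball z0 R" for z
  proof -
    have hol: "(\<lambda>t. f (z + t *s axis j 1)) holomorphic_on ball 0 R"
      by (rule holo_on_line[OF f]) (use inU[OF z] in auto)
    have "continuous_on (cball 0 R) (\<lambda>t. f (z + t *s axis j 1))"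
      by (rule continuous_on_compose2[OF holo_on_continuous_on[OF f]])
         (use inU[OF z] in \<open>auto intro!: continuous_intros\<close>)
    note circle = circle_mean(2)[OF this hol R]
    have "partial_deriv f j z = deriv (\<lambda>t. f (z + t *s axis j 1)) 0"
      unfolding partial_deriv_def
      using arg_cong[where f="\<lambda>h. deriv (\<lambda>t. f (z + h t)) 0", OF ext[of "axis j", OF axis_eq_smult]] .
    then show ?thesis using circle by simp
  qed
  have "holo_on (\<lambda>z. LINT t:{0..1}|lborel. f (z + ?c t *s axis j 1) / ?c t) (ball z0 R)"
  proof (rule holo_on_integral_interval)
    have "continuous_on (ball z0 R \<times> {0..1}) (\<lambda>x. f (fst x + ?c (snd x) *s axis j 1))"
      by (rule continuous_on_compose2[OF holo_on_continuous_on[OF f]])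
         (use inU R in \<open>auto intro!: continuous_intros simp: norm_mult\<close>)
    then have "continuous_on (ball z0 R \<times> {0..1}) (\<lambda>x. f (fst x + ?c (snd x) *s axis j 1) / ?c (snd x))"
      using R by (intro continuous_intros) auto
    then show "continuous_on (ball z0 R \<times> {0..1}) (\<lambda>(z, t). f (z + ?c t *s axis j 1) / ?c t)"
      by (simp add: case_prod_beta)
    fix t :: real
    have "holo_on (\<lambda>z. f (z + ?c t *s axis j 1)) (ball z0 R)"
    proof (rule holo_on_compose[OF f])
      show "holo_map_on (\<lambda>z. z + ?c t *s axis j 1) (ball z0 R)"
        unfolding holo_map_on_def by (auto intro!: holo_on_add holo_on_nth holo_on_const)
    qed (use inU R in \<open>auto simp: norm_mult\<close>)
    then show "holo_on (\<lambda>z. f (z + ?c t *s axis j 1) / ?c t) (ball z0 R)"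
      by (rule holo_on_divide) (use R in \<open>auto intro!: holo_on_const\<close>)
  qed simp
  then have "holo_on (partial_deriv f j) (ball z0 R)" by (rule holo_on_cong) (simp add: eq)
  then show "\<exists>V. z0 \<in> V \<and> holo_on (partial_deriv f j) V" using R by (intro exI[of _ "ball z0 R"]) simp
qed

definition jacobian_matrix :: "(complex^'n \<Rightarrow> complex^'m) \<Rightarrow> complex^'n \<Rightarrow> complex^'n^'m" where
  "jacobian_matrix f z = (\<chi> i j. partial_deriv (\<lambda>w. f w $ i) j z)"

lemma complex_jacobian_det: "complex_jacobian f z = det (jacobian_matrix f z)"
  by (simp add: complex_jacobian_def jacobian_matrix_def partial_deriv_def)

lemma jacobian_matrix_eq:
  assumes "(f has_derivative (*v) M) (at z)"
  shows "jacobian_matrix f z = M"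
proof -
  have "((\<lambda>w. f w $ i) has_derivative (\<lambda>h. \<Sum>j\<in>UNIV. (M $ i) $ j * h $ j)) (at z)" for i
    using has_derivative_cvec_nth[OF assms, of i] by (simp add: matrix_vector_mult_def)
  then show ?thesis by (simp add: vec_eq_iff jacobian_matrix_def partial_deriv_eq)
qed

lemma holo_map_on_has_derivative:
  fixes f :: "complex^'n \<Rightarrow> complex^'m"
  assumes "holo_map_on f U" "z \<in> U"
  shows "(f has_derivative (*v) (jacobian_matrix f z)) (at z)"
proof (rule has_derivative_cvecI)
  show "((\<lambda>w. f w $ i) has_derivative (\<lambda>h. (jacobian_matrix f z *v h) $ i)) (at z)" for i
    using holo_on_has_derivative[of "\<lambda>w. f w $ i" U z] assms
    by (simp add: holo_map_on_def matrix_vector_mult_def jacobian_matrix_def)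
qed

lemma holo_on_complex_jacobian:
  assumes "holo_map_on f U" shows "holo_on (complex_jacobian f) U"
proof -
  have entry: "holo_on (\<lambda>z. jacobian_matrix f z $ i $ j) U" for i j
    unfolding jacobian_matrix_def vec_lambda_beta
    by (rule holo_on_partial_deriv) (use assms in \<open>simp add: holo_map_on_def\<close>)
  have op: "open U" by (rule holo_map_on_open[OF assms])
  have "holo_on (\<lambda>z. \<Prod>i\<in>UNIV. jacobian_matrix f z $ i $ p i) U" for p
    by (rule holo_on_prod[OF op entry])
  then have "holo_on (\<lambda>z. of_int (sign p) * (\<Prod>i\<in>UNIV. jacobian_matrix f z $ i $ p i)) U" for p
    by (rule holo_on_cmult)
  then have "holo_on (\<lambda>z. det (jacobian_matrix f z)) U"
    unfolding det_def by (rule holo_on_sum[OF op])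
  then show ?thesis by (rule holo_on_cong) (rule complex_jacobian_det)
qed

lemma complex_jacobian_eq:
  "(f has_derivative (*v) M) (at z) \<Longrightarrow> complex_jacobian f z = det M"
  by (simp add: complex_jacobian_det jacobian_matrix_eq)

lemma complex_jacobian_compose:
  assumes f: "holo_map_on f V" "g z \<in> V" and g: "holo_map_on g U" "z \<in> U"
  shows "complex_jacobian (\<lambda>w. f (g w)) z = complex_jacobian f (g z) * complex_jacobian g z"
proof -
  have "((\<lambda>w. f (g w)) has_derivative (\<lambda>h. jacobian_matrix f (g z) *v (jacobian_matrix g z *v h))) (at z)"
    using has_derivative_compose[OF holo_map_on_has_derivative[OF g] holo_map_on_has_derivative[OF f]] .
  then have "((\<lambda>w. f (g w)) has_derivative (*v) (jacobian_matrix f (g z) ** jacobian_matrix g z)) (at z)"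
    by (simp add: matrix_vector_mul_assoc)
  from complex_jacobian_eq[OF this] show ?thesis by (simp add: det_mul complex_jacobian_det)
qed

lemma complex_jacobian_cong:
  assumes "holo_map_on f U" "z \<in> U" "\<And>w. w \<in> U \<Longrightarrow> g w = f w"
  shows "complex_jacobian g z = complex_jacobian f z"
proof -
  have "(g has_derivative (*v) (jacobian_matrix f z)) (at z)"
    by (rule has_derivative_transform_within_open[OF holo_map_on_has_derivative[OF assms(1,2)] holo_map_on_open[OF assms(1)] assms(2)])
       (simp add: assms(3))
  from complex_jacobian_eq[OF this] show ?thesis by (simp add: complex_jacobian_det)
qed

lemma complex_jacobian_id: "complex_jacobian (\<lambda>z. z) z = 1"
proof -
  have "((\<lambda>z. z) has_derivative (*v) (mat 1)) (at z)" by (simp add: matrix_vector_mul_lid[abs_def])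
  from complex_jacobian_eq[OF this] show ?thesis by (simp add: det_I)
qed

lemma holo_map_image_integral:
  fixes g :: "complex^'n \<Rightarrow> complex^'n" and f :: "complex^'n \<Rightarrow> 'b::{banach, second_countable_topology}"
  assumes g: "holo_map_on g U" and S: "S \<in> sets borel" "S \<subseteq> U" "g ` S \<in> sets borel" and inj: "inj_on g S"
    and f: "set_borel_measurable borel (g ` S) f"
  shows "set_integrable lborel (g ` S) f \<longleftrightarrow> set_integrable lborel S (\<lambda>x. (cmod (complex_jacobian g x))\<^sup>2 *\<^sub>R f (g x))"
    and "(LINT y:g ` S|lborel. f y) = (LINT x:S|lborel. (cmod (complex_jacobian g x))\<^sup>2 *\<^sub>R f (g x))"
proof -
  let ?g' = "\<lambda>x. (*v) (jacobian_matrix g x)"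
  have rd: "\<bar>rdet (?g' x)\<bar> = (cmod (complex_jacobian g x))\<^sup>2" for x
    by (simp add: abs_rdet_matrix complex_jacobian_det)
  have der: "(g has_derivative ?g' x) (at x within S)" if "x \<in> S" for x
    using holo_map_on_has_derivative[OF g, of x] that S by (auto intro: has_derivative_at_withinI)
  have "continuous_on S (complex_jacobian g)"
    using holo_on_continuous_on[OF holo_on_complex_jacobian[OF g]] continuous_on_subset S by blast
  then have "continuous_on S (\<lambda>x. (cmod (complex_jacobian g x))\<^sup>2)" by (intro continuous_intros)
  then have meas: "(\<lambda>x. indicator S x *\<^sub>R \<bar>rdet (?g' x)\<bar>) \<in> borel_measurable borel"
    unfolding rd by (rule borel_measurable_continuous_on_indicator[OF S(1)])
  note I = integral_injective_image[OF S(1,3) der inj meas f]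
  show "set_integrable lborel (g ` S) f \<longleftrightarrow> set_integrable lborel S (\<lambda>x. (cmod (complex_jacobian g x))\<^sup>2 *\<^sub>R f (g x))"
    using I(1) unfolding rd .
  show "(LINT y:g ` S|lborel. f y) = (LINT x:S|lborel. (cmod (complex_jacobian g x))\<^sup>2 *\<^sub>R f (g x))"
    using I(2) unfolding rd .
qed

text \<open>The derivative depends continuously on the point, so the map is injective near \<open>z\<close>;
  invariance of domain makes its image open, and the inverse has the inverse matrix, which is
  complex linear, as its derivative.\<close>

lemma holo_map_local_inverse:
  fixes g :: "complex^'n \<Rightarrow> complex^'n"
  assumes g: "holo_map_on g U" and z: "z \<in> U" and J: "complex_jacobian g z \<noteq> 0"
  obtains r where "r > 0" "ball z r \<subseteq> U" "inj_on g (ball z r)" "open (g ` ball z r)"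
    "holo_map_on (inv_into (ball z r) g) (g ` ball z r)"
proof -
  let ?M = "\<lambda>x. jacobian_matrix g x"
  have "invertible (?M z)" using J by (simp add: invertible_det_nz complex_jacobian_det)
  then obtain N where N: "N ** ?M z = mat 1" "?M z ** N = mat 1" unfolding invertible_def by blast
  define U' where "U' = {x \<in> U. complex_jacobian g x \<noteq> 0}"
  have contJ: "continuous_on U (complex_jacobian g)"
    by (rule holo_on_continuous_on[OF holo_on_complex_jacobian[OF g]])
  have U': "open U'"
    using continuous_open_preimage[OF contJ holo_map_on_open[OF g], of "- {0}"]
    by (simp add: U'_def vimage_def Int_def open_Compl)
  have contM: "continuous_on U (\<lambda>x. ?M x $ i $ j)" for i j
    unfolding jacobian_matrix_def vec_lambda_beta
    by (rule holo_on_continuous_on[OF holo_on_partial_deriv]) (use g in \<open>simp add: holo_map_on_def\<close>)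
  obtain r where r: "r > 0" "ball z r \<subseteq> U'" "inj_on g (ball z r)"
  proof (rule has_derivative_locally_injective[of z U' "(*v) N" "\<lambda>x. (*v) (?M x)" g])
    show "z \<in> U'" using z J by (simp add: U'_def)
    show "bounded_linear ((*v) N)" using linear_matrix_cvec linear_linear by blast
    show "(*v) N \<circ> (*v) (?M z) = id"
      by (auto simp: fun_eq_iff matrix_vector_mul_assoc N)
    show "(g has_derivative (*v) (?M x)) (at x)" if "x \<in> U'" for x
      using holo_map_on_has_derivative[OF g] that by (simp add: U'_def)
    fix e :: real assume e: "e > 0"
    \<comment> \<open>The sum of the moduli of the entries bounds the operator norm and is
      continuous in \<open>x\<close>.\<close>
    define b where "b x = (\<Sum>i\<in>UNIV. \<Sum>j\<in>UNIV. cmod (?M x $ i $ j - ?M z $ i $ j))" for x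
    have "continuous_on U b" unfolding b_def by (intro continuous_intros contM)
    then have "isCont b z" using z holo_map_on_open[OF g] continuous_on_eq_continuous_at by blast
    moreover have "b z = 0" by (simp add: b_def)
    ultimately have "\<exists>d>0. \<forall>x. dist x z < d \<longrightarrow> dist (b x) 0 < e"
      using e unfolding continuous_at_eps_delta by auto
    then obtain d where d: "d > 0" "\<And>x. dist x z < d \<Longrightarrow> dist (b x) 0 < e" by blast
    show "\<exists>d>0. \<forall>x. dist z x < d \<longrightarrow> onorm (\<lambda>v. ?M x *v v - ?M z *v v) < e"
    proof (intro exI conjI allI impI)
      show "d > 0" by (rule d(1))
      fix x assume x: "dist z x < d"
      have "onorm (\<lambda>v. ?M x *v v - ?M z *v v) \<le> b x"
      proof (rule onorm_le)
        fix v :: "complex^'n"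
        have "norm (?M x *v v - ?M z *v v) \<le> (\<Sum>i\<in>UNIV. cmod ((?M x *v v - ?M z *v v) $ i))"
          unfolding norm_vec_def by (rule L2_set_le_sum_abs[THEN order_trans]) simp
        also have "\<dots> \<le> (\<Sum>i\<in>UNIV. \<Sum>j\<in>UNIV. cmod (?M x $ i $ j - ?M z $ i $ j) * norm v)"
        proof (rule sum_mono)
          fix i
          have "(?M x *v v - ?M z *v v) $ i = (\<Sum>j\<in>UNIV. (?M x $ i $ j - ?M z $ i $ j) * v $ j)"
            by (simp add: matrix_vector_mult_def sum_subtractf[symmetric] algebra_simps)
          also have "cmod \<dots> \<le> (\<Sum>j\<in>UNIV. cmod (?M x $ i $ j - ?M z $ i $ j) * norm v)"
            by (rule sum_norm_le) (simp add: norm_mult mult_left_mono Finite_Cartesian_Product.norm_nth_le)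
          finally show "cmod ((?M x *v v - ?M z *v v) $ i) \<le> (\<Sum>j\<in>UNIV. cmod (?M x $ i $ j - ?M z $ i $ j) * norm v)" .
        qed
        also have "\<dots> = b x * norm v" by (simp add: b_def sum_distrib_right)
        finally show "norm (?M x *v v - ?M z *v v) \<le> b x * norm v" .
      qed
      also have "b x < e" using d(2)[of x] x by (simp add: dist_commute dist_real_def)
      finally show "onorm (\<lambda>v. ?M x *v v - ?M z *v v) < e" .
    qed
  qed (use U' in auto)
  have sub: "ball z r \<subseteq> U" using r(2) by (auto simp: U'_def)
  have cont: "continuous_on (ball z r) g"
    using holo_map_on_continuous_on[OF g] sub continuous_on_subset by blast
  have op: "open (g ` ball z r)" by (rule invariance_of_domain[OF cont open_ball r(3)])
  have "holo_map_on (inv_into (ball z r) g) (g ` ball z r)"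
  proof (rule holo_map_onI[OF op])
    fix y assume "y \<in> g ` ball z r"
    then obtain x where x: "x \<in> ball z r" "y = g x" by blast
    then have "invertible (?M x)" using r(2) by (auto simp: U'_def invertible_det_nz complex_jacobian_det)
    then obtain N where N: "N ** ?M x = mat 1" "?M x ** N = mat 1" unfolding invertible_def by blast
    have "(inv_into (ball z r) g has_derivative (*v) N) (at (g x))"
      by (rule has_derivative_inverse_strong[OF open_ball x(1) cont _ holo_map_on_has_derivative[OF g]])
         (use r(3) x sub in \<open>auto simp: fun_eq_iff matrix_vector_mul_assoc N\<close>)
    then show "\<exists>f'. (inv_into (ball z r) g has_derivative f') (at y) \<and> (\<forall>c h. f' (c *s h) = c *s f' h)"
      unfolding x(2) by (intro exI[of _ "(*v) N"]) (auto simp: matrix_vector_mult_scaleR vec.scale)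
  qed
  with r sub op show ?thesis using that by blast
qed

section \<open>Mean values over balls\<close>

text \<open>The integral over the ball is invariant under each \<open>\<rho> t\<close>, so it equals its
  average over \<open>t\<close>; by Fubini's theorem the average may be taken pointwise. In this
  way mean values over balls are obtained from mean values over circles, without polar
  coordinates.\<close>

lemma integral_ball_rotations:
  fixes f :: "'a::euclidean_space \<Rightarrow> complex" and \<rho> :: "real \<Rightarrow> 'a \<Rightarrow> 'a"
  assumes lin: "\<And>t. linear (\<rho> t)" and norm: "\<And>t x. norm (\<rho> t x) = norm x"
    and cont: "continuous_on UNIV (\<lambda>p. \<rho> (fst p) (snd p))"
    and int: "set_integrable lborel (ball 0 r) f"
    and mean: "\<And>x. x \<in> ball 0 r \<Longrightarrow> (LINT t:{0..1}|lborel. f (\<rho> t x)) = c"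
  shows "(LINT x:ball 0 r|lborel. f x) = measure lborel (ball (0::'a) r) *\<^sub>R c"
proof -
  define f0 where "f0 x = indicator (ball 0 r) x *\<^sub>R f x" for x
  have f0: "integrable lborel f0" using int by (simp add: set_integrable_def f0_def[abs_def])
  then have f0m [measurable]: "f0 \<in> borel_measurable borel" by auto
  have rot: "distr lborel borel (\<rho> t) = lborel" for t by (rule lborel_isometry[OF lin norm])
  have \<rho>m [measurable]: "\<rho> t \<in> borel_measurable borel" for t
    by (rule borel_measurable_continuous_onI[OF linear_continuous_on]) (simp add: lin linear_linear)
  have f0\<rho>: "integrable lborel (\<lambda>x. f0 (\<rho> t x))" for t
    using f0 integrable_distr_eq[of "\<rho> t" lborel borel f0] by (simp add: rot)
  have I: "(LINT x|lborel. f0 (\<rho> t x)) = (LINT x|lborel. f0 x)" for t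
    using integral_distr[of "\<rho> t" lborel borel f0] by (simp add: rot)
  have In: "(LINT x|lborel. norm (f0 (\<rho> t x))) = (LINT x|lborel. norm (f0 x))" for t
    using integral_distr[of "\<rho> t" lborel borel "\<lambda>x. norm (f0 x)"] by (simp add: rot)
  let ?h = "\<lambda>t x. indicator {0..1} t *\<^sub>R f0 (\<rho> t x)"
  have cm: "(\<lambda>p. \<rho> (fst p) (snd p)) \<in> borel_measurable (borel \<Otimes>\<^sub>M borel)"
    unfolding borel_prod by (rule borel_measurable_continuous_onI[OF cont])
  have hm: "case_prod ?h \<in> borel_measurable (lborel \<Otimes>\<^sub>M lborel)"
  proof -
    have "(\<lambda>p. f0 (\<rho> (fst p) (snd p))) \<in> borel_measurable (borel \<Otimes>\<^sub>M borel)"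
      using measurable_compose[OF cm f0m] .
    then have "(\<lambda>p. indicator {0..1} (fst p) *\<^sub>R f0 (\<rho> (fst p) (snd p))) \<in> borel_measurable (borel \<Otimes>\<^sub>M borel)"
      by measurable
    then show ?thesis by (simp add: case_prod_beta' cong: measurable_cong_sets)
  qed
  have "integrable (lborel \<Otimes>\<^sub>M lborel) (case_prod ?h)"
  proof (rule lborel_pair.Fubini_integrable[OF hm])
    have "(\<lambda>t. LINT x|lborel. norm (case (t, x) of (t, x) \<Rightarrow> ?h t x)) = (\<lambda>t. indicator {0..1} t *\<^sub>R (LINT x|lborel. norm (f0 x)))"
      by (auto simp: In)
    then show "integrable lborel (\<lambda>t. LINT x|lborel. norm (case (t, x) of (t, x) \<Rightarrow> ?h t x))"
      by simp
    show "AE t in lborel. integrable lborel (\<lambda>x. case (t, x) of (t, x) \<Rightarrow> ?h t x)"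
      using f0\<rho> by (intro AE_I2) simp
  qed
  from lborel_pair.Fubini_integral[OF this]
  have swap: "(LINT x|lborel. LINT t|lborel. ?h t x) = (LINT t|lborel. LINT x|lborel. ?h t x)" .
  have right: "(LINT t|lborel. LINT x|lborel. ?h t x) = (LINT x|lborel. f0 x)"
  proof -
    have "(LINT t|lborel. LINT x|lborel. ?h t x) = (LINT t|lborel. indicator {0..1::real} t *\<^sub>R (LINT x|lborel. f0 x))"
      by (simp add: I)
    also have "\<dots> = (LINT x|lborel. f0 x)" by simp
    finally show ?thesis .
  qed
  have left: "(LINT x|lborel. LINT t|lborel. ?h t x) = (LINT x|lborel. indicator (ball (0::'a) r) x *\<^sub>R c)"
  proof (rule Bochner_Integration.integral_cong[OF refl])
    fix x :: 'a
    have "(LINT t|lborel. ?h t x) = (LINT t|lborel. indicator (ball 0 r) x *\<^sub>R (indicator {0..1} t *\<^sub>R f (\<rho> t x)))"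
      by (rule Bochner_Integration.integral_cong) (auto simp: f0_def norm indicator_def)
    also have "\<dots> = indicator (ball 0 r) x *\<^sub>R (LINT t:{0..1}|lborel. f (\<rho> t x))"
      unfolding set_lebesgue_integral_def by (cases "x \<in> ball 0 r") auto
    also have "\<dots> = indicator (ball 0 r) x *\<^sub>R c"
      using mean[of x] by (auto simp: indicator_def)
    finally show "(LINT t|lborel. ?h t x) = indicator (ball 0 r) x *\<^sub>R c" .
  qed
  have "(LINT x:ball 0 r|lborel. f x) = (LINT x|lborel. f0 x)"
    by (simp add: set_lebesgue_integral_def f0_def)
  also have "\<dots> = (LINT x|lborel. indicator (ball (0::'a) r) x *\<^sub>R c)" using swap left right by simp
  also have "\<dots> = measure lborel (ball (0::'a) r) *\<^sub>R c"
    using emeasure_lborel_ball_finite[of "0::'a" r] by (simp add: integral_scaleR_left)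
  finally show ?thesis .
qed

lemma cis_mult_mean:
  assumes "\<phi> holomorphic_on ball 0 R" "R > 1"
  shows "(LINT t:{0..1}|lborel. \<phi> (cis (2 * pi * t))) = \<phi> 0"
proof -
  have "continuous_on (cball 0 1) \<phi>"
    by (rule continuous_on_subset[OF holomorphic_on_imp_continuous_on[OF assms(1)]]) (use assms(2) in auto)
  moreover have "\<phi> holomorphic_on ball 0 1"
    by (rule holomorphic_on_subset[OF assms(1)]) (use assms(2) in auto)
  ultimately show ?thesis using circle_mean(1)[of 1 \<phi>] by simp
qed

lemma holo_mean_value:
  fixes f :: "complex^'n \<Rightarrow> complex"
  assumes f: "holo_on f (ball 0 r)" and int: "set_integrable lborel (ball 0 r) f"
  shows "(LINT z:ball 0 r|lborel. f z) = measure lborel (ball (0::complex^'n) r) *\<^sub>R f 0"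
proof (rule integral_ball_rotations[where \<rho>="\<lambda>t z. cis (2 * pi * t) *s z", OF _ _ _ int])
  show "linear (\<lambda>z::complex^'n. cis (2 * pi * t) *s z)" for t
    using bounded_linear_smult_right linear_linear by blast
  show "norm (cis (2 * pi * t) *s z) = norm z" for t and z :: "complex^'n"
    by (simp add: norm_vector_smult)
  have "continuous_on UNIV (\<lambda>p::real \<times> (complex^'n). \<chi> i. cis (2 * pi * fst p) * snd p $ i)"
    by (intro continuous_intros continuous_on_vec_lambda)
  then show "continuous_on UNIV (\<lambda>p::real \<times> (complex^'n). cis (2 * pi * fst p) *s snd p)"
    by (simp add: vector_scalar_mult_def)
  fix z :: "complex^'n" assume z: "z \<in> ball 0 r"
  \<comment> \<open>The function is holomorphic on a disc that is larger than the unit disc, since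
    \<open>z\<close> lies inside the open ball.\<close>
  define R where "R = (if z = 0 then 2 else r / norm z)"
  have R: "R > 1" using z by (auto simp: R_def)
  have "(\<lambda>t. f (0 + t *s z)) holomorphic_on ball 0 R"
  proof (rule holo_on_line[OF f])
    fix t :: complex assume "t \<in> ball 0 R"
    then show "0 + t *s z \<in> ball 0 r"
      using z by (cases "z = 0") (auto simp: R_def norm_vector_smult pos_less_divide_eq)
  qed
  from cis_mult_mean[OF this R] show "(LINT t:{0..1}|lborel. f (cis (2 * pi * t) *s z)) = f 0" by simp
qed

lemma holomorphic_mean_value:
  fixes \<phi> :: "complex \<Rightarrow> complex"
  assumes f: "\<phi> holomorphic_on ball 0 r" and int: "set_integrable lborel (ball 0 r) \<phi>"
  shows "(LINT z:ball 0 r|lborel. \<phi> z) = measure lborel (ball (0::complex) r) *\<^sub>R \<phi> 0"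
proof (rule integral_ball_rotations[where \<rho>="\<lambda>t z. cis (2 * pi * t) * z", OF _ _ _ int])
  show "linear (\<lambda>z. cis (2 * pi * t) * z)" for t by (rule linearI) (auto simp: algebra_simps)
  show "norm (cis (2 * pi * t) * z) = norm z" for t z by (simp add: norm_mult)
  show "continuous_on UNIV (\<lambda>p. cis (2 * pi * fst p) * snd p)" by (intro continuous_intros)
  fix z :: complex assume z: "z \<in> ball 0 r"
  define R where "R = (if z = 0 then 2 else r / norm z)"
  have R: "R > 1" using z by (auto simp: R_def)
  have "(\<lambda>t. \<phi> (t * z)) holomorphic_on ball 0 R"
  proof (rule holomorphic_on_compose_gen[OF _ f, unfolded o_def])
    show "(\<lambda>t. t * z) holomorphic_on ball 0 R" by (intro holomorphic_intros)
    show "(\<lambda>t. t * z) ` ball 0 R \<subseteq> ball 0 r"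
      using z by (cases "z = 0") (auto simp: R_def norm_mult pos_less_divide_eq)
  qed
  from cis_mult_mean[OF this R] show "(LINT t:{0..1}|lborel. \<phi> (cis (2 * pi * t) * z)) = \<phi> 0" by simp
qed

section \<open>Removable singularities of square integrable functions\<close>

lemma integrable_lborel_translate:
  fixes g :: "'a::euclidean_space \<Rightarrow> 'b::{banach, second_countable_topology}"
  assumes "integrable lborel g"
  shows "integrable lborel (\<lambda>x. g (c + x))" "(LINT x|lborel. g (c + x)) = (LINT x|lborel. g x)"
proof -
  have m: "g \<in> borel_measurable borel" using assms by auto
  show "integrable lborel (\<lambda>x. g (c + x))"
    using assms integrable_distr_eq[of "(+) c" lborel borel g] m by (simp add: lborel_distr_plus)
  show "(LINT x|lborel. g (c + x)) = (LINT x|lborel. g x)"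
    using integral_distr[of "(+) c" lborel borel g] m by (simp add: lborel_distr_plus)
qed

text \<open>The mean value property of the holomorphic function \<open>\<phi>\<^sup>2\<close>.\<close>

lemma holomorphic_square_sub_mean:
  fixes \<phi> :: "complex \<Rightarrow> complex"
  assumes hol: "\<phi> holomorphic_on ball s r" and r: "r > 0" and int: "set_integrable lborel (ball s r) (\<lambda>t. (cmod (\<phi> t))\<^sup>2)"
  shows "pi * r\<^sup>2 * (cmod (\<phi> s))\<^sup>2 \<le> (LINT t:ball s r|lborel. (cmod (\<phi> t))\<^sup>2)"
proof -
  define g where "g t = indicator (ball s r) t *\<^sub>R (\<phi> t)\<^sup>2" for t
  have ng: "norm (g t) = indicator (ball s r) t *\<^sub>R (cmod (\<phi> t))\<^sup>2" for t
    by (simp add: g_def norm_power)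
  have gm: "g \<in> borel_measurable borel"
    unfolding g_def[abs_def]
    by (intro borel_measurable_continuous_on_indicator continuous_intros holomorphic_on_imp_continuous_on[OF hol]) auto
  have gi: "integrable lborel g"
    using int gm unfolding set_integrable_def by (subst integrable_norm_iff[symmetric]) (auto simp: ng)
  have tr: "indicator (ball 0 r) t *\<^sub>R (\<phi> (s + t))\<^sup>2 = g (s + t)" for t
    by (auto simp: g_def indicator_def dist_norm)
  have int0: "set_integrable lborel (ball 0 r) (\<lambda>t. (\<phi> (s + t))\<^sup>2)"
    unfolding set_integrable_def tr by (rule integrable_lborel_translate(1)[OF gi])
  have hol0: "(\<lambda>t. (\<phi> (s + t))\<^sup>2) holomorphic_on ball 0 r"
    by (intro holomorphic_on_power holomorphic_on_compose_gen[OF _ hol, unfolded o_def] holomorphic_intros)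
       (auto simp: dist_norm)
  have "(LINT t|lborel. g t) = (LINT t:ball 0 r|lborel. (\<phi> (s + t))\<^sup>2)"
    unfolding set_lebesgue_integral_def tr by (rule integrable_lborel_translate(2)[OF gi, symmetric])
  also have "\<dots> = measure lborel (ball (0::complex) r) *\<^sub>R (\<phi> s)\<^sup>2"
    using holomorphic_mean_value[OF hol0 int0] by simp
  finally have "measure lborel (ball (0::complex) r) * (cmod (\<phi> s))\<^sup>2 = cmod (LINT t|lborel. g t)"
    by (simp add: norm_power)
  also have "\<dots> \<le> (LINT t|lborel. norm (g t))" by (rule integral_norm_bound)
  also have "\<dots> = (LINT t:ball s r|lborel. (cmod (\<phi> t))\<^sup>2)" unfolding ng set_lebesgue_integral_def ..
  also have "measure lborel (ball (0::complex) r) = pi * r\<^sup>2"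
    using content_ball[of r "0::complex"] r by (simp add: unit_ball_vol_2)
  finally show ?thesis .
qed

text \<open>The sub-mean value property on the disc around \<open>t\<close> of radius \<open>\<bar>t -
  s\<bar>\<close> bounds \<open>\<bar>(t - s) \<phi>(t)\<bar>\<^sup>2\<close> by the integral of
  \<open>\<bar>\<phi>\<bar>\<^sup>2\<close> over a disc shrinking to \<open>s\<close>, divided by
  \<open>\<pi>\<close>. This tends to zero, so Riemann's theorem applies at \<open>s\<close>.\<close>

lemma square_integrable_puncture:
  fixes \<phi> :: "complex \<Rightarrow> complex"
  assumes hol: "\<phi> holomorphic_on ball s r - {s}" and r: "r > 0"
    and int: "set_integrable lborel (ball s r - {s}) (\<lambda>t. (cmod (\<phi> t))\<^sup>2)"
  shows "((\<lambda>t. (t - s) * \<phi> t) \<longlongrightarrow> 0) (at s)"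
proof -
  let ?D = "ball s r - {s}"
  let ?g = "\<lambda>t. indicator ?D t *\<^sub>R (cmod (\<phi> t))\<^sup>2"
  have gi: "integrable lborel ?g" using int by (simp add: set_integrable_def)
  have "((\<lambda>t. (t - s) * \<phi> t) \<longlongrightarrow> 0) (at s within ball s (r / 2))"
    unfolding tendsto_at_iff_sequentially
  proof safe
    fix X assume X: "\<forall>i. X i \<in> ball s (r / 2) - {s}" "X \<longlonglongrightarrow> s"
    define d where "d i = cmod (X i - s)" for i
    have d: "d i > 0" "d i < r / 2" for i using X(1) by (auto simp: d_def dist_norm norm_minus_commute)
    have d0: "d \<longlonglongrightarrow> 0"
      using tendsto_norm[OF LIM_zero[OF X(2)]] by (simp add: d_def[abs_def])
    let ?I = "\<lambda>i. LINT t|lborel. indicator (ball s (2 * d i)) t *\<^sub>R ?g t"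
    have int_i: "integrable lborel (\<lambda>t. indicator (ball s (2 * d i)) t *\<^sub>R ?g t)" for i
      by (rule integrable_mult_indicator[OF _ gi]) simp
    have "?I \<longlonglongrightarrow> (LINT t|(lborel :: complex measure). 0)"
    proof (rule integral_dominated_convergence[OF _ _ gi])
      show "(\<lambda>t. indicator (ball s (2 * d i)) t *\<^sub>R ?g t) \<in> borel_measurable lborel" for i
        by (rule borel_measurable_integrable[OF int_i])
      show "AE t in lborel. norm (indicator (ball s (2 * d i)) t *\<^sub>R ?g t) \<le> ?g t" for i
        by (intro AE_I2) (auto simp: indicator_def)
      show "AE t in lborel. (\<lambda>i. indicator (ball s (2 * d i)) t *\<^sub>R ?g t) \<longlonglongrightarrow> 0"
      proof (intro AE_I2)
        fix t :: complex
        show "(\<lambda>i. indicator (ball s (2 * d i)) t *\<^sub>R ?g t) \<longlonglongrightarrow> 0"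
        proof (cases "t = s")
          case False
          then have "\<forall>\<^sub>F i in sequentially. d i < dist s t / 2"
            using order_tendstoD(2)[OF d0, of "dist s t / 2"] by auto
          then have "\<forall>\<^sub>F i in sequentially. indicator (ball s (2 * d i)) t *\<^sub>R ?g t = 0"
            by eventually_elim (auto simp: indicator_def)
          then show ?thesis by (rule tendsto_eventually)
        qed simp
      qed
    qed simp
    then have I0: "?I \<longlonglongrightarrow> 0" by simp
    have le: "(cmod ((X i - s) * \<phi> (X i)))\<^sup>2 \<le> ?I i / pi" for i
    proof -
      have sub: "ball (X i) (d i) \<subseteq> ?D"
      proof
        fix t assume t: "t \<in> ball (X i) (d i)"
        have "dist s t \<le> dist s (X i) + dist (X i) t" by (rule dist_triangle)
        then have "dist s t < r" using t d[of i] by (simp add: d_def dist_norm norm_minus_commute)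
        moreover have "t \<noteq> s" using t by (auto simp: d_def dist_norm)
        ultimately show "t \<in> ?D" by simp
      qed
      have sub2: "ball (X i) (d i) \<subseteq> ball s (2 * d i)"
      proof
        fix t assume t: "t \<in> ball (X i) (d i)"
        have "dist s t \<le> dist s (X i) + dist (X i) t" by (rule dist_triangle)
        then show "t \<in> ball s (2 * d i)" using t by (simp add: d_def dist_norm norm_minus_commute)
      qed
      have "pi * (d i)\<^sup>2 * (cmod (\<phi> (X i)))\<^sup>2 \<le> (LINT t:ball (X i) (d i)|lborel. (cmod (\<phi> t))\<^sup>2)"
        by (rule holomorphic_square_sub_mean[OF holomorphic_on_subset[OF hol sub] d(1)])
           (rule set_integrable_subset[OF int _ sub], simp)
      also have "\<dots> \<le> ?I i"
        unfolding set_lebesgue_integral_def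
      proof (rule integral_mono)
        show "integrable lborel (\<lambda>t. indicator (ball (X i) (d i)) t *\<^sub>R (cmod (\<phi> t))\<^sup>2)"
          using set_integrable_subset[OF int _ sub] by (simp add: set_integrable_def)
        show "indicator (ball (X i) (d i)) t *\<^sub>R (cmod (\<phi> t))\<^sup>2 \<le> indicator (ball s (2 * d i)) t *\<^sub>R ?g t" for t
          using sub sub2 by (auto simp: indicator_def)
      qed (rule int_i)
      finally have "pi * (d i)\<^sup>2 * (cmod (\<phi> (X i)))\<^sup>2 \<le> ?I i" .
      then show ?thesis
        by (simp add: d_def norm_mult power_mult_distrib pos_le_divide_eq mult_ac)
    qed
    have "(\<lambda>i. (cmod ((X i - s) * \<phi> (X i)))\<^sup>2) \<longlonglongrightarrow> 0"
    proof (rule tendsto_sandwich[OF _ _ tendsto_const])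
      show "(\<lambda>i. ?I i / pi) \<longlonglongrightarrow> 0" using tendsto_divide[OF I0 tendsto_const, of pi] by simp
      show "\<forall>\<^sub>F i in sequentially. 0 \<le> (cmod ((X i - s) * \<phi> (X i)))\<^sup>2" by simp
      show "\<forall>\<^sub>F i in sequentially. (cmod ((X i - s) * \<phi> (X i)))\<^sup>2 \<le> ?I i / pi" using le by simp
    qed
    from tendsto_real_sqrt[OF this] have "(\<lambda>i. cmod ((X i - s) * \<phi> (X i))) \<longlonglongrightarrow> 0" by simp
    then have "(\<lambda>i. (X i - s) * \<phi> (X i)) \<longlonglongrightarrow> 0" by (rule tendsto_norm_zero_cancel)
    then show "((\<lambda>t. (t - s) * \<phi> t) \<circ> X) \<longlonglongrightarrow> 0" by (simp add: o_def)
  qed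
  moreover have "at s within ball s (r / 2) = at s" using r by (intro at_within_open) auto
  ultimately show ?thesis by simp
qed

text \<open>The singularities in \<open>Z\<close> are removable by the previous lemma, and the extended
  function has the mean value property.\<close>

lemma circle_mean_square_integrable:
  fixes \<phi> :: "complex \<Rightarrow> complex"
  assumes W: "open W" "cball 0 R \<subseteq> W" and R: "R > 0" and Z: "finite Z" "Z \<subseteq> ball 0 R" "0 \<notin> Z"
    and hol: "\<phi> holomorphic_on (W - Z)"
    and int: "set_integrable lborel (ball 0 R - Z) (\<lambda>t. (cmod (\<phi> t))\<^sup>2)"
  shows "(LINT t:{0..1}|lborel. \<phi> (R * cis (2 * pi * t))) = \<phi> 0"
proof -
  have "\<exists>l. (\<phi> \<longlongrightarrow> l) (at s)" if s: "s \<in> Z" for s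
  proof -
    have "open (ball 0 R - (Z - {s}))" using Z by (intro open_Diff finite_imp_closed) auto
    moreover have "s \<in> ball 0 R - (Z - {s})" using s Z by auto
    ultimately obtain r where r: "r > 0" "ball s r \<subseteq> ball 0 R - (Z - {s})"
      using open_contains_ball by blast
    have sub: "ball s r - {s} \<subseteq> ball 0 R - Z" using r by auto
    have "ball 0 R \<subseteq> W" using W(2) by (meson ball_subset_cball order_trans)
    then have subW: "ball s r - {s} \<subseteq> W - Z" using sub by blast
    have "((\<lambda>t. (t - s) * \<phi> t) \<longlongrightarrow> 0) (at s)"
      by (rule square_integrable_puncture[OF holomorphic_on_subset[OF hol subW] r(1)])
         (rule set_integrable_subset[OF int _ sub], simp)
    then obtain g where g: "g holomorphic_on ball s r" "\<And>t. t \<in> ball s r - {s} \<Longrightarrow> g t = \<phi> t"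
      using holomorphic_on_extend_lim[of \<phi> "ball s r" s] holomorphic_on_subset[OF hol subW] r by auto
    have "isCont g s"
      using holomorphic_on_imp_continuous_on[OF g(1)] r continuous_on_eq_continuous_at by (metis centre_in_ball open_ball)
    then have "(g \<longlongrightarrow> g s) (at s)" by (simp add: isCont_def)
    then have "(\<phi> \<longlongrightarrow> g s) (at s)"
      by (rule Lim_transform_within_open[of _ _ _ _ "ball s r"]) (use r g in auto)
    then show ?thesis by blast
  qed
  then obtain l where l: "\<And>s. s \<in> Z \<Longrightarrow> (\<phi> \<longlongrightarrow> l s) (at s)" by metis
  define \<psi> where "\<psi> t = (if t \<in> Z then l t else \<phi> t)" for t
  have "\<psi> holomorphic_on W"
  proof (rule no_isolated_singularity'[OF _ _ W(1) Z(1)])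
    have "open (W - Z)" using W Z by (intro open_Diff finite_imp_closed)
    have "\<psi> holomorphic_on (W - Z) \<longleftrightarrow> \<phi> holomorphic_on (W - Z)"
      by (rule holomorphic_cong) (auto simp: \<psi>_def)
    with hol show "\<psi> holomorphic_on (W - Z)" by simp
    fix s assume s: "s \<in> Z"
    have "open (- (Z - {s}))" using Z by (intro open_Compl finite_imp_closed) auto
    then have lim: "(\<psi> \<longlongrightarrow> l s) (at s)"
      by (rule Lim_transform_within_open[OF l[OF s]]) (auto simp: \<psi>_def)
    then show "(\<psi> \<longlongrightarrow> \<psi> s) (at s within W)"
      using s tendsto_within_subset[OF lim, of W] by (simp add: \<psi>_def)
  qed
  then have "(LINT t:{0..1}|lborel. \<psi> (R * cis (2 * pi * t))) = \<psi> 0"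
    using W R by (intro circle_mean(1)) (auto intro!: holomorphic_on_imp_continuous_on elim!: holomorphic_on_subset)
  moreover have "\<psi> (R * cis (2 * pi * t)) = \<phi> (R * cis (2 * pi * t))" for t
    using Z R by (auto simp: \<psi>_def norm_mult subset_iff)
  ultimately show ?thesis using Z by (simp add: \<psi>_def)
qed

text \<open>For a holomorphic function this says that it vanishes identically on no connected component of
  the open set \<open>U\<close>.\<close>

definition generically_nonzero :: "(complex^'n \<Rightarrow> complex) \<Rightarrow> (complex^'n) set \<Rightarrow> bool" where
  "generically_nonzero \<Delta> U \<longleftrightarrow> (\<forall>W. open W \<and> W \<noteq> {} \<and> W \<subseteq> U \<longrightarrow> (\<exists>z\<in>W. \<Delta> z \<noteq> 0))"

lemma generically_nonzeroD:
  "generically_nonzero \<Delta> U \<Longrightarrow> open W \<Longrightarrow> x \<in> W \<Longrightarrow> W \<subseteq> U \<Longrightarrow> \<exists>z\<in>W. \<Delta> z \<noteq> 0"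
  unfolding generically_nonzero_def by blast

text \<open>By translation invariance, integrating \<open>g\<close> over all discs with a fixed direction
  \<open>v\<close> gives a multiple of its integral. So a property of almost all line slices can
  be read off from an integral over the whole space, for an arbitrary direction and without
  choosing coordinates.\<close>

lemma nn_integral_line_slices:
  fixes g :: "complex^'n \<Rightarrow> ennreal"
  assumes [measurable]: "g \<in> borel_measurable borel"
  shows "(\<integral>\<^sup>+z. (\<integral>\<^sup>+t. g (z + t *s v) * indicator (ball 0 R) t \<partial>lborel) \<partial>lborel)
           = (\<integral>\<^sup>+z. g z \<partial>lborel) * emeasure lborel (ball (0::complex) R)"
    and "(\<lambda>z. \<integral>\<^sup>+t. g (z + t *s v) * indicator (ball 0 R) t \<partial>lborel) \<in> borel_measurable lborel"
proof -
  have c: "continuous_on UNIV (\<lambda>p :: complex \<times> (complex^'n). snd p + fst p *s v)"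
    by (intro continuous_intros)
  have m: "(\<lambda>p :: complex \<times> (complex^'n). snd p + fst p *s v) \<in> borel_measurable (borel \<Otimes>\<^sub>M borel)"
    unfolding borel_prod by (rule borel_measurable_continuous_onI[OF c])
  have "(\<lambda>p :: complex \<times> (complex^'n). g (snd p + fst p *s v)) \<in> borel_measurable (borel \<Otimes>\<^sub>M borel)"
    using measurable_compose[OF m assms] .
  moreover have "(\<lambda>p :: complex \<times> (complex^'n). indicator (ball 0 R) (fst p) :: ennreal) \<in> borel_measurable (borel \<Otimes>\<^sub>M borel)"
    by (rule measurable_compose[OF measurable_fst borel_measurable_indicator]) simp
  ultimately have m1: "(\<lambda>p :: complex \<times> (complex^'n). g (snd p + fst p *s v) * indicator (ball 0 R) (fst p)) \<in> borel_measurable (borel \<Otimes>\<^sub>M borel)"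
    by (rule borel_measurable_times_ennreal)
  have meas: "(\<lambda>(t, z). g (z + t *s v) * indicator (ball 0 R) t) \<in> borel_measurable (lborel \<Otimes>\<^sub>M lborel)"
    using m1 by (simp add: case_prod_beta' cong: measurable_cong_sets)
  have tr: "(\<integral>\<^sup>+z. g (z + t *s v) \<partial>lborel) = (\<integral>\<^sup>+z. g z \<partial>lborel)" for t
  proof -
    have "(\<integral>\<^sup>+z. g z \<partial>lborel) = (\<integral>\<^sup>+z. g z \<partial>distr lborel borel ((+) (t *s v)))"
      by (simp add: lborel_distr_plus)
    also have "\<dots> = (\<integral>\<^sup>+z. g (t *s v + z) \<partial>lborel)" by (subst nn_integral_distr) auto
    finally show ?thesis by (simp add: add.commute)
  qed
  have "(\<integral>\<^sup>+z. (\<integral>\<^sup>+t. g (z + t *s v) * indicator (ball 0 R) t \<partial>lborel) \<partial>lborel)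
      = (\<integral>\<^sup>+t. (\<integral>\<^sup>+z. g (z + t *s v) * indicator (ball 0 R) t \<partial>lborel) \<partial>lborel)"
    by (rule lborel_pair.Fubini'[OF meas])
  also have "\<dots> = (\<integral>\<^sup>+t. (\<integral>\<^sup>+z. g z \<partial>lborel) * indicator (ball (0::complex) R) t \<partial>lborel)"
  proof (rule nn_integral_cong)
    fix t :: complex
    show "(\<integral>\<^sup>+z. g (z + t *s v) * indicator (ball 0 R) t \<partial>lborel) = (\<integral>\<^sup>+z. g z \<partial>lborel) * indicator (ball 0 R) t"
      by (cases "t \<in> ball 0 R") (auto simp: tr)
  qed
  also have "\<dots> = (\<integral>\<^sup>+z. g z \<partial>lborel) * emeasure lborel (ball (0::complex) R)"
    by (rule nn_integral_cmult_indicator) simp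
  finally show "(\<integral>\<^sup>+z. (\<integral>\<^sup>+t. g (z + t *s v) * indicator (ball 0 R) t \<partial>lborel) \<partial>lborel)
           = (\<integral>\<^sup>+z. g z \<partial>lborel) * emeasure lborel (ball (0::complex) R)" .
  have "(\<lambda>(z, t). g (z + t *s v) * indicator (ball 0 R) t) \<in> borel_measurable (lborel \<Otimes>\<^sub>M lborel)"
    using measurable_pair_swap[OF meas] by (simp add: case_prod_beta')
  from lborel.borel_measurable_nn_integral[OF this]
  show "(\<lambda>z. \<integral>\<^sup>+t. g (z + t *s v) * indicator (ball 0 R) t \<partial>lborel) \<in> borel_measurable lborel"
    by simp
qed

lemma emeasure_ball_pos:
  assumes "r > 0"
  shows "emeasure lborel (ball (c::'a::euclidean_space) r) \<noteq> 0"
  using content_ball_pos[OF assms, of c] by (auto simp: measure_def)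

lemma zero_set_borel:
  assumes "holo_on \<Delta> U"
  shows "{z \<in> U. \<Delta> z = 0} \<in> sets borel" and "open {z \<in> U. \<Delta> z \<noteq> 0}"
proof -
  have o: "open {z \<in> U. \<Delta> z \<noteq> 0}"
    using continuous_open_preimage[OF holo_on_continuous_on[OF assms] holo_on_open[OF assms], of "- {0}"]
    by (simp add: vimage_def Int_def open_Compl)
  then show "open {z \<in> U. \<Delta> z \<noteq> 0}" .
  have "{z \<in> U. \<Delta> z = 0} = U - {z \<in> U. \<Delta> z \<noteq> 0}" by blast
  then show "{z \<in> U. \<Delta> z = 0} \<in> sets borel" using o holo_on_open[OF assms] by auto
qed

text \<open>Near a point \<open>z0\<close> of \<open>U\<close> choose a direction \<open>v\<close> leading
  to a point where the function does not vanish. On every parallel line the zeros near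
  \<open>z0\<close> are then isolated, so all slices of the zero set are null.\<close>

lemma zero_set_null:
  fixes \<Delta> :: "complex^'n \<Rightarrow> complex"
  assumes \<Delta>: "holo_on \<Delta> U" and gen: "generically_nonzero \<Delta> U"
  shows "{z \<in> U. \<Delta> z = 0} \<in> null_sets lborel"
proof -
  let ?Z = "{z \<in> U. \<Delta> z = 0}"
  have loc: "\<exists>\<delta>>0. ?Z \<inter> ball z0 \<delta> \<in> null_sets lborel" if z0: "z0 \<in> U" for z0
  proof -
    obtain r where r: "r > 0" "ball z0 r \<subseteq> U" using z0 holo_on_open[OF \<Delta>] open_contains_ball by blast
    obtain y where y: "y \<in> ball z0 r" "\<Delta> y \<noteq> 0"
      using generically_nonzeroD[OF gen open_ball, of z0 z0 r] r by auto
    have "open ({z \<in> U. \<Delta> z \<noteq> 0} \<inter> ball z0 r)" by (intro open_Int zero_set_borel[OF \<Delta>] open_ball)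
    then obtain d where d: "d > 0" "ball y d \<subseteq> {z \<in> U. \<Delta> z \<noteq> 0} \<inter> ball z0 r"
      using y r open_contains_ball[of "{z \<in> U. \<Delta> z \<noteq> 0} \<inter> ball z0 r"] by blast
    define \<delta> where "\<delta> = min (d / 2) (r / 2)"
    have \<delta>: "\<delta> > 0" "\<delta> < d" "\<delta> < r" using d r by (auto simp: \<delta>_def)
    define v where "v = y - z0"
    let ?N = "?Z \<inter> ball z0 \<delta>"
    have N: "?N \<in> sets borel" using zero_set_borel[OF \<Delta>] by auto
    have inner: "(\<integral>\<^sup>+t. indicator ?N (z + t *s v) * indicator (ball (0::complex) 1) t \<partial>lborel) = 0" for z
    proof -
      define T where "T = {t. z + t *s v \<in> ball z0 r}"
      define K where "K = {t \<in> cball 0 1. z + t *s v \<in> cball z0 \<delta>}"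
      have cont: "continuous_on UNIV (\<lambda>t. z + t *s v)" by (intro continuous_intros)
      have T: "open T" "connected T"
      proof -
        have "T = (\<lambda>t. z + t *s v) -` ball z0 r" by (auto simp: T_def)
        then show "open T" using open_vimage[OF open_ball cont] by simp
        have "convex T"
          unfolding convex_alt
        proof safe
          fix s t and u :: real assume st: "s \<in> T" "t \<in> T" and u: "0 \<le> u" "u \<le> 1"
          have "z + ((1 - u) *\<^sub>R s + u *\<^sub>R t) *s v = (1 - u) *\<^sub>R (z + s *s v) + u *\<^sub>R (z + t *s v)"
            by (simp add: vec_eq_iff algebra_simps)
          also have "\<dots> \<in> ball z0 r"
            using convex_ball[of z0 r] st u unfolding convex_alt T_def by blast
          finally show "(1 - u) *\<^sub>R s + u *\<^sub>R t \<in> T" by (simp add: T_def)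
        qed
        then show "connected T" by (rule convex_connected)
      qed
      have "K = cball 0 1 \<inter> (\<lambda>t. z + t *s v) -` cball z0 \<delta>" by (auto simp: K_def)
      then have K: "compact K" using closed_vimage[OF closed_cball cont] by (simp add: compact_Int_closed)
      have KT: "K \<subseteq> T" using \<delta> by (auto simp: K_def T_def)
      have hol: "(\<lambda>t. \<Delta> (z + t *s v)) holomorphic_on T"
        by (rule holo_on_line[OF \<Delta>]) (use r in \<open>auto simp: T_def\<close>)
      have "finite {t \<in> K. \<Delta> (z + t *s v) = 0}"
      proof (cases "{t \<in> K. \<Delta> (z + t *s v) = 0} = {}")
        case False
        then obtain t where t: "t \<in> K" "\<Delta> (z + t *s v) = 0" by blast
        \<comment> \<open>As \<open>v = y - z0\<close>, a parameter that is larger by one leads from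
          near \<open>z0\<close> to near \<open>y\<close>.\<close>
        have "dist y (z + (t + 1) *s v) = dist z0 (z + t *s v)"
          by (simp add: v_def dist_norm algebra_simps)
        then have "z + (t + 1) *s v \<in> ball y d" using t \<delta> by (auto simp: K_def)
        then have "\<Delta> (z + (t + 1) *s v) \<noteq> 0" "t + 1 \<in> T" using d by (auto simp: T_def)
        then have "\<not> (\<lambda>t. \<Delta> (z + t *s v)) constant_on T"
          using t KT unfolding constant_on_def by (metis subsetD)
        then show ?thesis by (rule holomorphic_compact_finite_zeros[OF hol T K KT])
      next
        case True
        then show ?thesis by (simp only: finite.emptyI)
      qed
      then have fin: "{t \<in> K. \<Delta> (z + t *s v) = 0} \<in> null_sets lborel" by (rule finite_imp_null_set_lborel)
      have "AE t in lborel. indicator ?N (z + t *s v) * indicator (ball (0::complex) 1) t = (0::ennreal)"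
        using AE_not_in[OF fin]
        by eventually_elim (auto simp: indicator_def K_def less_imp_le)
      then show ?thesis by (subst nn_integral_cong_AE[where v="\<lambda>_. 0"]) auto
    qed
    have "(\<lambda>z. indicator ?N z :: ennreal) \<in> borel_measurable borel" using N by simp
    from nn_integral_line_slices(1)[OF this, of v 1]
    have "(\<integral>\<^sup>+z. indicator ?N z \<partial>lborel) * emeasure lborel (ball (0::complex) 1) = 0"
      unfolding inner by simp
    then have "emeasure lborel ?N = 0" using N emeasure_ball_pos[of 1 "0::complex"] by simp
    then show ?thesis using N \<delta> by (intro exI[of _ \<delta>]) (auto simp: null_sets_def)
  qed
  have "negligible ?Z"
  proof (rule locally_negligible_alt[THEN iffD2], rule ballI)
    fix z0 assume z0: "z0 \<in> ?Z"
    then have "z0 \<in> U" by simp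
    from loc[OF this] obtain \<delta> where \<delta>: "\<delta> > 0" "?Z \<inter> ball z0 \<delta> \<in> null_sets lborel"
      by (elim exE conjE)
    have "negligible (?Z \<inter> ball z0 \<delta>)"
      by (rule negligible_iff_null_sets[THEN iffD2, OF null_sets_completionI[OF \<delta>(2)]])
    then show "\<exists>V. openin (top_of_set ?Z) V \<and> z0 \<in> V \<and> negligible V"
      using \<delta>(1) z0 by (intro exI[of _ "?Z \<inter> ball z0 \<delta>"]) auto
  qed
  then show ?thesis
    using zero_set_borel(1)[OF \<Delta>] by (simp add: negligible_iff_null_sets null_sets_completion_iff)
qed

lemma AE_eq_imp_eq_on:
  fixes a b :: "'a::euclidean_space \<Rightarrow> complex"
  assumes O: "open O'" and a: "continuous_on O' a" and b: "continuous_on O' b"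
    and ae: "AE x in lborel. x \<in> O' \<longrightarrow> a x = b x" and x: "x \<in> O'"
  shows "a x = b x"
proof (rule ccontr)
  assume ne: "a x \<noteq> b x"
  let ?V = "{x \<in> O'. a x - b x \<noteq> 0}"
  have "continuous_on O' (\<lambda>x. a x - b x)" using a b by (intro continuous_intros)
  from continuous_open_preimage[OF this O, of "- {0}"]
  have V: "open ?V" by (simp add: vimage_def Int_def open_Compl)
  have "AE x in lborel. x \<notin> ?V" using ae by eventually_elim auto
  then have "?V \<in> null_sets lborel" using V by (subst AE_iff_null_sets) auto
  then have "negligible ?V" by (simp add: negligible_iff_null_sets null_sets_completionI)
  then show False using open_not_negligible[OF V] x ne by auto
qed

text \<open>On a line through \<open>z0\<close> and a nearby point where the function does not vanish there
  are finitely many zeros in the unit disc, hence a radius that none of them has.\<close>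

lemma circle_avoiding_zeros:
  fixes \<Delta> :: "complex^'n \<Rightarrow> complex"
  assumes \<Delta>: "holo_on \<Delta> U" and gen: "generically_nonzero \<Delta> U" and z0: "z0 \<in> U"
  obtains v R \<epsilon> where "0 < R" "R < 1" "0 < \<epsilon>"
    "\<And>z t. z \<in> ball z0 \<epsilon> \<Longrightarrow> cmod t < 2 \<Longrightarrow> z + t *s v \<in> U"
    "\<And>t. cmod t = R \<Longrightarrow> \<Delta> (z0 + t *s v) \<noteq> 0"
proof -
  obtain r where r: "r > 0" "ball z0 r \<subseteq> U" using z0 holo_on_open[OF \<Delta>] open_contains_ball by blast
  define \<epsilon> where "\<epsilon> = r / 3"
  have \<epsilon>: "\<epsilon> > 0" using r by (simp add: \<epsilon>_def)
  have "ball z0 \<epsilon> \<subseteq> U" using r by (auto simp: \<epsilon>_def)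
  then obtain y where y: "y \<in> ball z0 \<epsilon>" "\<Delta> y \<noteq> 0"
    using generically_nonzeroD[OF gen open_ball, of z0 z0 \<epsilon>] \<epsilon> by auto
  define v where "v = y - z0"
  have v: "norm v < \<epsilon>" using y by (simp add: v_def dist_norm norm_minus_commute)
  have line: "z + t *s v \<in> U" if "z \<in> ball z0 \<epsilon>" "cmod t < 2" for z t
  proof -
    have "norm (z0 - (z + t *s v)) \<le> norm (z0 - z) + cmod t * norm v"
      using norm_triangle_ineq4[of "z0 - z" "t *s v"] by (simp add: algebra_simps norm_vector_smult)
    also have "cmod t * norm v \<le> 2 * norm v" using that by (intro mult_right_mono) auto
    finally have "norm (z0 - (z + t *s v)) < r" using that v by (simp add: \<epsilon>_def dist_norm)
    then show ?thesis using r by (auto simp: dist_norm)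
  qed
  have hol: "(\<lambda>t. \<Delta> (z0 + t *s v)) holomorphic_on ball 0 2"
    by (rule holo_on_line[OF \<Delta>]) (use line[of z0] \<epsilon> in auto)
  have fin: "finite {t \<in> cball 0 1. \<Delta> (z0 + t *s v) = 0}"
  proof (cases "{t \<in> cball 0 1. \<Delta> (z0 + t *s v) = 0} = {}")
    case False
    then obtain t where t: "t \<in> cball 0 1" "\<Delta> (z0 + t *s v) = 0" by blast
    have t2: "t \<in> ball 0 2" "(1::complex) \<in> ball 0 2" using t by auto
    have "\<Delta> (z0 + 1 *s v) \<noteq> 0" using y by (simp add: v_def)
    then have "\<not> (\<lambda>t. \<Delta> (z0 + t *s v)) constant_on ball 0 2"
      using t(2) t2 unfolding constant_on_def by metis
    then show ?thesis by (intro holomorphic_compact_finite_zeros[OF hol]) auto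
  next
    case True
    then show ?thesis by (simp only: finite.emptyI)
  qed
  then have "finite (cmod ` {t \<in> cball 0 1. \<Delta> (z0 + t *s v) = 0})" by simp
  then have "{0<..<1::real} - cmod ` {t \<in> cball 0 1. \<Delta> (z0 + t *s v) = 0} \<noteq> {}"
    by (metis Diff_eq_empty_iff finite_subset infinite_Ioo zero_less_one)
  then obtain R where R: "R \<in> {0<..<1}" "R \<notin> cmod ` {t \<in> cball 0 1. \<Delta> (z0 + t *s v) = 0}" by blast
  show ?thesis
  proof (rule that[of R \<epsilon> v])
    show "0 < R" "R < 1" using R by auto
    show "0 < \<epsilon>" by (rule \<epsilon>)
    show "z + t *s v \<in> U" if "z \<in> ball z0 \<epsilon>" "cmod t < 2" for z t by (rule line[OF that])
    show "\<Delta> (z0 + t *s v) \<noteq> 0" if "cmod t = R" for t using R that by auto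
  qed
qed

text \<open>Riemann's removable singularity theorem in the \<open>L\<^sup>2\<close> setting. Near
  \<open>z0\<close> the extension is the average \<open>g1\<close> of \<open>f\<close> over
  circles \<open>z + R e\<^sup>i\<^sup>t v\<close>, which stay away from the zeros of
  \<open>\<Delta>\<close> and so depend holomorphically on \<open>z\<close>. For almost all
  \<open>z\<close> the restriction of \<open>f\<close> to the disc is square integrable, with
  finitely many singularities, and \<open>circle_mean_square_integrable\<close> shows that
  \<open>g1 z = f z\<close>; by continuity this holds wherever \<open>\<Delta>\<close> is nonzero.\<close>

lemma square_integrable_extension:
  fixes \<Delta> f :: "complex^'n \<Rightarrow> complex"
  assumes \<Delta>: "holo_on \<Delta> U" and gen: "generically_nonzero \<Delta> U"
    and f: "holo_on f {z \<in> U. \<Delta> z \<noteq> 0}"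
    and int: "set_integrable lborel {z \<in> U. \<Delta> z \<noteq> 0} (\<lambda>z. (cmod (f z))\<^sup>2)"
  obtains g where "holo_on g U" "\<And>z. z \<in> U \<Longrightarrow> \<Delta> z \<noteq> 0 \<Longrightarrow> g z = f z"
proof -
  let ?U' = "{z \<in> U. \<Delta> z \<noteq> 0}"
  have U': "open ?U'" by (rule zero_set_borel(2)[OF \<Delta>])
  define g where "g z = ennreal (indicator ?U' z *\<^sub>R (cmod (f z))\<^sup>2)" for z
  have g0: "(\<lambda>z. indicator ?U' z *\<^sub>R (cmod (f z))\<^sup>2) \<in> borel_measurable borel"
    using int by (auto simp: set_integrable_def)
  then have gm: "g \<in> borel_measurable borel" unfolding g_def[abs_def] by measurable
  have gfin: "(\<integral>\<^sup>+z. g z \<partial>lborel) < \<infinity>"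
    using int unfolding g_def set_integrable_def by (subst nn_integral_eq_integral) auto
  have loc: "\<exists>\<delta> g0. \<delta> > 0 \<and> ball z0 \<delta> \<subseteq> U \<and> holo_on g0 (ball z0 \<delta>) \<and> (\<forall>z\<in>ball z0 \<delta> \<inter> ?U'. g0 z = f z)"
    if z0: "z0 \<in> U" for z0
  proof -
    obtain v R \<epsilon> where R: "0 < R" "R < 1" and \<epsilon>: "0 < \<epsilon>"
      and line: "\<And>z t. z \<in> ball z0 \<epsilon> \<Longrightarrow> cmod t < 2 \<Longrightarrow> z + t *s v \<in> U"
      and nz: "\<And>t. cmod t = R \<Longrightarrow> \<Delta> (z0 + t *s v) \<noteq> 0"
      by (rule circle_avoiding_zeros[OF \<Delta> gen z0], rule that)
    have hol: "(\<lambda>t. \<Delta> (z + t *s v)) holomorphic_on ball 0 2" if "z \<in> ball z0 \<epsilon>" for z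
      by (rule holo_on_line[OF \<Delta>]) (use line[OF that] in auto)
    have fin: "finite {t \<in> cball 0 R. \<Delta> (z + t *s v) = 0}"
      if z: "z \<in> ball z0 \<epsilon>" and R: "R < 2" and nz: "\<exists>t\<in>ball 0 2. \<Delta> (z + t *s v) \<noteq> 0" for z R
    proof (cases "{t \<in> cball 0 R. \<Delta> (z + t *s v) = 0} = {}")
      case False
      then obtain t where "t \<in> cball 0 R" "\<Delta> (z + t *s v) = 0" by blast
      with R nz have "\<not> (\<lambda>t. \<Delta> (z + t *s v)) constant_on ball 0 2"
        unfolding constant_on_def by (metis (no_types, lifting) mem_ball mem_cball order_le_less_trans)
      then show ?thesis
        using R by (intro holomorphic_compact_finite_zeros[OF hol[OF z]]) auto
    next
      case True
      then show ?thesis by (simp only: finite.emptyI)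
    qed
    let ?S = "(\<lambda>t. z0 + t *s v) ` sphere 0 R"
    have S1: "compact ?S" by (intro compact_continuous_image continuous_intros compact_sphere)
    have "z0 + t *s v \<in> ?U'" if "cmod t = R" for t
      using nz[OF that] line[of z0 t] R \<epsilon> that by simp
    then have S2: "?S \<subseteq> ?U'" by auto
    obtain \<delta>' where \<delta>': "\<delta>' > 0" "(\<Union>x\<in>?S. ball x \<delta>') \<subseteq> ?U'"
      using compact_subset_open_imp_ball_epsilon_subset[OF S1 U' S2] by blast
    define \<delta> where "\<delta> = min \<delta>' \<epsilon>"
    have \<delta>: "\<delta> > 0" "\<delta> \<le> \<delta>'" "\<delta> \<le> \<epsilon>" using \<delta>' \<epsilon> by (auto simp: \<delta>_def)
    have circ: "z + t *s v \<in> ?U'" if z: "z \<in> ball z0 \<delta>" and t: "cmod t = R" for z t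
    proof -
      have "z + t *s v \<in> ball (z0 + t *s v) \<delta>'" using z \<delta> by (auto simp: dist_norm)
      moreover have "z0 + t *s v \<in> ?S" using t by auto
      ultimately show ?thesis using \<delta>'(2) by blast
    qed
    let ?c = "\<lambda>t. R * cis (2 * pi * t)"
    have nc: "cmod (?c t) = R" for t using R by (simp add: norm_mult)
    define g1 where "g1 z = (LINT t:{0..1}|lborel. f (z + ?c t *s v))" for z
    have g1: "holo_on g1 (ball z0 \<delta>)"
      unfolding g1_def
    proof (rule holo_on_integral_interval)
      have "continuous_on (ball z0 \<delta> \<times> {0..1}) (\<lambda>x. f (fst x + ?c (snd x) *s v))"
        by (rule continuous_on_compose2[OF holo_on_continuous_on[OF f]])
           (use circ[OF _ nc] in \<open>auto intro!: continuous_intros\<close>)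
      then show "continuous_on (ball z0 \<delta> \<times> {0..1}) (\<lambda>(z, t). f (z + ?c t *s v))"
        by (simp add: case_prod_beta)
      fix t :: real
      show "holo_on (\<lambda>z. f (z + ?c t *s v)) (ball z0 \<delta>)"
      proof (rule holo_on_compose[OF f])
        show "holo_map_on (\<lambda>z. z + ?c t *s v) (ball z0 \<delta>)"
          unfolding holo_map_on_def by (auto intro!: holo_on_add holo_on_nth holo_on_const)
        show "(\<lambda>z. z + ?c t *s v) ` ball z0 \<delta> \<subseteq> ?U'" using circ[OF _ nc] by blast
      qed
    qed simp
    \<comment> \<open>The circle average equals the value at the centre on every disc with finite
      energy.\<close>
    have mean: "g1 z = f z" if z: "z \<in> ball z0 \<delta> \<inter> ?U'"
      and slice: "(\<integral>\<^sup>+t. g (z + t *s v) * indicator (ball 0 R) t \<partial>lborel) \<noteq> \<infinity>" for z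
    proof -
      have z\<epsilon>: "z \<in> ball z0 \<epsilon>" using z \<delta> by auto
      let ?\<phi> = "\<lambda>t. f (z + t *s v)"
      define Z where "Z = {t \<in> cball 0 R. \<Delta> (z + t *s v) = 0}"
      define W where "W = {t \<in> ball 0 2. \<Delta> (z + t *s v) \<noteq> 0} \<union> ball 0 R"
      have "open {t \<in> ball 0 2. \<Delta> (z + t *s v) \<noteq> 0}"
        using continuous_open_preimage[OF holomorphic_on_imp_continuous_on[OF hol[OF z\<epsilon>]] open_ball, of "- {0}"]
        by (simp add: vimage_def Int_def open_Compl)
      then have W: "open W" by (auto simp: W_def)
      have cW: "cball 0 R \<subseteq> W"
      proof
        fix t :: complex assume t: "t \<in> cball 0 R"
        show "t \<in> W"
        proof (cases "cmod t = R")
          case True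
          then show ?thesis using circ[of z t] z R by (auto simp: W_def)
        qed (use t in \<open>auto simp: W_def\<close>)
      qed
      have 0: "\<Delta> (z + 0 *s v) \<noteq> 0" using z by simp
      have Zf: "finite Z" unfolding Z_def by (rule fin[OF z\<epsilon>]) (use R 0 in \<open>auto intro!: bexI[of _ 0]\<close>)
      have Zb: "Z \<subseteq> ball 0 R"
      proof
        fix t assume t: "t \<in> Z"
        then have "cmod t \<noteq> R" using circ[of z t] z by (auto simp: Z_def)
        then show "t \<in> ball 0 R" using t by (auto simp: Z_def)
      qed
      have Z0: "0 \<notin> Z" using 0 by (auto simp: Z_def)
      have WU: "z + t *s v \<in> ?U'" if t: "t \<in> W - Z" for t
      proof -
        have "cmod t < 2" using t R by (auto simp: W_def)
        then have "z + t *s v \<in> U" by (rule line[OF z\<epsilon>])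
        then show ?thesis using t by (auto simp: W_def Z_def)
      qed
      have hol\<phi>: "?\<phi> holomorphic_on W - Z" by (rule holo_on_line[OF f WU])
      have BW: "ball 0 R - Z \<subseteq> W - Z" by (auto simp: W_def)
      have "Z \<in> sets borel" using Zf by (simp add: borel_closed finite_imp_closed)
      then have bZ: "ball 0 R - Z \<in> sets borel" by (rule sets.Diff[OF borel_open[OF open_ball]])
      have "continuous_on (ball 0 R - Z) ?\<phi>"
        by (rule continuous_on_subset[OF holomorphic_on_imp_continuous_on[OF hol\<phi>] BW])
      then have "continuous_on (ball 0 R - Z) (\<lambda>t. (cmod (?\<phi> t))\<^sup>2)" by (intro continuous_intros)
      then have m\<phi>: "(\<lambda>t. indicator (ball 0 R - Z) t *\<^sub>R (cmod (?\<phi> t))\<^sup>2) \<in> borel_measurable borel"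
        by (rule borel_measurable_continuous_on_indicator[OF bZ])
      have "set_integrable lborel (ball 0 R - Z) (\<lambda>t. (cmod (?\<phi> t))\<^sup>2)"
        unfolding set_integrable_def
      proof (rule integrableI_nonneg)
        show "(\<lambda>t. indicator (ball 0 R - Z) t *\<^sub>R (cmod (?\<phi> t))\<^sup>2) \<in> borel_measurable lborel"
          using m\<phi> by simp
        have "(\<integral>\<^sup>+t. ennreal (indicator (ball 0 R - Z) t *\<^sub>R (cmod (?\<phi> t))\<^sup>2) \<partial>lborel)
            \<le> (\<integral>\<^sup>+t. g (z + t *s v) * indicator (ball 0 R) t \<partial>lborel)"
        proof (rule nn_integral_mono)
          fix t :: complex
          show "ennreal (indicator (ball 0 R - Z) t *\<^sub>R (cmod (?\<phi> t))\<^sup>2) \<le> g (z + t *s v) * indicator (ball 0 R) t"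
          proof (cases "t \<in> ball 0 R - Z")
            case True
            then have "z + t *s v \<in> ?U'" using WU BW by blast
            then show ?thesis using True by (simp add: g_def)
          qed simp
        qed
        also have "\<dots> < \<infinity>" using slice by (simp add: less_top)
        finally show "(\<integral>\<^sup>+t. ennreal (indicator (ball 0 R - Z) t *\<^sub>R (cmod (?\<phi> t))\<^sup>2) \<partial>lborel) < \<infinity>" .
      qed auto
      from circle_mean_square_integrable[OF W cW R(1) Zf Zb Z0 hol\<phi> this]
      show ?thesis by (simp add: g1_def)
    qed
    have "AE z in lborel. (\<integral>\<^sup>+t. g (z + t *s v) * indicator (ball 0 R) t \<partial>lborel) \<noteq> \<infinity>"
    proof (rule nn_integral_PInf_AE[OF nn_integral_line_slices(2)[OF gm]])
      have "emeasure lborel (ball (0::complex) R) < \<infinity>" using emeasure_lborel_ball_finite[of "0::complex" R] by simp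
      then show "(\<integral>\<^sup>+z. (\<integral>\<^sup>+t. g (z + t *s v) * indicator (ball 0 R) t \<partial>lborel) \<partial>lborel) \<noteq> \<infinity>"
        unfolding nn_integral_line_slices(1)[OF gm] using gfin
        by (simp add: ennreal_mult_eq_top_iff less_top)
    qed
    then have ae: "AE z in lborel. z \<in> ball z0 \<delta> \<inter> ?U' \<longrightarrow> g1 z = f z"
      by eventually_elim (auto intro: mean)
    have "g1 z = f z" if "z \<in> ball z0 \<delta> \<inter> ?U'" for z
    proof (rule AE_eq_imp_eq_on[OF _ _ _ ae that])
      show "open (ball z0 \<delta> \<inter> ?U')" using U' by auto
      show "continuous_on (ball z0 \<delta> \<inter> ?U') g1" by (rule continuous_on_subset[OF holo_on_continuous_on[OF g1]]) auto
      show "continuous_on (ball z0 \<delta> \<inter> ?U') f" by (rule continuous_on_subset[OF holo_on_continuous_on[OF f]]) auto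
    qed
    moreover have "ball z0 \<delta> \<subseteq> U" using line[of _ 0] \<delta> by auto
    ultimately show ?thesis using \<delta>(1) g1 by blast
  qed
  \<comment> \<open>The local extensions agree with the limit of \<open>f\<close>, so they fit
    together.\<close>
  define h where "h z = Lim (at z within ?U') f" for z
  have heq: "h z = g0 z" if g0: "holo_on g0 (ball z0 \<delta>)" "\<And>z. z \<in> ball z0 \<delta> \<inter> ?U' \<Longrightarrow> g0 z = f z"
    "ball z0 \<delta> \<subseteq> U" and z: "z \<in> ball z0 \<delta>" for g0 z0 \<delta> z
  proof -
    have nontriv: "at z within ?U' \<noteq> bot"
    proof -
      have "z islimpt ?U'"
        unfolding islimpt_def
      proof (intro allI impI)
        fix T assume T: "z \<in> T" "open T"
        let ?T = "T \<inter> ball z0 \<delta> - {z}"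
        have op: "open ?T" using T by auto
        have "?T \<noteq> {}"
        proof
          assume e: "?T = {}"
          have "open (T \<inter> ball z0 \<delta>)" using T by auto
          moreover have "T \<inter> ball z0 \<delta> = {z}" using e T z by auto
          ultimately have "open {z}" by simp
          then show False by (simp add: not_open_singleton)
        qed
        then obtain x where x: "x \<in> ?T" by blast
        have TU: "?T \<subseteq> U" using g0(3) by auto
        obtain w where w: "w \<in> ?T" "\<Delta> w \<noteq> 0"
          using generically_nonzeroD[OF gen op x TU] by (rule bexE)
        then have "w \<in> ?U'" using TU by auto
        then show "\<exists>y\<in>?U'. y \<in> T \<and> y \<noteq> z" using w(1) by auto
      qed
      then show ?thesis by (simp add: trivial_limit_within)
    qed
    have "isCont g0 z" using holo_on_continuous_on[OF g0(1)] z by (simp add: continuous_on_eq_continuous_at)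
    then have "(g0 \<longlongrightarrow> g0 z) (at z within ?U')" by (auto simp: isCont_def intro: tendsto_within_subset)
    moreover have "\<forall>\<^sub>F x in at z within ?U'. g0 x = f x"
      unfolding eventually_at_topological using z g0(2) by (intro exI[of _ "ball z0 \<delta>"]) auto
    ultimately have "(f \<longlongrightarrow> g0 z) (at z within ?U')" by (rule Lim_transform_eventually)
    then show ?thesis unfolding h_def by (rule tendsto_Lim[OF nontriv])
  qed
  show ?thesis
  proof (rule that)
    show "holo_on h U"
    proof (rule holo_on_local[OF holo_on_open[OF \<Delta>]])
      fix z0 assume "z0 \<in> U"
      then obtain \<delta> g0 where *: "\<delta> > 0" "ball z0 \<delta> \<subseteq> U" "holo_on g0 (ball z0 \<delta>)" "\<And>z. z \<in> ball z0 \<delta> \<inter> ?U' \<Longrightarrow> g0 z = f z"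
        using loc by blast
      have "holo_on h (ball z0 \<delta>)"
        by (rule holo_on_cong[OF *(3)]) (rule heq[OF *(3,4,2)])
      then show "\<exists>V. z0 \<in> V \<and> holo_on h V" using *(1) by (intro exI[of _ "ball z0 \<delta>"]) simp
    qed
    fix z assume z: "z \<in> U" "\<Delta> z \<noteq> 0"
    then obtain \<delta> g0 where *: "\<delta> > 0" "ball z \<delta> \<subseteq> U" "holo_on g0 (ball z \<delta>)" "\<And>w. w \<in> ball z \<delta> \<inter> ?U' \<Longrightarrow> g0 w = f w"
      using loc[of z] by blast
    have "h z = g0 z" by (rule heq[OF *(3,4,2)]) (use *(1) in auto)
    also have "\<dots> = f z" by (rule *(4)) (use * z in auto)
    finally show "h z = f z" .
  qed
qed

section \<open>Bergman spaces and reproducing functions\<close>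

lemma ball_volume_pos: "measure lborel (unit_ball :: (complex^'n) set) > 0"
  using content_ball_pos[of 1 "0::complex^'n"] by simp

lemma normalized_volume_density:
  "normalized_volume = density (lborel :: (complex^'n) measure)
     (\<lambda>_. ennreal (1 / measure lborel (unit_ball :: (complex^'n) set)))"
proof (rule measure_eqI)
  show "sets (normalized_volume :: (complex^'n) measure) = sets (density lborel
     (\<lambda>_. ennreal (1 / measure lborel (unit_ball :: (complex^'n) set))))"
    by (simp add: normalized_volume_def)
  fix A :: "(complex^'n) set" assume "A \<in> sets normalized_volume"
  then have A: "A \<in> sets lborel" by (simp add: normalized_volume_def)
  have "emeasure lborel (unit_ball :: (complex^'n) set) = ennreal (measure lborel (unit_ball :: (complex^'n) set))"
    using emeasure_lborel_ball_finite[of "0::complex^'n" 1] by (intro emeasure_eq_ennreal_measure) auto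
  then have "1 / emeasure lborel (unit_ball :: (complex^'n) set) = ennreal (1 / measure lborel (unit_ball :: (complex^'n) set))"
    using ball_volume_pos[where 'n='n] by (simp add: divide_ennreal[symmetric])
  then show "emeasure normalized_volume A = emeasure (density lborel
     (\<lambda>_. ennreal (1 / measure lborel (unit_ball :: (complex^'n) set)))) A"
    using A by (simp add: normalized_volume_def emeasure_density_const)
qed

lemma set_integrable_normalized_volume:
  fixes f :: "complex^'n \<Rightarrow> 'b::{banach, second_countable_topology}"
  shows "set_integrable normalized_volume D f \<longleftrightarrow> set_integrable lborel D f"
proof -
  let ?v = "measure lborel (unit_ball :: (complex^'n) set)"
  let ?f = "\<lambda>x. indicator D x *\<^sub>R f x"
  have v: "?v > 0" by (rule ball_volume_pos)
  have "integrable normalized_volume ?f \<longleftrightarrow> integrable lborel ?f"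
  proof
    assume i: "integrable normalized_volume ?f"
    then have m: "?f \<in> borel_measurable borel"
      by (auto simp: normalized_volume_density dest: borel_measurable_integrable)
    have "integrable (density lborel (\<lambda>_. ennreal (1 / ?v))) ?f \<longleftrightarrow> integrable lborel (\<lambda>x. (1 / ?v) *\<^sub>R ?f x)"
      by (rule integrable_density) (use m v in auto)
    with i have "integrable lborel (\<lambda>x. (1 / ?v) *\<^sub>R ?f x)"
      by (simp only: normalized_volume_density)
    then have "integrable lborel (\<lambda>x. ?v *\<^sub>R ((1 / ?v) *\<^sub>R ?f x))" by (rule integrable_scaleR_right)
    moreover have "?v *\<^sub>R ((1 / ?v) *\<^sub>R y) = y" for y :: 'b using v by simp
    ultimately show "integrable lborel ?f" by (simp only:)
  next
    assume i: "integrable lborel ?f"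
    then have m: "?f \<in> borel_measurable borel" by (auto dest: borel_measurable_integrable)
    have "integrable lborel (\<lambda>x. (1 / ?v) *\<^sub>R ?f x)" using i by (rule integrable_scaleR_right)
    then show "integrable normalized_volume ?f"
      unfolding normalized_volume_density using m v by (subst integrable_density) auto
  qed
  then show ?thesis by (simp add: set_integrable_def)
qed

lemma integral_normalized_volume:
  fixes f :: "complex^'n \<Rightarrow> complex"
  assumes "set_integrable lborel D f"
  shows "(LINT z:D|normalized_volume. f z) = (LINT z:D|lborel. f z) / measure lborel (unit_ball :: (complex^'n) set)"
proof -
  let ?v = "measure lborel (unit_ball :: (complex^'n) set)"
  have m: "(\<lambda>x. indicator D x *\<^sub>R f x) \<in> borel_measurable borel"
    using assms by (auto simp: set_integrable_def dest: borel_measurable_integrable)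
  have "(LINT z:D|normalized_volume. f z) = (LINT z|lborel. (1 / ?v) *\<^sub>R (indicator D z *\<^sub>R f z))"
    unfolding set_lebesgue_integral_def normalized_volume_density
    using m ball_volume_pos[where 'n='n] by (subst integral_density) auto
  also have "\<dots> = (1 / ?v) *\<^sub>R (LINT z:D|lborel. f z)"
    unfolding set_lebesgue_integral_def by (rule integral_scaleR_right)
  finally show ?thesis by (simp add: scaleR_conv_of_real)
qed

lemma bergman_space_iff:
  "f \<in> bergman_space D \<longleftrightarrow> holo_on f D \<and> set_integrable lborel D (\<lambda>z. (cmod (f z))\<^sup>2)"
  by (simp add: bergman_space_def set_integrable_normalized_volume)

text \<open>Unnormalized: the factor \<open>1 / V(B)\<close> of the normalized volume is moved into
  \<open>reproduces\<close>.\<close>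

definition inner_L2 :: "(complex^'n) set \<Rightarrow> (complex^'n \<Rightarrow> complex) \<Rightarrow> (complex^'n \<Rightarrow> complex) \<Rightarrow> complex" where
  "inner_L2 D f g = (LINT z:D|lborel. f z * cnj (g z))"

lemma set_borel_measurable_continuous:
  fixes f :: "complex^'n \<Rightarrow> 'b::{banach, second_countable_topology}"
  shows "D \<in> sets borel \<Longrightarrow> continuous_on D f \<Longrightarrow> set_borel_measurable borel D f"
  unfolding set_borel_measurable_def by (rule borel_measurable_continuous_on_indicator)

lemma set_borel_measurable_lborel: "set_borel_measurable borel D f \<Longrightarrow> set_borel_measurable lborel D f"
  by (simp add: set_borel_measurable_def)

lemma mult_le_sum_squares: "(a::real) * b \<le> a\<^sup>2 + b\<^sup>2"
proof -
  have "2 * (a * b) \<le> a\<^sup>2 + b\<^sup>2" using zero_le_power2[of "a - b"] by (simp add: power2_diff)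
  moreover have "0 \<le> a\<^sup>2 + b\<^sup>2" by simp
  ultimately show ?thesis by linarith
qed

lemma set_integrable_product:
  fixes D :: "(complex^'n) set"
  assumes D: "D \<in> sets borel" and f: "continuous_on D f" "set_integrable lborel D (\<lambda>z. (cmod (f z))\<^sup>2)"
    and g: "continuous_on D g" "set_integrable lborel D (\<lambda>z. (cmod (g z))\<^sup>2)"
  shows "set_integrable lborel D (\<lambda>z. f z * cnj (g z))"
proof (rule set_integrable_bound)
  show "set_integrable lborel D (\<lambda>z. (cmod (f z))\<^sup>2 + (cmod (g z))\<^sup>2)"
    using f g by (intro set_integral_add)
  have "continuous_on D (\<lambda>z. f z * cnj (g z))" by (intro continuous_intros f g)
  then show "set_borel_measurable lborel D (\<lambda>z. f z * cnj (g z))"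
    by (intro set_borel_measurable_lborel set_borel_measurable_continuous D)
  show "AE z in lborel. z \<in> D \<longrightarrow> norm (f z * cnj (g z)) \<le> norm ((cmod (f z))\<^sup>2 + (cmod (g z))\<^sup>2)"
    by (intro AE_I2) (simp add: norm_mult mult_le_sum_squares)
qed

lemma bergman_space_product:
  assumes "f \<in> bergman_space D" "g \<in> bergman_space D"
  shows "set_integrable lborel D (\<lambda>z. f z * cnj (g z))"
  using assms unfolding bergman_space_iff
  by (intro set_integrable_product holo_on_continuous_on) (auto intro: borel_open holo_on_open)

lemma bergman_space_add:
  assumes f: "f \<in> bergman_space D" and g: "g \<in> bergman_space D"
  shows "(\<lambda>z. f z + g z) \<in> bergman_space D"
  unfolding bergman_space_iff
proof
  have fg: "holo_on f D" "holo_on g D" using f g by (auto simp: bergman_space_iff)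
  then show h: "holo_on (\<lambda>z. f z + g z) D" by (rule holo_on_add)
  show "set_integrable lborel D (\<lambda>z. (cmod (f z + g z))\<^sup>2)"
  proof (rule set_integrable_bound)
    show "set_integrable lborel D (\<lambda>z. 2 * (cmod (f z))\<^sup>2 + 2 * (cmod (g z))\<^sup>2)"
      using f g by (intro set_integral_add set_integrable_mult_right) (auto simp: bergman_space_iff)
    have "continuous_on D (\<lambda>z. (cmod (f z + g z))\<^sup>2)"
      using holo_on_continuous_on[OF h] by (intro continuous_on_power continuous_on_norm)
    then show "set_borel_measurable lborel D (\<lambda>z. (cmod (f z + g z))\<^sup>2)"
      using holo_on_open[OF h] by (intro set_borel_measurable_lborel set_borel_measurable_continuous) auto
    show "AE z in lborel. z \<in> D \<longrightarrow> norm ((cmod (f z + g z))\<^sup>2) \<le> norm (2 * (cmod (f z))\<^sup>2 + 2 * (cmod (g z))\<^sup>2)"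
    proof (intro AE_I2 impI)
      fix z
      have "(cmod (f z + g z))\<^sup>2 \<le> (cmod (f z) + cmod (g z))\<^sup>2" by (intro power_mono norm_triangle_ineq) simp
      also have "\<dots> \<le> 2 * (cmod (f z))\<^sup>2 + 2 * (cmod (g z))\<^sup>2"
        using zero_le_power2[of "cmod (f z) - cmod (g z)"] by (simp add: power2_sum power2_diff)
      finally show "norm ((cmod (f z + g z))\<^sup>2) \<le> norm (2 * (cmod (f z))\<^sup>2 + 2 * (cmod (g z))\<^sup>2)" by simp
    qed
  qed
qed

lemma bergman_space_cmult:
  assumes f: "f \<in> bergman_space D" shows "(\<lambda>z. c * f z) \<in> bergman_space D"
  using f unfolding bergman_space_iff
  by (auto intro!: holo_on_cmult simp: norm_mult power_mult_distrib)

lemma bergman_space_diff: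
  "f \<in> bergman_space D \<Longrightarrow> g \<in> bergman_space D \<Longrightarrow> (\<lambda>z. f z - g z) \<in> bergman_space D"
  using bergman_space_add[of f D "\<lambda>z. (-1) * g z"] bergman_space_cmult[of g D "-1"] by simp

lemma bergman_space_cong:
  assumes f: "f \<in> bergman_space D" and eq: "\<And>z. z \<in> D \<Longrightarrow> g z = f z"
  shows "g \<in> bergman_space D"
proof -
  have "set_integrable lborel D (\<lambda>z. (cmod (g z))\<^sup>2) \<longleftrightarrow> set_integrable lborel D (\<lambda>z. (cmod (f z))\<^sup>2)"
    by (rule set_integrable_cong) (auto simp: eq)
  then show ?thesis using f holo_on_cong[of f D g] eq by (simp add: bergman_space_iff)
qed

lemma inner_L2_self_eq_0:
  assumes f: "f \<in> bergman_space D" and 0: "inner_L2 D f f = 0" and z: "z \<in> D"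
  shows "f z = 0"
proof -
  have h: "holo_on f D" and i: "set_integrable lborel D (\<lambda>z. (cmod (f z))\<^sup>2)"
    using f by (auto simp: bergman_space_iff)
  have "inner_L2 D f f = (LINT z:D|lborel. complex_of_real ((cmod (f z))\<^sup>2))"
    unfolding inner_L2_def by (simp add: complex_norm_square[symmetric])
  also have "\<dots> = complex_of_real (LINT z:D|lborel. (cmod (f z))\<^sup>2)"
    unfolding set_lebesgue_integral_def by (subst integral_complex_of_real[symmetric]) (simp add: scaleR_conv_of_real)
  finally have "(LINT z:D|lborel. (cmod (f z))\<^sup>2) = 0" using 0 by simp
  then have "AE z in lborel. indicator D z *\<^sub>R (cmod (f z))\<^sup>2 = 0"
    unfolding set_lebesgue_integral_def using i unfolding set_integrable_def
    by (subst (asm) integral_nonneg_eq_0_iff_AE) auto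
  then have "AE z in lborel. z \<in> D \<longrightarrow> f z = 0"
    by eventually_elim (auto simp: indicator_def split: if_splits)
  then show ?thesis
    by (intro AE_eq_imp_eq_on[OF holo_on_open[OF h] holo_on_continuous_on[OF h] continuous_on_const _ z])
qed

text \<open>The function \<open>k\<close> represents evaluation at \<open>w\<close>, so it is the section
  \<open>\<lambda>z. K z w\<close> of the Bergman kernel. Speaking of one point \<open>w\<close>
  at a time makes it possible to prove existence pointwise.\<close>

definition reproduces :: "(complex^'n) set \<Rightarrow> complex^'n \<Rightarrow> (complex^'n \<Rightarrow> complex) \<Rightarrow> bool" where
  "reproduces D w k \<longleftrightarrow> k \<in> bergman_space D \<and>
     (\<forall>f\<in>bergman_space D. measure lborel (unit_ball :: (complex^'n) set) * f w = inner_L2 D f k)"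

lemma bergman_reproducing_iff:
  fixes K :: "complex^'n \<Rightarrow> complex^'n \<Rightarrow> complex"
  shows "bergman_reproducing D K \<longleftrightarrow> (\<forall>w\<in>D. reproduces D w (\<lambda>z. K z w))"
proof -
  have "f w = (LINT z:D|normalized_volume. f z * cnj (K z w)) \<longleftrightarrow>
      measure lborel (unit_ball :: (complex^'n) set) * f w = inner_L2 D f (\<lambda>z. K z w)"
    if "(\<lambda>z. K z w) \<in> bergman_space D" "f \<in> bergman_space D" for f :: "complex^'n \<Rightarrow> complex" and w
  proof -
    have v: "complex_of_real (measure lborel (unit_ball :: (complex^'n) set)) \<noteq> 0"
      using ball_volume_pos[where 'n='n] by simp
    show ?thesis
      unfolding integral_normalized_volume[OF bergman_space_product[OF that(2,1)]] inner_L2_def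
        nonzero_eq_divide_eq[OF v] by (simp only: mult.commute)
  qed
  then show ?thesis unfolding bergman_reproducing_def reproduces_def by blast
qed

lemma inner_L2_diff_right:
  assumes "f \<in> bergman_space D" "g \<in> bergman_space D" "h \<in> bergman_space D"
  shows "inner_L2 D f (\<lambda>z. g z - h z) = inner_L2 D f g - inner_L2 D f h"
  unfolding inner_L2_def
  using set_integral_diff(2)[OF bergman_space_product[OF assms(1,2)] bergman_space_product[OF assms(1,3)]]
  by (simp add: algebra_simps)

lemma inner_L2_cmult_right: "inner_L2 D f (\<lambda>z. c * g z) = cnj c * inner_L2 D f g"
proof -
  have "inner_L2 D f (\<lambda>z. c * g z) = (LINT z:D|lborel. cnj c * (f z * cnj (g z)))"
    unfolding inner_L2_def by (simp add: mult_ac)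
  then show ?thesis by (simp add: inner_L2_def)
qed

lemma inner_L2_commute: "inner_L2 D g f = cnj (inner_L2 D f g)"
proof -
  have "cnj (inner_L2 D f g) = (LINT z|lborel. cnj (indicator D z *\<^sub>R (f z * cnj (g z))))"
    unfolding inner_L2_def set_lebesgue_integral_def by (rule Bochner_Integration.integral_cnj[symmetric])
  also have "\<dots> = inner_L2 D g f"
    unfolding inner_L2_def set_lebesgue_integral_def by (rule Bochner_Integration.integral_cong) (auto simp: mult_ac)
  finally show ?thesis by simp
qed

lemma reproduces_unique:
  fixes w :: "complex^'n"
  assumes k: "reproduces D w k" and k': "reproduces D w k'" and z: "z \<in> D"
  shows "k z = k' z"
proof -
  let ?d = "\<lambda>z. k z - k' z"
  have A: "k \<in> bergman_space D" "k' \<in> bergman_space D" using k k' by (auto simp: reproduces_def)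
  have d: "?d \<in> bergman_space D" by (rule bergman_space_diff[OF A])
  have "inner_L2 D ?d k = inner_L2 D ?d k'"
    using k k' d unfolding reproduces_def by metis
  then have "inner_L2 D ?d ?d = 0" by (subst inner_L2_diff_right[OF d A]) simp
  from inner_L2_self_eq_0[OF d this z] show ?thesis by simp
qed

lemma bergman_kernel_reproduces:
  fixes D :: "(complex^'n) set"
  assumes ex: "\<And>w. w \<in> D \<Longrightarrow> \<exists>k. reproduces D w k" and w: "w \<in> D"
  shows "reproduces D w (\<lambda>z. bergman_kernel D z w)"
proof -
  obtain k where k: "\<And>w. w \<in> D \<Longrightarrow> reproduces D w (k w)" using ex by metis
  define K where "K z w = (if z \<in> D \<and> w \<in> D then k w z else 0)" for z w
  have K: "reproduces D w (\<lambda>z. K z w)" if w: "w \<in> D" for w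
  proof -
    have eq: "K z w = k w z" if "z \<in> D" for z using that w by (simp add: K_def)
    have "(\<lambda>z. K z w) \<in> bergman_space D"
      by (rule bergman_space_cong[of "k w"]) (use k[OF w] eq in \<open>auto simp: reproduces_def\<close>)
    moreover have "inner_L2 D f (\<lambda>z. K z w) = inner_L2 D f (k w)" for f
      unfolding inner_L2_def set_lebesgue_integral_def
      by (rule Bochner_Integration.integral_cong[OF refl]) (auto simp: eq indicator_def)
    ultimately show ?thesis using k[OF w] by (simp add: reproduces_def)
  qed
  have "bergman_kernel D = K"
    unfolding bergman_kernel_def
  proof (rule the_equality)
    show "bergman_reproducing D K \<and> (\<forall>z w. z \<notin> D \<or> w \<notin> D \<longrightarrow> K z w = 0)"
      using K by (auto simp: bergman_reproducing_iff K_def)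
    fix K' assume K': "bergman_reproducing D K' \<and> (\<forall>z w. z \<notin> D \<or> w \<notin> D \<longrightarrow> K' z w = 0)"
    have "K' z w = K z w" for z w
    proof (cases "z \<in> D \<and> w \<in> D")
      case True
      then show ?thesis
        using reproduces_unique[of D w "\<lambda>z. K' z w" "\<lambda>z. K z w" z] K' K by (auto simp: bergman_reproducing_iff)
    qed (use K' in \<open>auto simp: K_def\<close>)
    then show "K' = K" by blast
  qed
  then show ?thesis using K[OF w] by simp
qed

text \<open>Each of the two functions reproduces the other one.\<close>

lemma reproduces_hermitian:
  fixes w w' :: "complex^'n"
  assumes k: "reproduces D w k" and k': "reproduces D w' k'"
  shows "k w' = cnj (k' w)"
proof -
  let ?v = "measure lborel (unit_ball :: (complex^'n) set)"
  have "?v * k w' = inner_L2 D k k'" "?v * k' w = inner_L2 D k' k"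
    using k k' by (auto simp: reproduces_def)
  then have "?v * k w' = cnj (?v * k' w)" using inner_L2_commute[of D k k'] by simp
  then show ?thesis using ball_volume_pos[where 'n='n] by simp
qed

text \<open>The factor \<open>\<bar>J\<bar>\<^sup>2\<close> of the change of variables is split between the
  two arguments.\<close>

lemma inner_L2_image:
  fixes g :: "complex^'n \<Rightarrow> complex^'n"
  assumes g: "holo_map_on g U" and S: "S \<in> sets borel" "S \<subseteq> U" "g ` S \<in> sets borel" and inj: "inj_on g S"
    and f: "continuous_on (g ` S) f" and h: "continuous_on (g ` S) h"
  shows "inner_L2 (g ` S) f h =
      inner_L2 S (\<lambda>z. complex_jacobian g z * f (g z)) (\<lambda>z. complex_jacobian g z * h (g z))"
    and "set_integrable lborel (g ` S) (\<lambda>z. (cmod (f z))\<^sup>2) \<longleftrightarrow>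
      set_integrable lborel S (\<lambda>z. (cmod (complex_jacobian g z * f (g z)))\<^sup>2)"
proof -
  have "continuous_on (g ` S) (\<lambda>z. f z * cnj (h z))" "continuous_on (g ` S) (\<lambda>z. (cmod (f z))\<^sup>2)"
    by (intro continuous_intros f h)+
  then have m: "set_borel_measurable borel (g ` S) (\<lambda>z. f z * cnj (h z))"
    "set_borel_measurable borel (g ` S) (\<lambda>z. (cmod (f z))\<^sup>2)"
    using S by (auto intro: set_borel_measurable_continuous)
  have eq: "(cmod a)\<^sup>2 *\<^sub>R (b * cnj c) = (a * b) * cnj (a * c)" for a b c
  proof -
    have "(cmod a)\<^sup>2 *\<^sub>R (b * cnj c) = (a * cnj a) * (b * cnj c)"
      by (simp only: scaleR_conv_of_real complex_norm_square)
    then show ?thesis by (simp add: mult_ac)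
  qed
  have eq2: "(cmod a)\<^sup>2 *\<^sub>R (cmod b)\<^sup>2 = (cmod (a * b))\<^sup>2" for a b
    by (simp add: norm_mult power_mult_distrib)
  show "inner_L2 (g ` S) f h =
      inner_L2 S (\<lambda>z. complex_jacobian g z * f (g z)) (\<lambda>z. complex_jacobian g z * h (g z))"
    unfolding inner_L2_def
    using holo_map_image_integral(2)[OF g S inj m(1)] unfolding eq .
  show "set_integrable lborel (g ` S) (\<lambda>z. (cmod (f z))\<^sup>2) \<longleftrightarrow>
      set_integrable lborel S (\<lambda>z. (cmod (complex_jacobian g z * f (g z)))\<^sup>2)"
    using holo_map_image_integral(1)[OF g S inj m(2)] unfolding eq2 .
qed

lemma bergman_space_image:
  fixes g :: "complex^'n \<Rightarrow> complex^'n"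
  assumes g: "holo_map_on g U" "g ` U = V" "inj_on g U" "open V"
    and f: "f \<in> bergman_space V"
  shows "(\<lambda>z. complex_jacobian g z * f (g z)) \<in> bergman_space U"
    and "h \<in> bergman_space V \<Longrightarrow> inner_L2 U (\<lambda>z. complex_jacobian g z * f (g z)) (\<lambda>z. complex_jacobian g z * h (g z)) = inner_L2 V f h"
proof -
  have U: "U \<in> sets borel" "g ` U \<in> sets borel" using holo_map_on_open[OF g(1)] g by auto
  have c: "continuous_on (g ` U) f" if "f \<in> bergman_space V" for f
  proof -
    have "holo_on f V" using that by (simp add: bergman_space_iff)
    then show ?thesis unfolding g(2) by (rule holo_on_continuous_on)
  qed
  have hf: "holo_on f V" using f by (simp add: bergman_space_iff)
  have "holo_on (\<lambda>z. complex_jacobian g z * f (g z)) U"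
    by (rule holo_on_mult[OF holo_on_complex_jacobian[OF g(1)] holo_on_compose[OF hf g(1)]]) (simp add: g(2))
  moreover have "set_integrable lborel (g ` U) (\<lambda>z. (cmod (f z))\<^sup>2)" using f g by (simp add: bergman_space_iff)
  ultimately show "(\<lambda>z. complex_jacobian g z * f (g z)) \<in> bergman_space U"
    using inner_L2_image(2)[OF g(1) U(1) subset_refl U(2) g(3) c[OF f] c[OF f]] by (simp add: bergman_space_iff)
  assume h: "h \<in> bergman_space V"
  show "inner_L2 U (\<lambda>z. complex_jacobian g z * f (g z)) (\<lambda>z. complex_jacobian g z * h (g z)) = inner_L2 V f h"
    using inner_L2_image(1)[OF g(1) U(1) subset_refl U(2) g(3) c[OF f] c[OF h]] g(2) by simp
qed

section \<open>The Bergman kernel of the ball\<close>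

definition ball_kernel :: "complex^'n \<Rightarrow> complex^'n \<Rightarrow> complex" where
  "ball_kernel w z = 1 / (1 - hermitian_inner z w) ^ (CARD('n) + 1)"

lemma norm_hermitian_inner: "cmod (hermitian_inner z w) \<le> norm z * norm w"
proof -
  have "cmod (hermitian_inner z w) \<le> (\<Sum>i\<in>UNIV. \<bar>cmod (z $ i)\<bar> * \<bar>cmod (w $ i)\<bar>)"
    unfolding hermitian_inner_def by (rule order_trans[OF norm_sum]) (simp add: norm_mult)
  also have "\<dots> \<le> norm z * norm w" unfolding norm_vec_def by (rule L2_set_mult_ineq)
  finally show ?thesis .
qed

lemma hermitian_inner_self: "hermitian_inner z z = of_real ((norm z)\<^sup>2)"
  by (simp add: hermitian_inner_def norm_vec_def L2_set_def sum_nonneg complex_norm_square[symmetric])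

lemma hermitian_inner_neq_1:
  assumes "z \<in> unit_ball" "w \<in> unit_ball"
  shows "1 - hermitian_inner z w \<noteq> 0"
proof
  assume "1 - hermitian_inner z w = 0"
  then have "1 \<le> norm z * norm w" using norm_hermitian_inner[of z w] by (simp add: eq_iff_diff_eq_0[symmetric])
  also have "\<dots> < 1 * 1" using assms by (intro mult_strict_mono') auto
  finally show False by simp
qed

lemma norm_ball_kernel_le:
  assumes w: "w \<in> unit_ball" and z: "z \<in> unit_ball"
  shows "cmod (ball_kernel w (z::complex^'n)) \<le> 1 / (1 - norm w) ^ (CARD('n) + 1)"
proof -
  have "norm z * norm w \<le> 1 * norm w" using z by (intro mult_right_mono) auto
  then have "1 - norm w \<le> 1 - cmod (hermitian_inner z w)" using norm_hermitian_inner[of z w] by simp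
  also have "\<dots> \<le> cmod (1 - hermitian_inner z w)" using norm_triangle_ineq2[of 1 "hermitian_inner z w"] by simp
  finally have "(1 - norm w) ^ (CARD('n) + 1) \<le> cmod (1 - hermitian_inner z w) ^ (CARD('n) + 1)"
    using w by (intro power_mono) auto
  moreover have "0 < (1 - norm w) ^ (CARD('n) + 1)" using w by simp
  ultimately show ?thesis
    unfolding ball_kernel_def norm_divide norm_power norm_one by (intro frac_le) auto
qed

lemma holo_on_hermitian_inner: "open U \<Longrightarrow> holo_on (\<lambda>z. hermitian_inner z w) U"
  unfolding hermitian_inner_def by (intro holo_on_sum holo_on_mult holo_on_nth holo_on_const)

lemma holo_on_ball_kernel: "w \<in> unit_ball \<Longrightarrow> holo_on (ball_kernel (w::complex^'n)) unit_ball"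
  unfolding ball_kernel_def[abs_def]
  by (intro holo_on_divide holo_on_const holo_on_power holo_on_diff holo_on_hermitian_inner)
     (use hermitian_inner_neq_1 in auto)

lemma bounded_holo_bergman:
  assumes h: "holo_on h unit_ball" and b: "\<And>z. z \<in> unit_ball \<Longrightarrow> cmod (h z) \<le> B"
  shows "h \<in> bergman_space (unit_ball :: (complex^'n) set)"
  unfolding bergman_space_iff
proof
  show "set_integrable lborel unit_ball (\<lambda>z. (cmod (h z))\<^sup>2)"
  proof (rule set_integrable_bound)
    show "set_integrable lborel (unit_ball :: (complex^'n) set) (\<lambda>z. B\<^sup>2)"
      unfolding set_integrable_def using emeasure_lborel_ball_finite[of "0::complex^'n" 1]
      by (intro integrable_scaleR_left) auto
    have "continuous_on unit_ball (\<lambda>z. (cmod (h z))\<^sup>2)" using holo_on_continuous_on[OF h] by (intro continuous_intros)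
    then show "set_borel_measurable lborel unit_ball (\<lambda>z. (cmod (h z))\<^sup>2)"
      by (intro set_borel_measurable_lborel set_borel_measurable_continuous) auto
    show "AE z in lborel. z \<in> unit_ball \<longrightarrow> norm ((cmod (h z))\<^sup>2) \<le> norm (B\<^sup>2)"
      using b by (intro AE_I2) (auto intro: power_mono)
  qed
qed (rule h)

lemma ball_kernel_bergman: "w \<in> unit_ball \<Longrightarrow> ball_kernel w \<in> bergman_space unit_ball"
  by (rule bounded_holo_bergman[OF holo_on_ball_kernel norm_ball_kernel_le])

text \<open>At the centre the kernel is constant, and the claim is the mean value property.\<close>

lemma ball_kernel_reproduces_0: "reproduces unit_ball 0 (ball_kernel (0::complex^'n))"
proof -
  have k: "ball_kernel (0::complex^'n) z = 1" for z by (simp add: ball_kernel_def hermitian_inner_def)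
  show ?thesis
    unfolding reproduces_def
  proof (intro conjI ballI)
    show B: "ball_kernel 0 \<in> bergman_space (unit_ball :: (complex^'n) set)" by (rule ball_kernel_bergman) simp
    fix f :: "complex^'n \<Rightarrow> complex" assume f: "f \<in> bergman_space unit_ball"
    have "set_integrable lborel unit_ball f" using bergman_space_product[OF f B] by (simp add: k)
    then show "measure lborel (unit_ball :: (complex^'n) set) * f 0 = inner_L2 unit_ball f (ball_kernel 0)"
      using holo_mean_value[of f 1] f by (simp add: bergman_space_iff inner_L2_def k scaleR_conv_of_real)
  qed
qed

text \<open>The automorphism of the ball moving \<open>0\<close> to \<open>c\<close> on the
  \<open>i\<close>-th coordinate axis. Points are moved to the centre one coordinate at a time, so
  automorphisms for a general direction are avoided.\<close>

definition ball_moebius :: "'n \<Rightarrow> complex \<Rightarrow> complex^'n \<Rightarrow> complex^'n" where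
  "ball_moebius i c z = (\<chi> j. (if j = i then z $ i + c else sqrt (1 - (cmod c)\<^sup>2) * z $ j) / (1 + cnj c * z $ i))"

context
  fixes i :: "'n::finite" and c :: complex
  assumes c: "cmod c < 1"
begin

lemma moebius_scale: "sqrt (1 - (cmod c)\<^sup>2) > 0" "(complex_of_real (sqrt (1 - (cmod c)\<^sup>2)))\<^sup>2 = 1 - c * cnj c"
proof -
  have "(cmod c)\<^sup>2 < 1" using c by (simp add: power_less_one_iff abs_square_less_1)
  then show "sqrt (1 - (cmod c)\<^sup>2) > 0" by simp
  have "(complex_of_real (sqrt (1 - (cmod c)\<^sup>2)))\<^sup>2 = complex_of_real (1 - (cmod c)\<^sup>2)"
    using \<open>(cmod c)\<^sup>2 < 1\<close> by (simp flip: of_real_power)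
  also have "\<dots> = 1 - c * cnj c" by (simp add: complex_norm_square[symmetric])
  finally show "(complex_of_real (sqrt (1 - (cmod c)\<^sup>2)))\<^sup>2 = 1 - c * cnj c" .
qed

lemma moebius_denominator: "z \<in> unit_ball \<Longrightarrow> 1 + cnj c * (z::complex^'n) $ i \<noteq> 0"
proof
  assume z: "z \<in> unit_ball" and "1 + cnj c * z $ i = 0"
  then have "cmod (cnj c * z $ i) = 1" by (metis add_eq_0_iff norm_minus_cancel norm_one)
  then have "cmod c * cmod (z $ i) = 1" by (simp add: norm_mult)
  moreover have "cmod (z $ i) < 1" using z Finite_Cartesian_Product.norm_nth_le[of z i] by simp
  then have "cmod c * cmod (z $ i) < 1 * 1" using c by (intro mult_strict_mono') auto
  ultimately show False by simp
qed

lemma moebius_hermitian: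
  assumes z: "z \<in> unit_ball" and w: "w \<in> unit_ball"
  shows "1 - hermitian_inner (ball_moebius i c z) (ball_moebius i c w) =
    (1 - c * cnj c) * (1 - hermitian_inner z w) / ((1 + cnj c * z $ i) * (1 + c * cnj (w $ i)))"
proof -
  let ?s = "complex_of_real (sqrt (1 - (cmod c)\<^sup>2))"
  let ?a = "1 + cnj c * z $ i" and ?b = "1 + c * cnj (w $ i)"
  have b: "cnj (1 + cnj c * w $ i) = ?b" by simp
  have nz: "?a \<noteq> 0" "?b \<noteq> 0" using moebius_denominator[OF z] moebius_denominator[OF w] b by (simp, metis complex_cnj_zero_iff)
  define R where "R = (\<Sum>j\<in>UNIV - {i}. z $ j * cnj (w $ j))"
  have in1: "hermitian_inner z w = z $ i * cnj (w $ i) + R"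
    unfolding hermitian_inner_def R_def by (subst sum.remove[of _ i]) auto
  have "hermitian_inner (ball_moebius i c z) (ball_moebius i c w)
      = (z $ i + c) / ?a * cnj ((w $ i + c) / (1 + cnj c * w $ i))
        + (\<Sum>j\<in>UNIV - {i}. (?s * z $ j / ?a) * cnj (?s * w $ j / (1 + cnj c * w $ i)))"
    unfolding hermitian_inner_def by (subst sum.remove[of _ i]) (auto simp: ball_moebius_def intro!: sum.cong)
  also have "(\<Sum>j\<in>UNIV - {i}. (?s * z $ j / ?a) * cnj (?s * w $ j / (1 + cnj c * w $ i)))
      = ?s\<^sup>2 / (?a * ?b) * R"
    unfolding R_def sum_distrib_left by (rule sum.cong) (auto simp: power2_eq_square)
  also have "(z $ i + c) / ?a * cnj ((w $ i + c) / (1 + cnj c * w $ i)) = (z $ i + c) * (cnj (w $ i) + cnj c) / (?a * ?b)"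
    by simp
  finally have H: "hermitian_inner (ball_moebius i c z) (ball_moebius i c w)
      = (z $ i + c) * (cnj (w $ i) + cnj c) / (?a * ?b) + (1 - c * cnj c) / (?a * ?b) * R"
    unfolding moebius_scale(2) .
  have frac: "1 - (x / d + y / d * r) = (d - x - y * r) / d" if "d \<noteq> 0" for x y d r :: complex
    using that by (simp add: field_simps)
  have "1 - hermitian_inner (ball_moebius i c z) (ball_moebius i c w)
      = (?a * ?b - (z $ i + c) * (cnj (w $ i) + cnj c) - (1 - c * cnj c) * R) / (?a * ?b)"
    unfolding H by (rule frac) (use nz in simp)
  also have "?a * ?b - (z $ i + c) * (cnj (w $ i) + cnj c) - (1 - c * cnj c) * R = (1 - c * cnj c) * (1 - hermitian_inner z w)"
    unfolding in1 by (simp add: algebra_simps)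
  finally show ?thesis .
qed

lemma moebius_ball:
  assumes z: "z \<in> unit_ball" shows "ball_moebius i c z \<in> unit_ball"
proof -
  have cc: "1 - c * cnj c = of_real (1 - (cmod c)\<^sup>2)" by (simp add: complex_norm_square[symmetric])
  have "(1 + cnj c * z $ i) * (1 + c * cnj (z $ i)) = of_real ((cmod (1 + cnj c * z $ i))\<^sup>2)"
    unfolding complex_norm_square by simp
  then have "complex_of_real (1 - (norm (ball_moebius i c z))\<^sup>2)
      = of_real ((1 - (cmod c)\<^sup>2) * (1 - (norm z)\<^sup>2) / (cmod (1 + cnj c * z $ i))\<^sup>2)"
    using moebius_hermitian[OF z z] by (simp add: hermitian_inner_self cc)
  then have "1 - (norm (ball_moebius i c z))\<^sup>2 = (1 - (cmod c)\<^sup>2) * (1 - (norm z)\<^sup>2) / (cmod (1 + cnj c * z $ i))\<^sup>2"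
    by (simp only: of_real_eq_iff)
  also have "\<dots> > 0"
    using z c moebius_denominator[OF z] by (intro divide_pos_pos mult_pos_pos) (auto simp: abs_square_less_1)
  finally show ?thesis by (simp add: abs_square_less_1)
qed

lemma holo_moebius: "holo_map_on (ball_moebius i c) unit_ball"
proof -
  have "holo_on (\<lambda>z. ball_moebius i c z $ j) unit_ball" for j
  proof -
    have den: "holo_on (\<lambda>z. 1 + cnj c * z $ i) unit_ball"
      by (intro holo_on_add holo_on_const holo_on_cmult holo_on_nth) auto
    have "holo_on (\<lambda>z. if j = i then z $ i + c else sqrt (1 - (cmod c)\<^sup>2) * z $ j) unit_ball"
      by (cases "j = i") (auto intro!: holo_on_add holo_on_const holo_on_cmult holo_on_nth)
    from holo_on_divide[OF this den moebius_denominator] show ?thesis by (simp add: ball_moebius_def)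
  qed
  then show ?thesis by (simp add: holo_map_on_def)
qed

end

lemma moebius_inverse:
  assumes c: "cmod c < 1" and z: "z \<in> unit_ball"
  shows "ball_moebius i (- c) (ball_moebius i c z) = z"
proof -
  let ?s = "complex_of_real (sqrt (1 - (cmod c)\<^sup>2))" and ?a = "1 + cnj c * z $ i"
  have a: "?a \<noteq> 0" by (rule moebius_denominator[OF c z])
  have s: "?s\<^sup>2 = 1 - c * cnj c" "?s \<noteq> 0" using moebius_scale[OF c] by auto
  have n: "1 - c * cnj c \<noteq> 0" using s by (metis power_not_zero)
  have d: "1 + cnj (- c) * ((z $ i + c) / ?a) = (1 - c * cnj c) / ?a"
    using a by (simp add: field_simps)
  have "ball_moebius i (- c) (ball_moebius i c z) $ j = z $ j" for j
  proof (cases "j = i")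
    case True
    have "(z $ i + c) / ?a - c = z $ i * (1 - c * cnj c) / ?a" using a by (simp add: field_simps)
    then show ?thesis using True a n by (simp add: ball_moebius_def d[simplified])
  next
    case False
    have "ball_moebius i (- c) (ball_moebius i c z) $ j = ?s * (?s * z $ j / ?a) / ((1 - c * cnj c) / ?a)"
      using False by (simp add: ball_moebius_def d[simplified])
    also have "\<dots> = ?s\<^sup>2 * z $ j / (1 - c * cnj c)" using a by (simp add: power2_eq_square)
    also have "\<dots> = z $ j" using n unfolding s(1) by simp
    finally show ?thesis .
  qed
  then show ?thesis by (simp add: vec_eq_iff)
qed

text \<open>If all nonzero entries lie on the diagonal or in column \<open>i\<close>, every permutation
  other than the identity picks a zero.\<close>

lemma det_arrow:
  fixes M :: "complex^'n^'n"
  assumes M: "\<And>j l. l \<noteq> j \<Longrightarrow> l \<noteq> i \<Longrightarrow> M $ j $ l = 0"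
  shows "det M = (\<Prod>j\<in>UNIV. M $ j $ j)"
proof -
  have z: "(\<Prod>j\<in>UNIV. M $ j $ p j) = 0" if p: "p permutes UNIV" "p \<noteq> id" for p
  proof -
    \<comment> \<open>Only one \<open>j\<close> has \<open>p j = i\<close>, and no permutation moves
      exactly one point.\<close>
    have "\<exists>j. p j \<noteq> j \<and> p j \<noteq> i"
    proof (rule ccontr)
      assume no: "\<nexists>j. p j \<noteq> j \<and> p j \<noteq> i"
      obtain j where j: "p j \<noteq> j" using p(2) by (auto simp: fun_eq_iff)
      then have pj: "p j = i" using no by blast
      then have "i \<noteq> j" using j by simp
      have "p i = i \<or> p i = i" using no by blast
      then have "p i = p j" using pj by simp
      then show False using \<open>i \<noteq> j\<close> permutes_inj[OF p(1)] by (auto dest: injD)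
    qed
    then show ?thesis using M by (intro prod_zero) auto
  qed
  have "det M = (\<Sum>p\<in>{id}. of_int (sign p) * (\<Prod>j\<in>UNIV. M $ j $ p j))"
    unfolding det_def
    by (rule sum.mono_neutral_right) (auto simp: z permutes_id finite_permutations)
  then show ?thesis by (simp add: sign_id)
qed

lemma moebius_jacobian:
  assumes c: "cmod c < 1" and z: "z \<in> unit_ball"
  shows "complex_jacobian (ball_moebius i c) (z::complex^'n) =
    (of_real (sqrt (1 - (cmod c)\<^sup>2)) / (1 + cnj c * z $ i)) ^ (CARD('n) + 1)"
proof -
  let ?s = "complex_of_real (sqrt (1 - (cmod c)\<^sup>2))" and ?a = "1 + cnj c * z $ i"
  have a: "?a \<noteq> 0" by (rule moebius_denominator[OF c z])
  define M :: "complex^'n^'n" where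
    "M = (\<chi> j l. if j = i then (if l = i then ?s\<^sup>2 / ?a\<^sup>2 else 0)
            else (if l = j then ?s / ?a else if l = i then - ?s * z $ j * cnj c / ?a\<^sup>2 else 0))"
  have "(ball_moebius i c has_derivative (*v) M) (at z)"
  proof (rule has_derivative_cvecI)
    fix j
    have nth: "((\<lambda>z. (z::complex^'n) $ l) has_derivative (\<lambda>h. h $ l)) (at z)" for l
      by (intro bounded_linear_imp_has_derivative bounded_linear_vec_nth)
    have den: "((\<lambda>z. 1 + cnj c * z $ i) has_derivative (\<lambda>h. cnj c * h $ i)) (at z)"
      by (auto intro!: derivative_eq_intros nth)
    show "((\<lambda>z. ball_moebius i c z $ j) has_derivative (\<lambda>h. (M *v h) $ j)) (at z)"
    proof (cases "j = i")
      case True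
      have num: "((\<lambda>z. z $ i + c) has_derivative (\<lambda>h. h $ i)) (at z)"
        by (auto intro!: derivative_eq_intros nth)
      have eq: "(M *v h) $ j = - (z $ i + c) * (inverse ?a * (cnj c * h $ i) * inverse ?a) + h $ i / ?a" for h
      proof -
        have "(M *v h) $ j = (\<Sum>l\<in>UNIV. if l = i then ?s\<^sup>2 / ?a\<^sup>2 * h $ i else 0)"
          unfolding matrix_vector_mult_def vec_lambda_beta using True by (intro sum.cong) (auto simp: M_def)
        also have "\<dots> = (1 - c * cnj c) / ?a\<^sup>2 * h $ i" by (simp add: moebius_scale(2)[OF c])
        also have "\<dots> = - (z $ i + c) * (inverse ?a * (cnj c * h $ i) * inverse ?a) + h $ i / ?a"
          using a by (simp add: divide_simps power2_eq_square) (simp add: algebra_simps)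
        finally show ?thesis .
      qed
      show ?thesis
        using has_derivative_divide[OF num den a] True unfolding eq by (simp add: ball_moebius_def)
    next
      case False
      have num: "((\<lambda>z. ?s * z $ j) has_derivative (\<lambda>h. ?s * h $ j)) (at z)"
        by (auto intro!: derivative_eq_intros nth)
      have eq: "(M *v h) $ j = - (?s * z $ j) * (inverse ?a * (cnj c * h $ i) * inverse ?a) + ?s * h $ j / ?a" for h
      proof -
        have "(M *v h) $ j = (\<Sum>l\<in>UNIV. (if l = i then - ?s * z $ j * cnj c / ?a\<^sup>2 * h $ i else 0) + (if l = j then ?s / ?a * h $ j else 0))"
          unfolding matrix_vector_mult_def vec_lambda_beta using False by (intro sum.cong) (auto simp: M_def)
        also have "\<dots> = - ?s * z $ j * cnj c / ?a\<^sup>2 * h $ i + ?s / ?a * h $ j" by (simp add: sum.distrib)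
        also have "\<dots> = - (?s * z $ j) * (inverse ?a * (cnj c * h $ i) * inverse ?a) + ?s * h $ j / ?a"
          by (simp add: divide_inverse power2_eq_square mult_ac)
        finally show ?thesis .
      qed
      show ?thesis
        using has_derivative_divide[OF num den a] False unfolding eq by (simp add: ball_moebius_def)
    qed
  qed
  then have "complex_jacobian (ball_moebius i c) z = det M" by (rule complex_jacobian_eq)
  also have "\<dots> = (\<Prod>j\<in>UNIV. M $ j $ j)" by (rule det_arrow[of i]) (auto simp: M_def)
  also have "\<dots> = M $ i $ i * (\<Prod>j\<in>UNIV - {i}. M $ j $ j)" by (rule prod.remove) auto
  also have "(\<Prod>j\<in>UNIV - {i}. M $ j $ j) = (\<Prod>j\<in>UNIV - {i}. ?s / ?a)"
    by (rule prod.cong) (auto simp: M_def)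
  also have "\<dots> = (?s / ?a) ^ (CARD('n) - 1)" by (simp add: card_Diff_singleton)
  also have "M $ i $ i = (?s / ?a)\<^sup>2" by (simp add: M_def power_divide)
  also have "(?s / ?a)\<^sup>2 * (?s / ?a) ^ (CARD('n) - 1) = (?s / ?a) ^ (2 + (CARD('n) - 1))"
    by (rule power_add[symmetric])
  also have "2 + (CARD('n) - 1) = CARD('n) + 1"
    using zero_less_card_finite[where 'a='n] by linarith
  finally show ?thesis .
qed

text \<open>The kernel obeys \<open>J(z) cnj (J w) k(\<phi> z, \<phi> w) = k(z, w)\<close> for the map
  \<open>\<phi>\<close>, and \<open>f \<mapsto> J \<cdot> (f \<circ> \<phi>)\<close> is unitary;
  so the reproducing property travels from \<open>w\<close> to \<open>\<phi> w\<close>.\<close>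

lemma ball_kernel_reproduces_moebius:
  assumes c: "cmod c < 1" and w: "w \<in> unit_ball" and rep: "reproduces unit_ball w (ball_kernel w)"
  shows "reproduces unit_ball (ball_moebius i c w) (ball_kernel (ball_moebius i c (w::complex^'n)))"
proof -
  let ?\<phi> = "ball_moebius i c" and ?J = "complex_jacobian (ball_moebius i c)"
  have cm: "cmod (- c) < 1" using c by simp
  have \<phi>w: "?\<phi> w \<in> unit_ball" by (rule moebius_ball[OF c w])
  have surj: "?\<phi> ` unit_ball = unit_ball"
  proof
    show "?\<phi> ` unit_ball \<subseteq> unit_ball" using moebius_ball[OF c] by blast
    show "unit_ball \<subseteq> ?\<phi> ` unit_ball"
    proof
      fix z :: "complex^'n" assume z: "z \<in> unit_ball"
      have "z = ?\<phi> (ball_moebius i (- c) z)" using moebius_inverse[OF cm z, of i] by simp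
      then show "z \<in> ?\<phi> ` unit_ball" using moebius_ball[OF cm z] by blast
    qed
  qed
  have inj: "inj_on ?\<phi> unit_ball" by (rule inj_on_inverseI[where g="ball_moebius i (- c)"]) (rule moebius_inverse[OF c])
  have kk: "?J z * cnj (?J w) * ball_kernel (?\<phi> w) (?\<phi> z) = ball_kernel w z" if z: "z \<in> unit_ball" for z
  proof -
    let ?s = "complex_of_real (sqrt (1 - (cmod c)\<^sup>2))"
    let ?a = "1 + cnj c * z $ i" and ?b = "1 + c * cnj (w $ i)"
    have a: "?a \<noteq> 0" by (rule moebius_denominator[OF c z])
    have cb: "cnj (1 + cnj c * w $ i) = ?b" by simp
    have b: "?b \<noteq> 0" using moebius_denominator[OF c w, of i] cb by (metis complex_cnj_zero_iff)
    have s: "?s\<^sup>2 = 1 - c * cnj c" "?s \<noteq> 0" using moebius_scale[OF c] by auto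
    have n: "1 - c * cnj c \<noteq> 0" using s by (metis power_not_zero)
    have "?J z * cnj (?J w) = (?s / ?a * (?s / ?b)) ^ (CARD('n) + 1)"
      unfolding moebius_jacobian[OF c z] moebius_jacobian[OF c w] complex_cnj_power complex_cnj_divide cb
        complex_cnj_complex_of_real power_mult_distrib ..
    also have "?s / ?a * (?s / ?b) = (1 - c * cnj c) / (?a * ?b)"
      unfolding s(1)[symmetric] by (simp add: power2_eq_square)
    finally have "?J z * cnj (?J w) * ball_kernel (?\<phi> w) (?\<phi> z)
        = ((1 - c * cnj c) / (?a * ?b) / ((1 - c * cnj c) * (1 - hermitian_inner z w) / (?a * ?b))) ^ (CARD('n) + 1)"
      unfolding ball_kernel_def moebius_hermitian[OF c z w] by (simp add: power_divide)
    also have "(1 - c * cnj c) / (?a * ?b) / ((1 - c * cnj c) * (1 - hermitian_inner z w) / (?a * ?b)) = 1 / (1 - hermitian_inner z w)"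
      using a b n by simp
    finally show ?thesis by (simp add: ball_kernel_def power_one_over)
  qed
  have Jw: "?J w \<noteq> 0"
  proof
    assume "?J w = 0"
    then have "ball_kernel w w = 0" using kk[OF w] by simp
    then show False using hermitian_inner_neq_1[OF w w] by (simp add: ball_kernel_def)
  qed
  show ?thesis
    unfolding reproduces_def
  proof (intro conjI ballI)
    show K: "ball_kernel (?\<phi> w) \<in> bergman_space unit_ball" by (rule ball_kernel_bergman[OF \<phi>w])
    fix f :: "complex^'n \<Rightarrow> complex" assume f: "f \<in> bergman_space unit_ball"
    let ?f = "\<lambda>z. ?J z * f (?\<phi> z)"
    have rep': "\<forall>f\<in>bergman_space unit_ball. measure lborel (unit_ball :: (complex^'n) set) * f w = inner_L2 unit_ball f (ball_kernel w)"
      using rep unfolding reproduces_def by (rule conjunct2)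
    have f': "?f \<in> bergman_space unit_ball"
      by (rule bergman_space_image(1)[OF holo_moebius[OF c] surj inj open_ball f])
    have "measure lborel (unit_ball :: (complex^'n) set) * ?f w = inner_L2 unit_ball ?f (ball_kernel w)"
      by (rule bspec[OF rep' f'])
    also have "\<dots> = inner_L2 unit_ball ?f (\<lambda>z. cnj (?J w) * (?J z * ball_kernel (?\<phi> w) (?\<phi> z)))"
      unfolding inner_L2_def
      by (rule set_lebesgue_integral_cong) (auto simp: kk[symmetric] mult_ac)
    also have "\<dots> = ?J w * inner_L2 unit_ball ?f (\<lambda>z. ?J z * ball_kernel (?\<phi> w) (?\<phi> z))"
      by (subst inner_L2_cmult_right) simp
    also have "inner_L2 unit_ball ?f (\<lambda>z. ?J z * ball_kernel (?\<phi> w) (?\<phi> z)) = inner_L2 unit_ball f (ball_kernel (?\<phi> w))"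
      by (rule bergman_space_image(2)[OF holo_moebius[OF c] surj inj open_ball f K])
    finally show "measure lborel (unit_ball :: (complex^'n) set) * f (?\<phi> w) = inner_L2 unit_ball f (ball_kernel (?\<phi> w))"
      using Jw by (simp add: mult_ac)
  qed
qed

text \<open>Induction on the set of possibly nonzero coordinates of \<open>w\<close>: the automorphism
  \<open>ball_moebius i (- w $ i)\<close> makes the \<open>i\<close>-th one vanish and only
  rescales the others.\<close>

lemma ball_kernel_reproduces:
  assumes "(w::complex^'n) \<in> unit_ball"
  shows "reproduces unit_ball w (ball_kernel w)"
proof -
  have "reproduces unit_ball w (ball_kernel w)"
    if "finite S" "w \<in> unit_ball" "\<And>j. j \<notin> S \<Longrightarrow> w $ j = 0" for S and w :: "complex^'n"
    using that
  proof (induction S arbitrary: w rule: finite_induct)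
    case empty
    then have "w = 0" by (simp add: vec_eq_iff)
    then show ?case using ball_kernel_reproduces_0 by simp
  next
    case (insert i S)
    define c where "c = w $ i"
    have c: "cmod c < 1" using insert.prems(1) Finite_Cartesian_Product.norm_nth_le[of w i] by (simp add: c_def)
    let ?s = "complex_of_real (sqrt (1 - (cmod c)\<^sup>2))"
    have s: "sqrt (1 - (cmod c)\<^sup>2) > 0" by (rule moebius_scale(1)[OF c])
    define u where "u = ball_moebius i (- c) w"
    have cm: "cmod (- c) < 1" using c by simp
    have u: "u \<in> unit_ball" unfolding u_def by (rule moebius_ball[OF cm insert.prems(1)])
    have "u $ j = 0" if "j \<notin> S" for j
      using insert.prems(2)[of j] that by (cases "j = i") (auto simp: u_def ball_moebius_def c_def)
    then have "reproduces unit_ball u (ball_kernel u)" by (rule insert.IH[OF u])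
    from ball_kernel_reproduces_moebius[OF c u this, of i]
    have rep: "reproduces unit_ball (ball_moebius i c u) (ball_kernel (ball_moebius i c u))" .
    have eq: "ball_moebius i c u = w"
      using moebius_inverse[OF cm insert.prems(1), of i] unfolding u_def by (simp only: minus_minus)
    show ?case using rep unfolding eq .
  qed
  note support_induct = this
  show ?thesis by (rule support_induct[OF finite_class.finite_UNIV assms]) simp
qed

section \<open>Branched coverings with a deck group\<close>

text \<open>A homeomorphism onto an open set has a Borel measurable inverse; the indicator extends the
  inverse to the whole space.\<close>

lemma borel_injective_image:
  fixes f :: "'a::euclidean_space \<Rightarrow> 'a"
  assumes f: "continuous_on U f" "open U" "inj_on f U" and S: "S \<in> sets borel" "S \<subseteq> U"
  shows "f ` S \<in> sets borel"
proof -
  let ?g = "inv_into U f"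
  have op: "open (f ` U)" by (rule invariance_of_domain[OF f])
  have cont: "continuous_on (f ` U) ?g" by (rule continuous_on_inverse_open[OF f(2,1)]) (use f(3) in auto)
  have "(\<lambda>y. indicator (f ` U) y *\<^sub>R ?g y) \<in> borel_measurable borel"
    by (rule borel_measurable_continuous_on_indicator[OF _ cont]) (use op in auto)
  from measurable_sets[OF this S(1)]
  have m: "(\<lambda>y. indicator (f ` U) y *\<^sub>R ?g y) -` S \<in> sets borel" by simp
  have "f ` S = f ` U \<inter> (\<lambda>y. indicator (f ` U) y *\<^sub>R ?g y) -` S"
    using S(2) f(3) by (auto simp: indicator_def subset_iff)
  then show ?thesis using m op by auto
qed

lemma inner_L2_null_part:
  fixes D D' :: "(complex^'n) set"
  assumes D: "D \<in> sets borel" "D' \<in> sets borel" "D' \<subseteq> D" "D - D' \<in> null_sets lborel"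
    and f: "continuous_on D f" and h: "continuous_on D h"
  shows "inner_L2 D' f h = inner_L2 D f h"
    and "set_integrable lborel D' (\<lambda>z. (cmod (f z))\<^sup>2) \<longleftrightarrow> set_integrable lborel D (\<lambda>z. (cmod (f z))\<^sup>2)"
proof -
  have ae: "AE z in lborel. z \<in> D \<longleftrightarrow> z \<in> D'" using AE_not_in[OF D(4)] by eventually_elim (use D(3) in auto)
  have c1: "continuous_on D (\<lambda>z. f z * cnj (h z))" by (intro continuous_intros f h)
  have c2: "continuous_on D (\<lambda>z. (cmod (f z))\<^sup>2)" by (intro continuous_intros f)
  have m: "set_borel_measurable lborel E (\<lambda>z. f z * cnj (h z))" if "E \<in> sets borel" "E \<subseteq> D" for E
    by (intro set_borel_measurable_lborel set_borel_measurable_continuous that continuous_on_subset[OF c1])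
  have m2: "set_borel_measurable lborel E (\<lambda>z. (cmod (f z))\<^sup>2)" if "E \<in> sets borel" "E \<subseteq> D" for E
    by (intro set_borel_measurable_lborel set_borel_measurable_continuous that continuous_on_subset[OF c2])
  show "inner_L2 D' f h = inner_L2 D f h"
    unfolding inner_L2_def by (rule set_integral_cong_set[OF m m ae]) (use D in auto)
  show "set_integrable lborel D' (\<lambda>z. (cmod (f z))\<^sup>2) \<longleftrightarrow> set_integrable lborel D (\<lambda>z. (cmod (f z))\<^sup>2)"
    unfolding set_integrable_def
  proof (rule integrable_cong_AE)
    show "(\<lambda>x. indicator D' x *\<^sub>R (cmod (f x))\<^sup>2) \<in> borel_measurable lborel"
      using m2[OF D(2,3)] by (simp add: set_borel_measurable_def)
    show "(\<lambda>x. indicator D x *\<^sub>R (cmod (f x))\<^sup>2) \<in> borel_measurable lborel"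
      using m2[OF D(1)] by (simp add: set_borel_measurable_def)
    show "AE x in lborel. indicator D' x *\<^sub>R (cmod (f x))\<^sup>2 = indicator D x *\<^sub>R (cmod (f x))\<^sup>2"
      using ae by eventually_elim (auto simp: indicator_def)
  qed
qed

text \<open>The map \<open>F\<close> is a branched covering whose fibres are the orbits of the automorphisms
  \<open>g s\<close>, acting freely where the Jacobian of \<open>F\<close> does not vanish. The
  family is closed under composition in the form that right translation by an element permutes the
  index set. The function \<open>\<Delta>\<close> on \<open>\<Omega>\<close> vanishes at all
  critical values, which are thereby contained in a thin analytic set; it plays the role of a
  discriminant.\<close>

locale deck_group =
  fixes F :: "complex^'n \<Rightarrow> complex^'n" and \<Omega> :: "(complex^'n) set"
    and I :: "'s set" and g :: "'s \<Rightarrow> complex^'n \<Rightarrow> complex^'n" and \<Delta> :: "complex^'n \<Rightarrow> complex"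
  assumes F: "holo_map_on F unit_ball" "F ` unit_ball = \<Omega>" and \<Omega>: "open \<Omega>"
    and finite_I: "finite I"
    and g_holo: "\<And>s. s \<in> I \<Longrightarrow> holo_map_on (g s) unit_ball"
    and g_bij: "\<And>s. s \<in> I \<Longrightarrow> bij_betw (g s) unit_ball unit_ball"
    and F_g: "\<And>s z. s \<in> I \<Longrightarrow> z \<in> unit_ball \<Longrightarrow> F (g s z) = F z"
    and fibre: "\<And>z w. z \<in> unit_ball \<Longrightarrow> w \<in> unit_ball \<Longrightarrow> F z = F w \<Longrightarrow> \<exists>s\<in>I. w = g s z"
    and free: "\<And>s t z. s \<in> I \<Longrightarrow> t \<in> I \<Longrightarrow> z \<in> unit_ball \<Longrightarrow> complex_jacobian F z \<noteq> 0 \<Longrightarrow> g s z = g t z \<Longrightarrow> s = t"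
    and right_mult: "\<And>t. t \<in> I \<Longrightarrow> \<exists>\<pi>. bij_betw \<pi> I I \<and> (\<forall>s\<in>I. \<forall>z\<in>unit_ball. g s (g t z) = g (\<pi> s) z)"
    and \<Delta>: "holo_on \<Delta> \<Omega>" "generically_nonzero (\<lambda>z. \<Delta> (F z)) unit_ball"
    and crit: "\<And>z. z \<in> unit_ball \<Longrightarrow> complex_jacobian F z = 0 \<Longrightarrow> \<Delta> (F z) = 0"
begin

abbreviation "J \<equiv> complex_jacobian F"
abbreviation "Jg s \<equiv> complex_jacobian (g s)"

lemma g_ball: "s \<in> I \<Longrightarrow> z \<in> unit_ball \<Longrightarrow> g s z \<in> unit_ball"
  using g_bij bij_betwE by blast

lemma F_in: "z \<in> unit_ball \<Longrightarrow> F z \<in> \<Omega>"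
  using F(2) by blast

lemma holo_J: "holo_on J unit_ball"
  by (rule holo_on_complex_jacobian[OF F(1)])

lemma generically_nonzero_J: "generically_nonzero J unit_ball"
  using \<Delta>(2) crit unfolding generically_nonzero_def by (meson subsetD)

text \<open>Differentiate \<open>F \<circ> g s = F\<close>.\<close>

lemma J_g: assumes s: "s \<in> I" and z: "z \<in> unit_ball" shows "J (g s z) * Jg s z = J z"
proof -
  have "complex_jacobian (\<lambda>w. F (g s w)) z = J (g s z) * Jg s z"
    by (rule complex_jacobian_compose[OF F(1) g_ball[OF s z] g_holo[OF s] z])
  moreover have "complex_jacobian (\<lambda>w. F (g s w)) z = J z"
    by (rule complex_jacobian_cong[OF F(1) z]) (rule F_g[OF s])
  ultimately show ?thesis by simp
qed

text \<open>The sum over the group of the unitary operators \<open>h \<mapsto> J\<^sub>g\<^sub>s \<cdot> (h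
  \<circ> g s)\<close>: up to a factor, the projection of the Bergman space onto the functions
  that transform like \<open>J\<close>. Applied to the kernel of the ball it is the sum in the
  kernel formula.\<close>

definition T :: "(complex^'n \<Rightarrow> complex) \<Rightarrow> complex^'n \<Rightarrow> complex" where
  "T h z = (\<Sum>s\<in>I. Jg s z * h (g s z))"

lemma T_g:
  assumes t: "t \<in> I" and z: "z \<in> unit_ball"
  shows "Jg t z * T h (g t z) = T h z"
proof -
  obtain \<pi> where \<pi>: "bij_betw \<pi> I I" "\<And>s z. s \<in> I \<Longrightarrow> z \<in> unit_ball \<Longrightarrow> g s (g t z) = g (\<pi> s) z"
    using right_mult[OF t] by auto
  have "Jg s (g t z) * Jg t z = Jg (\<pi> s) z" if s: "s \<in> I" for s
  proof -
    have \<pi>s: "\<pi> s \<in> I" using \<pi>(1) s by (rule bij_betw_apply)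
    have "complex_jacobian (\<lambda>w. g s (g t w)) z = Jg s (g t z) * Jg t z"
      by (rule complex_jacobian_compose[OF g_holo[OF s] g_ball[OF t z] g_holo[OF t] z])
    moreover have "complex_jacobian (\<lambda>w. g s (g t w)) z = Jg (\<pi> s) z"
      by (rule complex_jacobian_cong[OF g_holo[OF \<pi>s] z]) (rule \<pi>(2)[OF s])
    ultimately show ?thesis by simp
  qed
  then have "Jg t z * T h (g t z) = (\<Sum>s\<in>I. Jg (\<pi> s) z * h (g (\<pi> s) z))"
    unfolding T_def sum_distrib_left by (intro sum.cong) (auto simp: \<pi>(2)[OF _ z] mult_ac)
  also have "\<dots> = T h z" unfolding T_def by (rule sum.reindex_bij_betw[OF \<pi>(1)])
  finally show ?thesis .
qed

text \<open>Regularity is decided by \<open>\<Delta>\<close> rather than by \<open>J\<close>, so that the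
  image of the regular set is the complement in \<open>\<Omega>\<close> of the zeros of a
  holomorphic function.\<close>

definition regular :: "(complex^'n) set" where "regular = {z \<in> unit_ball. \<Delta> (F z) \<noteq> 0}"

lemma holo_\<Delta>F: "holo_on (\<lambda>z. \<Delta> (F z)) unit_ball"
  by (rule holo_on_compose[OF \<Delta>(1) F(1)]) (use F(2) in auto)

lemma regular_open: "open regular"
  unfolding regular_def by (rule zero_set_borel(2)[OF holo_\<Delta>F])

lemma regular_sub: "regular \<subseteq> unit_ball" by (auto simp: regular_def)

lemma regular_J: "z \<in> regular \<Longrightarrow> J z \<noteq> 0" using crit by (auto simp: regular_def)

lemma regular_g: "s \<in> I \<Longrightarrow> z \<in> unit_ball \<Longrightarrow> g s z \<in> regular \<longleftrightarrow> z \<in> regular"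
  using g_ball F_g by (auto simp: regular_def)

lemma regular_null: "unit_ball - regular \<in> null_sets lborel"
proof -
  have "unit_ball - regular = {z \<in> unit_ball. \<Delta> (F z) = 0}" by (auto simp: regular_def)
  then show ?thesis using zero_set_null[OF holo_\<Delta>F \<Delta>(2)] by simp
qed

lemma gen_\<Delta>: "generically_nonzero \<Delta> \<Omega>"
  unfolding generically_nonzero_def
proof (intro allI impI, elim conjE)
  fix W assume W: "open W" "W \<noteq> {}" "W \<subseteq> \<Omega>"
  then obtain x where x: "x \<in> W" by blast
  have "open (unit_ball \<inter> F -` W)"
    by (rule continuous_open_preimage[OF holo_map_on_continuous_on[OF F(1)] open_ball W(1)])
  note op = this
  obtain z where "z \<in> unit_ball" "x = F z" using W(3) x F(2) by blast
  then have "z \<in> unit_ball \<inter> F -` W" using x by simp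
  from generically_nonzeroD[OF \<Delta>(2) op this inf_le1]
  show "\<exists>z\<in>W. \<Delta> z \<noteq> 0" by blast
qed

lemma \<Omega>_null: "\<Omega> - F ` regular \<in> null_sets lborel" and F_regular: "F ` regular = {z \<in> \<Omega>. \<Delta> z \<noteq> 0}"
proof -
  show e: "F ` regular = {z \<in> \<Omega>. \<Delta> z \<noteq> 0}" using F(2) by (auto simp: regular_def)
  have "\<Omega> - F ` regular = {z \<in> \<Omega>. \<Delta> z = 0}" unfolding e by auto
  then show "\<Omega> - F ` regular \<in> null_sets lborel" using zero_set_null[OF \<Delta>(1) gen_\<Delta>] by simp
qed

text \<open>The regular set is covered by countably many open sets \<open>U i\<close> on which
  \<open>F\<close> is injective; every orbit is represented by its point in the first \<open>U
  i\<close> that it meets, and \<open>O' j\<close> is the union of the orbits that meet \<open>U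
  j\<close>.\<close>

lemma fundamental_domain:
  obtains E where "E \<in> sets borel" "E \<subseteq> regular" "inj_on F E" "F ` E = F ` regular"
    "(\<Union>s\<in>I. g s ` E) = regular" "disjoint_family_on (\<lambda>s. g s ` E) I"
proof -
  define \<U> where "\<U> = {V. open V \<and> V \<subseteq> regular \<and> inj_on F V}"
  have cover: "\<Union>\<U> = regular"
  proof
    show "\<Union>\<U> \<subseteq> regular" by (auto simp: \<U>_def)
    show "regular \<subseteq> \<Union>\<U>"
    proof
      fix z assume z: "z \<in> regular"
      have zb: "z \<in> unit_ball" using z regular_sub by blast
      obtain r where r: "r > 0" "inj_on F (ball z r)"
        using holo_map_local_inverse[OF F(1) zb regular_J[OF z]] by metis
      have "ball z r \<inter> regular \<in> \<U>"
        using r(2) regular_open by (auto simp: \<U>_def intro: inj_on_subset)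
      then show "z \<in> \<Union>\<U>" using z r(1) by (intro UnionI[of "ball z r \<inter> regular"]) auto
    qed
  qed
  obtain \<V> where \<V>: "\<V> \<subseteq> \<U>" "countable \<V>" "\<Union>\<V> = \<Union>\<U>"
    by (rule Lindelof[of \<U>]) (auto simp: \<U>_def)
  define U where "U = from_nat_into (insert {} \<V>)"
  have rU: "range U = insert {} \<V>"
    unfolding U_def by (rule range_from_nat_into) (use \<V>(2) in auto)
  have U: "open (U i)" "U i \<subseteq> regular" "inj_on F (U i)" for i
  proof -
    have "U i \<in> insert {} \<V>" using rU by blast
    then have "U i \<in> \<U>" using \<V>(1) by (auto simp: \<U>_def)
    then show "open (U i)" "U i \<subseteq> regular" "inj_on F (U i)" by (auto simp: \<U>_def)
  qed
  have UU: "(\<Union>i. U i) = regular" using rU \<V>(3) cover by auto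
  define O' where "O' j = (\<Union>s\<in>I. unit_ball \<inter> g s -` U j)" for j
  have O': "open (O' j)" for j
    unfolding O'_def
    by (intro open_UN ballI continuous_open_preimage[OF holo_map_on_continuous_on[OF g_holo] open_ball U(1)])
  define E where "E = (\<Union>i. U i - (\<Union>j<i. O' j))"
  have EB: "E \<in> sets borel"
    unfolding E_def using U(1) O' by (intro sets.countable_UN) (auto intro!: sets.Diff sets.finite_UN)
  have Esub: "E \<subseteq> regular" using U(2) by (auto simp: E_def)
  have Eb: "E \<subseteq> unit_ball" using Esub regular_sub by blast
  \<comment> \<open>Two points of one orbit cannot be chosen at different stages.\<close>
  have no: False if "i < i'" "z \<in> U i" "z' \<in> unit_ball" "z' \<notin> (\<Union>j<i'. O' j)" "F z = F z'" for i i' z z'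
  proof -
    have "z \<in> unit_ball" using that(2) U(2) regular_sub by blast
    from fibre[OF that(3) this that(5)[symmetric]] obtain s where "s \<in> I" "z = g s z'" by blast
    then have "z' \<in> O' i" using that by (auto simp: O'_def)
    then show False using that by auto
  qed
  have inj: "inj_on F E"
  proof (rule inj_onI)
    fix z z' assume z: "z \<in> E" "z' \<in> E" and eq: "F z = F z'"
    obtain i where i: "z \<in> U i" "z \<notin> (\<Union>j<i. O' j)" using z(1) by (auto simp: E_def)
    obtain i' where i': "z' \<in> U i'" "z' \<notin> (\<Union>j<i'. O' j)" using z(2) by (auto simp: E_def)
    have zb: "z \<in> unit_ball" "z' \<in> unit_ball" using z Eb by auto
    have "\<not> i < i'" using no[OF _ i(1) zb(2) i'(2) eq] by blast
    moreover have "\<not> i' < i" using no[OF _ i'(1) zb(1) i(2) eq[symmetric]] by blast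
    ultimately have "i = i'" by simp
    then show "z = z'" using U(3)[of i] i i' eq by (auto dest: inj_onD)
  qed
  have reach: "\<exists>s\<in>I. g s z \<in> E" if z: "z \<in> regular" for z
  proof -
    have zb: "z \<in> unit_ball" using z regular_sub by blast
    obtain s0 where s0: "s0 \<in> I" "z = g s0 z" using fibre[OF zb zb refl] by blast
    obtain i0 where "z \<in> U i0" using z UU by blast
    moreover have "g s0 z = z" using s0(2) by (rule sym)
    ultimately have "g s0 z \<in> U i0" by (simp only:)
    then have "z \<in> O' i0" using s0(1) zb unfolding O'_def by blast
    \<comment> \<open>The first stage at which the orbit of \<open>z\<close> is met.\<close>
    define i where "i = (LEAST i. z \<in> O' i)"
    have i: "z \<in> O' i" unfolding i_def by (rule LeastI[of _ i0]) fact
    have least: "z \<notin> O' j" if "j < i" for j using not_less_Least[of j "\<lambda>i. z \<in> O' i"] that by (auto simp: i_def)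
    obtain s where s: "s \<in> I" "g s z \<in> U i" using i by (auto simp: O'_def)
    have "g s z \<notin> O' j" if j: "j < i" for j
    proof
      assume "g s z \<in> O' j"
      then obtain t where t: "t \<in> I" "g t (g s z) \<in> U j" by (auto simp: O'_def)
      have "F z = F (g t (g s z))" using F_g[OF t(1) g_ball[OF s(1) zb]] F_g[OF s(1) zb] by simp
      then obtain r where "r \<in> I" "g t (g s z) = g r z"
        using fibre[OF zb g_ball[OF t(1) g_ball[OF s(1) zb]]] by blast
      then have "z \<in> O' j" using t zb by (auto simp: O'_def)
      then show False using least[OF j] by simp
    qed
    then have "g s z \<in> E" using s by (auto simp: E_def)
    then show ?thesis using s by blast
  qed
  show ?thesis
  proof (rule that[OF EB Esub inj])
    show "F ` E = F ` regular"
    proof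
      show "F ` E \<subseteq> F ` regular" using Esub by blast
      show "F ` regular \<subseteq> F ` E"
      proof
        fix y assume "y \<in> F ` regular"
        then obtain z where z: "z \<in> regular" "y = F z" by blast
        obtain s where s: "s \<in> I" "g s z \<in> E" using reach[OF z(1)] by blast
        have "F (g s z) = y" using F_g[OF s(1)] z regular_sub by blast
        then show "y \<in> F ` E" using s by blast
      qed
    qed
    show "(\<Union>s\<in>I. g s ` E) = regular"
    proof
      show "(\<Union>s\<in>I. g s ` E) \<subseteq> regular" using regular_g Esub Eb by blast
      show "regular \<subseteq> (\<Union>s\<in>I. g s ` E)"
      proof
        fix z assume z: "z \<in> regular"
        then have zb: "z \<in> unit_ball" using regular_sub by blast
        obtain s where s: "s \<in> I" "g s z \<in> E" using reach[OF z] by blast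
        obtain t where "t \<in> I" "z = g t (g s z)"
          using fibre[OF g_ball[OF s(1) zb] zb F_g[OF s(1) zb]] by blast
        then show "z \<in> (\<Union>s\<in>I. g s ` E)" using s by blast
      qed
    qed
    show "disjoint_family_on (\<lambda>s. g s ` E) I"
      unfolding disjoint_family_on_def
    proof (intro ballI impI)
      fix s t assume st: "s \<in> I" "t \<in> I" "s \<noteq> t"
      show "g s ` E \<inter> g t ` E = {}"
      proof (rule ccontr)
        assume "g s ` E \<inter> g t ` E \<noteq> {}"
        then obtain x y where xy: "x \<in> E" "y \<in> E" "g s x = g t y" by blast
        have xb: "x \<in> unit_ball" "y \<in> unit_ball" using xy Eb by auto
        have "F x = F y" using F_g[OF st(1) xb(1)] F_g[OF st(2) xb(2)] xy(3) by simp
        then have "x = y" using inj xy by (auto dest: inj_onD)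
        then have "s = t" using free[OF st(1,2) xb(1)] regular_J xy Esub by auto
        then show False using st by simp
      qed
    qed
  qed
qed

lemma pullback_g:
  assumes s: "s \<in> I" and z: "z \<in> unit_ball"
  shows "Jg s z * (J (g s z) * u (F (g s z))) = J z * u (F z)"
  using J_g[OF s z] F_g[OF s z] by (simp add: mult_ac)

text \<open>The translates of the fundamental domain \<open>E\<close> exhaust the ball up to a null set. The
  function is square integrable on \<open>E\<close>, which \<open>F\<close> maps bijectively to
  almost all of \<open>\<Omega>\<close>, and by \<open>pullback_g\<close> it has the same norm on
  every translate.\<close>

lemma pullback_bergman:
  assumes u: "u \<in> bergman_space \<Omega>"
  shows "(\<lambda>z. J z * u (F z)) \<in> bergman_space unit_ball"
  unfolding bergman_space_iff
proof
  have hu: "holo_on u \<Omega>" using u by (simp add: bergman_space_iff)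
  show h: "holo_on (\<lambda>z. J z * u (F z)) unit_ball"
    by (intro holo_on_mult holo_J holo_on_compose[OF hu F(1)]) (use F(2) in auto)
  let ?G = "\<lambda>z. J z * u (F z)"
  have cG: "continuous_on unit_ball ?G" by (rule holo_on_continuous_on[OF h])
  obtain E where E: "E \<in> sets borel" "E \<subseteq> regular" "inj_on F E" "F ` E = F ` regular"
    "(\<Union>s\<in>I. g s ` E) = regular" "disjoint_family_on (\<lambda>s. g s ` E) I" by (rule fundamental_domain)
  have Eb: "E \<subseteq> unit_ball" using E(2) regular_sub by blast
  have FE: "F ` E \<in> sets borel" unfolding E(4) F_regular using zero_set_borel(2)[OF \<Delta>(1)] by auto
  have FEs: "F ` E \<subseteq> \<Omega>" using E(4) F_regular by auto
  have cu: "continuous_on (F ` E) u" by (rule continuous_on_subset[OF holo_on_continuous_on[OF hu] FEs])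
  have "set_integrable lborel (F ` E) (\<lambda>z. (cmod (u z))\<^sup>2)"
    by (rule set_integrable_subset[of _ \<Omega>]) (use u FE FEs in \<open>auto simp: bergman_space_iff\<close>)
  then have iE: "set_integrable lborel E (\<lambda>z. (cmod (?G z))\<^sup>2)"
    using inner_L2_image(2)[OF F(1) E(1) Eb FE E(3) cu cu] by simp
  have "set_integrable lborel (g s ` E) (\<lambda>z. (cmod (?G z))\<^sup>2)" "g s ` E \<in> sets lborel" if s: "s \<in> I" for s
  proof -
    have inj: "inj_on (g s) unit_ball" using g_bij[OF s] by (rule bij_betw_imp_inj_on)
    have gE: "g s ` E \<in> sets borel"
      by (rule borel_injective_image[OF holo_map_on_continuous_on[OF g_holo[OF s]] open_ball inj E(1) Eb])
    then show "g s ` E \<in> sets lborel" by simp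
    have sub: "g s ` E \<subseteq> unit_ball" using g_ball[OF s] Eb by blast
    have c: "continuous_on (g s ` E) ?G" by (rule continuous_on_subset[OF cG sub])
    have "set_integrable lborel E (\<lambda>z. (cmod (Jg s z * ?G (g s z)))\<^sup>2) \<longleftrightarrow> set_integrable lborel E (\<lambda>z. (cmod (?G z))\<^sup>2)"
    proof (rule set_integrable_cong[OF refl refl])
      fix z assume "z \<in> E"
      then have "z \<in> unit_ball" using Eb by blast
      from pullback_g[OF s this] show "(cmod (Jg s z * ?G (g s z)))\<^sup>2 = (cmod (?G z))\<^sup>2" by simp
    qed
    then show "set_integrable lborel (g s ` E) (\<lambda>z. (cmod (?G z))\<^sup>2)"
      using inner_L2_image(2)[OF g_holo[OF s] E(1) Eb gE inj_on_subset[OF inj Eb] c c] iE by simp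
  qed
  then have "set_integrable lborel (\<Union>s\<in>I. g s ` E) (\<lambda>z. (cmod (?G z))\<^sup>2)"
    by (intro set_integrable_UN[OF finite_I]) auto
  then have "set_integrable lborel regular (\<lambda>z. (cmod (?G z))\<^sup>2)" unfolding E(5) .
  then show "set_integrable lborel unit_ball (\<lambda>z. (cmod (?G z))\<^sup>2)"
    using inner_L2_null_part(2)[OF _ _ regular_sub regular_null cG cG] regular_open by auto
qed

lemma T_bergman:
  assumes h: "h \<in> bergman_space unit_ball" shows "T h \<in> bergman_space unit_ball"
proof -
  have 1: "(\<lambda>z. Jg s z * h (g s z)) \<in> bergman_space unit_ball" if "s \<in> I" for s
    using bergman_space_image(1)[OF g_holo[OF that] _ _ open_ball h] g_bij[OF that] by (auto simp: bij_betw_def)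
  have 0: "(\<lambda>z. 0) \<in> bergman_space (unit_ball :: (complex^'n) set)"
    using bergman_space_cmult[OF h, of 0] by simp
  have "(\<lambda>z. \<Sum>s\<in>S. Jg s z * h (g s z)) \<in> bergman_space unit_ball" if "finite S" "S \<subseteq> I" for S
    using that by (induction S rule: finite_induct) (auto intro!: bergman_space_add 1 simp: 0)
  then show ?thesis unfolding T_def[abs_def] using finite_I by blast
qed

text \<open>The quotient \<open>T h / J\<close> is constant on regular fibres, hence a holomorphic function
  \<open>f0\<close> of \<open>F z\<close>. It is square integrable, because on the fundamental
  domain its norm is that of \<open>T h\<close>, and therefore extends across the zeros of
  \<open>\<Delta>\<close>. Unfolding the sum \<open>T h\<close> turns the integral over the
  fundamental domain into one over the ball, so \<open>h \<mapsto> f\<close> is adjoint to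
  \<open>u \<mapsto> J \<cdot> (u \<circ> F)\<close>.\<close>

lemma descent:
  assumes h: "h \<in> bergman_space unit_ball"
  obtains f where "f \<in> bergman_space \<Omega>" "\<And>z. z \<in> unit_ball \<Longrightarrow> J z * f (F z) = T h z"
    "\<And>u. u \<in> bergman_space \<Omega> \<Longrightarrow> inner_L2 \<Omega> u f = inner_L2 unit_ball (\<lambda>z. J z * u (F z)) h"
proof -
  let ?\<Omega>' = "{z \<in> \<Omega>. \<Delta> z \<noteq> 0}"
  have TB: "T h \<in> bergman_space unit_ball" by (rule T_bergman[OF h])
  have hT: "holo_on (T h) unit_ball" using TB by (simp add: bergman_space_iff)
  have hh: "holo_on h unit_ball" using h by (simp add: bergman_space_iff)
  obtain E where E: "E \<in> sets borel" "E \<subseteq> regular" "inj_on F E" "F ` E = F ` regular"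
    "(\<Union>s\<in>I. g s ` E) = regular" "disjoint_family_on (\<lambda>s. g s ` E) I" by (rule fundamental_domain)
  have Eb: "E \<subseteq> unit_ball" using E(2) regular_sub by blast
  have FE': "F ` E = ?\<Omega>'" using E(4) F_regular by simp
  have FE: "F ` E \<in> sets borel" unfolding FE' using zero_set_borel(2)[OF \<Delta>(1)] by auto
  define f0 where "f0 y = (let z = inv_into regular F y in T h z / J z)" for y
  have f0: "f0 (F z) = T h z / J z" if z: "z \<in> regular" for z
  proof -
    have zb: "z \<in> unit_ball" using z regular_sub by blast
    define z' where "z' = inv_into regular F (F z)"
    have z': "z' \<in> regular" "F z' = F z"
      unfolding z'_def using z by (auto intro: inv_into_into f_inv_into_f)
    then have "z' \<in> unit_ball" using regular_sub by blast
    then obtain s where s: "s \<in> I" "z' = g s z" using fibre[OF zb _ z'(2)[symmetric]] by blast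
    have "Jg s z \<noteq> 0" using J_g[OF s(1) zb] regular_J[OF z] by auto
    then have "T h z' / J z' = T h z / J z"
      unfolding s(2) T_g[OF s(1) zb, symmetric] J_g[OF s(1) zb, symmetric] by simp
    then show ?thesis by (simp add: f0_def z'_def)
  qed
  have hf0: "holo_on f0 ?\<Omega>'"
  proof (rule holo_on_local[OF zero_set_borel(2)[OF \<Delta>(1)]])
    fix y assume "y \<in> ?\<Omega>'"
    then obtain z where z: "z \<in> regular" "y = F z" using F_regular by blast
    have Jz: "J z \<noteq> 0" by (rule regular_J[OF z(1)])
    obtain r where r: "r > 0" "ball z r \<subseteq> regular" "inj_on F (ball z r)" "open (F ` ball z r)"
      "holo_map_on (inv_into (ball z r) F) (F ` ball z r)"
      by (rule holo_map_local_inverse[OF holo_map_on_subset[OF F(1) regular_open regular_sub] z(1) Jz])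
    let ?i = "inv_into (ball z r) F"
    have im: "?i ` (F ` ball z r) \<subseteq> ball z r" by (auto intro: inv_into_into)
    have rb: "ball z r \<subseteq> unit_ball" using r(2) regular_sub by blast
    have "holo_on (\<lambda>w. T h w / J w) (ball z r)"
      by (rule holo_on_divide[OF holo_on_subset[OF hT open_ball rb] holo_on_subset[OF holo_J open_ball rb]])
         (use r(2) regular_J in blast)
    from holo_on_compose[OF this r(5) im]
    have "holo_on (\<lambda>y. T h (?i y) / J (?i y)) (F ` ball z r)" .
    then have "holo_on f0 (F ` ball z r)"
    proof (rule holo_on_cong)
      fix y assume y: "y \<in> F ` ball z r"
      have "?i y \<in> regular" using im y r(2) by blast
      from f0[OF this] show "f0 y = T h (?i y) / J (?i y)" using f_inv_into_f[OF y] by simp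
    qed
    then show "\<exists>V. y \<in> V \<and> holo_on f0 V" using z r(1) by (intro exI[of _ "F ` ball z r"]) auto
  qed
  have cf0: "continuous_on (F ` E) f0" unfolding FE' by (rule holo_on_continuous_on[OF hf0])
  have JE: "J z * f0 (F z) = T h z" if "z \<in> regular" for z
    using f0[OF that] regular_J[OF that] by simp
  have "set_integrable lborel E (\<lambda>z. (cmod (T h z))\<^sup>2)"
    by (rule set_integrable_subset[of _ unit_ball]) (use TB E(1) Eb in \<open>auto simp: bergman_space_iff\<close>)
  also have "set_integrable lborel E (\<lambda>z. (cmod (T h z))\<^sup>2) \<longleftrightarrow> set_integrable lborel E (\<lambda>z. (cmod (J z * f0 (F z)))\<^sup>2)"
  proof (rule set_integrable_cong[OF refl refl])
    fix z assume "z \<in> E"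
    then have "z \<in> regular" using E(2) by blast
    from JE[OF this] show "(cmod (T h z))\<^sup>2 = (cmod (J z * f0 (F z)))\<^sup>2" by simp
  qed
  finally have "set_integrable lborel (F ` E) (\<lambda>z. (cmod (f0 z))\<^sup>2)"
    using inner_L2_image(2)[OF F(1) E(1) Eb FE E(3) cf0 cf0] by simp
  then have "set_integrable lborel ?\<Omega>' (\<lambda>z. (cmod (f0 z))\<^sup>2)" unfolding FE' .
  from square_integrable_extension[OF \<Delta>(1) gen_\<Delta> hf0 this]
  obtain f where f: "holo_on f \<Omega>" "\<And>z. z \<in> \<Omega> \<Longrightarrow> \<Delta> z \<noteq> 0 \<Longrightarrow> f z = f0 z" by blast
  have cf: "continuous_on \<Omega> f" by (rule holo_on_continuous_on[OF f(1)])
  have \<Omega>b: "\<Omega> \<in> sets borel" "?\<Omega>' \<in> sets borel" using \<Omega> zero_set_borel(2)[OF \<Delta>(1)] by auto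
  have n: "\<Omega> - ?\<Omega>' \<in> null_sets lborel" using \<Omega>_null unfolding F_regular .
  have "set_integrable lborel ?\<Omega>' (\<lambda>z. (cmod (f z))\<^sup>2) \<longleftrightarrow> set_integrable lborel ?\<Omega>' (\<lambda>z. (cmod (f0 z))\<^sup>2)"
    by (rule set_integrable_cong) (use f(2) in auto)
  with \<open>set_integrable lborel ?\<Omega>' (\<lambda>z. (cmod (f0 z))\<^sup>2)\<close>
  have "set_integrable lborel ?\<Omega>' (\<lambda>z. (cmod (f z))\<^sup>2)" by simp
  then have fB: "f \<in> bergman_space \<Omega>"
    using inner_L2_null_part(2)[OF \<Omega>b _ n cf cf] f(1) by (auto simp: bergman_space_iff)
  have freg: "J z * f (F z) = T h z" if z: "z \<in> regular" for z
    using JE[OF z] f(2)[of "F z"] F_in z by (auto simp: regular_def)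
  have feq: "J z * f (F z) = T h z" if z: "z \<in> unit_ball" for z
  proof (rule AE_eq_imp_eq_on[OF open_ball _ _ _ z])
    show "continuous_on unit_ball (\<lambda>z. J z * f (F z))"
      by (rule holo_on_continuous_on[of _ unit_ball], intro holo_on_mult holo_J holo_on_compose[OF f(1) F(1)])
         (use F(2) in auto)
    show "continuous_on unit_ball (T h)" by (rule holo_on_continuous_on[OF hT])
    show "AE x in lborel. x \<in> unit_ball \<longrightarrow> J x * f (F x) = T h x"
      using AE_not_in[OF regular_null] by eventually_elim (auto intro: freg)
  qed
  have inner: "inner_L2 \<Omega> u f = inner_L2 unit_ball (\<lambda>z. J z * u (F z)) h" if u: "u \<in> bergman_space \<Omega>" for u
  proof -
    let ?G = "\<lambda>z. J z * u (F z)"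
    have hu: "holo_on u \<Omega>" using u by (simp add: bergman_space_iff)
    have GB: "?G \<in> bergman_space unit_ball" by (rule pullback_bergman[OF u])
    have cG: "continuous_on unit_ball ?G" by (rule holo_on_continuous_on) (use GB in \<open>simp add: bergman_space_iff\<close>)
    have ch: "continuous_on unit_ball h" by (rule holo_on_continuous_on[OF hh])
    have cu: "continuous_on \<Omega> u" by (rule holo_on_continuous_on[OF hu])
    have FEs: "F ` E \<subseteq> \<Omega>" using FE' by auto
    \<comment> \<open>From \<open>\<Omega>\<close> to the fundamental domain, then summand by
      summand to its translates, which fill the ball.\<close>
    have "inner_L2 \<Omega> u f = inner_L2 (F ` E) u f"
      unfolding FE' by (rule inner_L2_null_part(1)[OF \<Omega>b _ n cu cf, symmetric]) auto
    also have "\<dots> = inner_L2 E ?G (\<lambda>z. J z * f (F z))"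
      by (rule inner_L2_image(1)[OF F(1) E(1) Eb FE E(3) continuous_on_subset[OF cu FEs] continuous_on_subset[OF cf FEs]])
    also have "\<dots> = inner_L2 E ?G (\<lambda>z. \<Sum>s\<in>I. Jg s z * h (g s z))"
      unfolding inner_L2_def
    proof (rule set_lebesgue_integral_cong)
      show "\<forall>z. z \<in> E \<longrightarrow> ?G z * cnj (J z * f (F z)) = ?G z * cnj (\<Sum>s\<in>I. Jg s z * h (g s z))"
      proof (intro allI impI)
        fix z assume "z \<in> E"
        then have "z \<in> unit_ball" using Eb by blast
        from feq[OF this] show "?G z * cnj (J z * f (F z)) = ?G z * cnj (\<Sum>s\<in>I. Jg s z * h (g s z))"
          unfolding T_def by (simp only:)
      qed
    qed (use E(1) in auto)
    also have "\<dots> = (LINT z:E|lborel. \<Sum>s\<in>I. ?G z * cnj (Jg s z * h (g s z)))"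
      unfolding inner_L2_def cnj_sum sum_distrib_left ..
    also have "\<dots> = (\<Sum>s\<in>I. inner_L2 E ?G (\<lambda>z. Jg s z * h (g s z)))"
      unfolding inner_L2_def set_lebesgue_integral_def scaleR_sum_right
    proof (rule Bochner_Integration.integral_sum)
      fix s assume s: "s \<in> I"
      have "(\<lambda>z. Jg s z * h (g s z)) \<in> bergman_space unit_ball"
        using bergman_space_image(1)[OF g_holo[OF s] _ _ open_ball h] g_bij[OF s] by (auto simp: bij_betw_def)
      from set_integrable_subset[OF bergman_space_product[OF GB this] _ Eb]
      show "integrable lborel (\<lambda>x. indicator E x *\<^sub>R (?G x * cnj (Jg s x * h (g s x))))"
        using E(1) by (simp add: set_integrable_def)
    qed
    also have "\<dots> = (\<Sum>s\<in>I. inner_L2 (g s ` E) ?G h)"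
    proof (rule sum.cong[OF refl])
      fix s assume s: "s \<in> I"
      have inj: "inj_on (g s) unit_ball" using g_bij[OF s] by (rule bij_betw_imp_inj_on)
      have gE: "g s ` E \<in> sets borel"
        by (rule borel_injective_image[OF holo_map_on_continuous_on[OF g_holo[OF s]] open_ball inj E(1) Eb])
      have sub: "g s ` E \<subseteq> unit_ball" using g_ball[OF s] Eb by blast
      have "inner_L2 (g s ` E) ?G h = inner_L2 E (\<lambda>z. Jg s z * ?G (g s z)) (\<lambda>z. Jg s z * h (g s z))"
        by (rule inner_L2_image(1)[OF g_holo[OF s] E(1) Eb gE inj_on_subset[OF inj Eb]
              continuous_on_subset[OF cG sub] continuous_on_subset[OF ch sub]])
      also have "\<dots> = inner_L2 E ?G (\<lambda>z. Jg s z * h (g s z))"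
        unfolding inner_L2_def
      proof (rule set_lebesgue_integral_cong)
        show "\<forall>z. z \<in> E \<longrightarrow> Jg s z * ?G (g s z) * cnj (Jg s z * h (g s z)) = ?G z * cnj (Jg s z * h (g s z))"
        proof (intro allI impI)
          fix z assume "z \<in> E"
          then have "z \<in> unit_ball" using Eb by blast
          from pullback_g[OF s this]
          show "Jg s z * ?G (g s z) * cnj (Jg s z * h (g s z)) = ?G z * cnj (Jg s z * h (g s z))" by simp
        qed
      qed (use E(1) in auto)
      finally show "inner_L2 E ?G (\<lambda>z. Jg s z * h (g s z)) = inner_L2 (g s ` E) ?G h" by simp
    qed
    also have "\<dots> = inner_L2 (\<Union>s\<in>I. g s ` E) ?G h"
      unfolding inner_L2_def
    proof (rule set_integral_finite_Union[OF finite_I E(6), symmetric])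
      fix s assume s: "s \<in> I"
      have inj: "inj_on (g s) unit_ball" using g_bij[OF s] by (rule bij_betw_imp_inj_on)
      have gE: "g s ` E \<in> sets borel"
        by (rule borel_injective_image[OF holo_map_on_continuous_on[OF g_holo[OF s]] open_ball inj E(1) Eb])
      then show "g s ` E \<in> sets lborel" by simp
      have sub: "g s ` E \<subseteq> unit_ball" using g_ball[OF s] Eb by blast
      show "set_integrable lborel (g s ` E) (\<lambda>z. ?G z * cnj (h z))"
        by (rule set_integrable_subset[OF bergman_space_product[OF GB h] _ sub]) (use gE in simp)
    qed
    also have "\<dots> = inner_L2 unit_ball ?G h"
      unfolding E(5) by (rule inner_L2_null_part(1)[OF _ _ regular_sub regular_null cG ch]) (use regular_open in auto)
    finally show ?thesis .
  qed
  show ?thesis by (rule that[OF fB feq inner])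
qed

end

section \<open>Reproducing functions on the image of a branched covering\<close>

text \<open>Fubini's theorem, for a bounded continuous family on the ball; \<open>G\<close> is integrable
  because the ball has finite measure.\<close>

lemma inner_L2_interval_average:
  fixes G :: "complex^'n \<Rightarrow> complex" and k :: "real \<Rightarrow> complex^'n \<Rightarrow> complex"
  assumes G: "G \<in> bergman_space unit_ball"
    and k: "continuous_on (unit_ball \<times> {0..1}) (\<lambda>p. k (snd p) (fst p))"
    and B: "\<And>z t. z \<in> unit_ball \<Longrightarrow> t \<in> {0..1} \<Longrightarrow> cmod (k t z) \<le> B"
  shows "inner_L2 unit_ball G (\<lambda>z. LINT t:{0..1}|lborel. k t z) = (LINT t:{0..1}|lborel. inner_L2 unit_ball G (k t))"
proof -
  let ?q = "\<lambda>z t. indicator unit_ball z *\<^sub>R (indicator {0..1} t *\<^sub>R (G z * cnj (k t z)))"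
  have cG: "continuous_on unit_ball G"
    by (rule holo_on_continuous_on) (use G in \<open>simp add: bergman_space_iff\<close>)
  have "continuous_on (unit_ball \<times> {0..1}) (\<lambda>p. G (fst p))"
    by (rule continuous_on_compose2[OF cG continuous_on_fst[OF continuous_on_id]]) auto
  then have c: "continuous_on (unit_ball \<times> {0..1}) (\<lambda>p. G (fst p) * cnj (k (snd p) (fst p)))"
    by (intro continuous_on_mult continuous_on_cnj k)
  have "(\<lambda>p. indicator (unit_ball \<times> {0..1}) p *\<^sub>R (G (fst p) * cnj (k (snd p) (fst p)))) \<in> borel_measurable (borel :: ((complex^'n) \<times> real) measure)"
    by (rule borel_measurable_continuous_on_indicator[OF _ c]) (auto intro!: borel_Times)
  moreover have "(\<lambda>p. indicator (unit_ball \<times> {0..1}) p *\<^sub>R (G (fst p) * cnj (k (snd p) (fst p)))) = case_prod ?q"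
    by (auto simp: fun_eq_iff indicator_def)
  ultimately have "case_prod ?q \<in> borel_measurable (borel \<Otimes>\<^sub>M borel)" by (simp add: borel_prod)
  then have qm: "case_prod ?q \<in> borel_measurable (lborel \<Otimes>\<^sub>M lborel)" by (simp cong: measurable_cong_sets)
  have 1: "(\<lambda>z. 1) \<in> bergman_space (unit_ball :: (complex^'n) set)"
    by (rule bounded_holo_bergman[of _ 1]) (auto intro: holo_on_const)
  have G1: "set_integrable lborel unit_ball G" using bergman_space_product[OF G 1] by simp
  have qle: "norm (?q z t) \<le> norm (indicator {0..1} t *\<^sub>R (B * norm (indicator unit_ball z *\<^sub>R G z)))" for z t
  proof (cases "z \<in> unit_ball \<and> t \<in> {0..1}")
    case True
    then have "cmod (G z) * cmod (k t z) \<le> cmod (G z) * B" using B[of z t] by (intro mult_left_mono) auto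
    moreover have "0 \<le> B" using B[of z t] True norm_ge_zero order_trans by blast
    ultimately show ?thesis using True by (simp add: norm_mult mult.commute abs_mult)
  next
    case False
    then show ?thesis by (auto simp: indicator_def)
  qed
  have sl: "integrable lborel (\<lambda>t. ?q z t)" for z
  proof (rule Bochner_Integration.integrable_bound)
    show "integrable lborel (\<lambda>t::real. indicator {0..1} t *\<^sub>R (B * norm (indicator unit_ball z *\<^sub>R G z)))" by simp
    have "(\<lambda>t. (z, t)) \<in> lborel \<rightarrow>\<^sub>M (lborel \<Otimes>\<^sub>M lborel)" by simp
    from measurable_compose[OF this qm] show "(\<lambda>t. ?q z t) \<in> borel_measurable lborel" by simp
    show "AE t in lborel. norm (?q z t) \<le> norm (indicator {0..1} t *\<^sub>R (B * norm (indicator unit_ball z *\<^sub>R G z)))"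
      by (rule AE_I2) (rule qle)
  qed
  have int: "integrable (lborel \<Otimes>\<^sub>M lborel) (case_prod ?q)"
  proof (rule lborel_pair.Fubini_integrable[OF qm])
    show "AE z in lborel. integrable lborel (\<lambda>t. case_prod ?q (z, t))" using sl by (intro AE_I2) simp
    show "integrable lborel (\<lambda>z. LINT t|lborel. norm (case_prod ?q (z, t)))"
    proof (rule Bochner_Integration.integrable_bound)
      show "integrable lborel (\<lambda>z. B * norm (indicator unit_ball z *\<^sub>R G z))"
        using G1 unfolding set_integrable_def by (intro integrable_mult_right integrable_norm)
      have "(\<lambda>p. norm (case_prod ?q p)) \<in> borel_measurable (lborel \<Otimes>\<^sub>M lborel)" using qm by measurable
      then have "(\<lambda>(z, t). norm (case_prod ?q (z, t))) \<in> borel_measurable (lborel \<Otimes>\<^sub>M lborel)" by (simp add: case_prod_beta')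
      from lborel.borel_measurable_lebesgue_integral[OF this]
      show "(\<lambda>z. LINT t|lborel. norm (case_prod ?q (z, t))) \<in> borel_measurable lborel" .
      show "AE z in lborel. norm (LINT t|lborel. norm (case_prod ?q (z, t))) \<le> norm (B * norm (indicator unit_ball z *\<^sub>R G z))"
      proof (rule AE_I2)
        fix z :: "complex^'n"
        have "(LINT t|lborel. norm (?q z t)) \<le> (LINT t|lborel. norm (indicator {0..1::real} t *\<^sub>R (B * norm (indicator unit_ball z *\<^sub>R G z))))"
          by (rule integral_mono[OF integrable_norm[OF sl] _ qle]) simp
        also have "\<dots> = (LINT t|lborel. indicator {0..1::real} t *\<^sub>R \<bar>B * norm (indicator unit_ball z *\<^sub>R G z)\<bar>)"
          by (rule Bochner_Integration.integral_cong) (auto simp: indicator_def)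
        also have "\<dots> = \<bar>B * norm (indicator unit_ball z *\<^sub>R G z)\<bar>" by simp
        finally show "norm (LINT t|lborel. norm (case_prod ?q (z, t))) \<le> norm (B * norm (indicator unit_ball z *\<^sub>R G z))"
          by (simp add: abs_of_nonneg)
      qed
    qed
  qed
  have left: "(LINT t|lborel. ?q z t) = indicator unit_ball z *\<^sub>R (G z * cnj (LINT t:{0..1}|lborel. k t z))" for z
  proof -
    have "(LINT t|lborel. ?q z t) = (LINT t|lborel. (indicator unit_ball z *\<^sub>R G z) * cnj (indicator {0..1} t *\<^sub>R k t z))"
      by (rule Bochner_Integration.integral_cong) (auto simp: indicator_def)
    also have "\<dots> = (indicator unit_ball z *\<^sub>R G z) * cnj (LINT t:{0..1}|lborel. k t z)"
      unfolding set_lebesgue_integral_def Bochner_Integration.integral_cnj[symmetric] by (rule integral_mult_right_zero)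
    finally show ?thesis by simp
  qed
  have right: "(LINT z|lborel. ?q z t) = indicator {0..1} t *\<^sub>R inner_L2 unit_ball G (k t)" for t
  proof -
    have "(LINT z|lborel. ?q z t) = (LINT z|lborel. indicator {0..1} t *\<^sub>R (indicator unit_ball z *\<^sub>R (G z * cnj (k t z))))"
      by (rule Bochner_Integration.integral_cong) (auto simp: indicator_def)
    also have "\<dots> = indicator {0..1} t *\<^sub>R inner_L2 unit_ball G (k t)"
      unfolding inner_L2_def set_lebesgue_integral_def by (cases "t \<in> {0..1}") auto
    finally show ?thesis .
  qed
  have "inner_L2 unit_ball G (\<lambda>z. LINT t:{0..1}|lborel. k t z) = (LINT z|lborel. LINT t|lborel. ?q z t)"
    unfolding left inner_L2_def set_lebesgue_integral_def[of _ unit_ball] ..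
  also have "\<dots> = (LINT t|lborel. LINT z|lborel. ?q z t)"
    by (rule lborel_pair.Fubini_integral[OF int, symmetric])
  also have "\<dots> = (LINT t:{0..1}|lborel. inner_L2 unit_ball G (k t))"
    unfolding right set_lebesgue_integral_def ..
  finally show ?thesis .
qed

context deck_group
begin

text \<open>At a point where \<open>J\<close> does not vanish the function obtained from \<open>k\<^sub>w /
  cnj (J w)\<close> by descent reproduces at \<open>F w\<close>. To include the critical points,
  these functions are averaged over a circle around \<open>w\<close> on which \<open>J\<close> has
  no zeros; the average reproduces at \<open>F w\<close> by the mean value property of \<open>u
  \<circ> F\<close>.\<close>

lemma reproducing_exists:
  assumes w: "w \<in> unit_ball"
  shows "\<exists>k. reproduces \<Omega> (F w) k"
proof -
  let ?V = "complex_of_real (measure lborel (unit_ball :: (complex^'n) set))"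
  obtain v R \<epsilon> where R: "0 < R" "R < 1" and \<epsilon>: "0 < \<epsilon>"
    and line': "\<And>z t. z \<in> ball w \<epsilon> \<Longrightarrow> cmod t < 2 \<Longrightarrow> z + t *s v \<in> unit_ball"
    and nz: "\<And>t. cmod t = R \<Longrightarrow> J (w + t *s v) \<noteq> 0"
    by (rule circle_avoiding_zeros[OF holo_J generically_nonzero_J w], rule that)
  have line: "w + t *s v \<in> unit_ball" if "cmod t < 2" for t by (rule line'[OF _ that]) (use \<epsilon> in simp)
  define c where "c t = w + (R * cis (2 * pi * t)) *s v" for t
  have nc: "cmod (R * cis (2 * pi * t)) = R" for t using R by (simp add: norm_mult)
  have cB: "c t \<in> unit_ball" for t unfolding c_def by (rule line) (use nc[of t] R in simp)
  have cJ: "J (c t) \<noteq> 0" for t unfolding c_def by (rule nz[OF nc])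
  have cc: "continuous_on S c" for S unfolding c_def by (intro continuous_intros)
  have cJc: "continuous_on S (\<lambda>t. J (c t))" for S
    by (rule continuous_on_compose2[OF holo_on_continuous_on[OF holo_J] cc]) (use cB in auto)
  define k where "k t z = inverse (cnj (J (c t))) * ball_kernel (c t) z" for t z
  have kcont: "continuous_on (unit_ball \<times> {0..1}) (\<lambda>p. k (snd p) (fst p))"
  proof -
    have 1: "continuous_on (unit_ball \<times> {0..1}) (\<lambda>p. J (c (snd p)))"
      by (rule continuous_on_compose2[OF cJc continuous_on_snd[OF continuous_on_id]]) auto
    have 2: "continuous_on (unit_ball \<times> {0..1}) (\<lambda>p. c (snd p))"
      by (rule continuous_on_compose2[OF cc continuous_on_snd[OF continuous_on_id]]) auto
    have 3: "continuous_on (unit_ball \<times> {0..1}) (\<lambda>p. hermitian_inner (fst p) (c (snd p)))"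
      unfolding hermitian_inner_def
      by (intro continuous_on_sum continuous_on_mult continuous_on_cnj continuous_on_component 2 continuous_on_fst continuous_on_id)
    have 4: "1 - hermitian_inner (fst p) (c (snd p)) \<noteq> 0" if "p \<in> unit_ball \<times> {0..1}" for p
      using hermitian_inner_neq_1[of "fst p" "c (snd p)"] that cB[of "snd p"] by (auto simp: mem_Times_iff)
    show ?thesis
      unfolding k_def ball_kernel_def
      by (intro continuous_on_mult continuous_on_inverse continuous_on_cnj 1 continuous_on_divide continuous_on_const
          continuous_on_power continuous_on_diff 3) (use cJ 4 in \<open>simp_all add: mem_Times_iff\<close>)
  qed
  have "continuous_on {0..1} (\<lambda>t. cmod (inverse (cnj (J (c t)))) * (1 / (1 - norm (c t)) ^ (CARD('n) + 1)))"
  proof -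
    have "1 - norm (c t) \<noteq> 0" for t using cB[of t] by simp
    then show ?thesis
      by (intro continuous_on_mult continuous_on_norm continuous_on_inverse continuous_on_cnj cJc continuous_on_divide
          continuous_on_const continuous_on_power continuous_on_diff cc) (use cJ in auto)
  qed
  then have "compact ((\<lambda>t. cmod (inverse (cnj (J (c t)))) * (1 / (1 - norm (c t)) ^ (CARD('n) + 1))) ` {0..1})"
    by (rule compact_continuous_image) simp
  then have "bounded ((\<lambda>t. cmod (inverse (cnj (J (c t)))) * (1 / (1 - norm (c t)) ^ (CARD('n) + 1))) ` {0..1})"
    by (rule compact_imp_bounded)
  then obtain B where "\<forall>x\<in>(\<lambda>t. cmod (inverse (cnj (J (c t)))) * (1 / (1 - norm (c t)) ^ (CARD('n) + 1))) ` {0..1}. norm x \<le> B"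
    unfolding bounded_iff by blast
  then have B0: "norm (cmod (inverse (cnj (J (c t)))) * (1 / (1 - norm (c t)) ^ (CARD('n) + 1))) \<le> B" if "t \<in> {0..1}" for t
    using that by blast
  have kB: "cmod (k t z) \<le> B" if z: "z \<in> unit_ball" and t: "t \<in> {0..1}" for z t
  proof -
    have "cmod (k t z) \<le> cmod (inverse (cnj (J (c t)))) * (1 / (1 - norm (c t)) ^ (CARD('n) + 1))"
      unfolding k_def norm_mult by (intro mult_left_mono norm_ball_kernel_le[OF cB z]) simp
    also have "\<dots> \<le> norm (cmod (inverse (cnj (J (c t)))) * (1 / (1 - norm (c t)) ^ (CARD('n) + 1)))"
      unfolding real_norm_def by (rule abs_ge_self)
    also have "\<dots> \<le> B" by (rule B0[OF t])
    finally show ?thesis .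
  qed
  define h where "h z = (LINT t:{0..1}|lborel. k t z)" for z
  have hh: "holo_on h unit_ball"
    unfolding h_def
  proof (rule holo_on_integral_interval[OF open_ball])
    show "continuous_on (unit_ball \<times> {0..1}) (\<lambda>(z, t). k t z)" using kcont by (simp add: case_prod_beta')
    show "holo_on (\<lambda>z. k t z) unit_ball" for t
      unfolding k_def by (rule holo_on_cmult[OF holo_on_ball_kernel[OF cB]])
  qed
  have hB: "h \<in> bergman_space unit_ball"
  proof (rule bounded_holo_bergman[OF hh])
    fix z :: "complex^'n" assume z: "z \<in> unit_ball"
    have "cmod (h z) \<le> (LINT t|lborel. norm (indicator {0..1} t *\<^sub>R k t z))"
      unfolding h_def set_lebesgue_integral_def by (rule integral_norm_bound)
    also have "\<dots> \<le> (LINT t|lborel. indicator {0..1::real} t *\<^sub>R B)"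
    proof (rule integral_mono)
      have "continuous_on {0..1::real} (\<lambda>t. (z, t))" by (intro continuous_on_Pair continuous_on_const continuous_on_id)
      moreover have "(\<lambda>t. (z, t)) ` {0..1::real} \<subseteq> unit_ball \<times> {0..1}" using z by auto
      ultimately have "continuous_on {0..1} (\<lambda>t. (\<lambda>p. k (snd p) (fst p)) (z, t))"
        by (rule continuous_on_compose2[OF kcont])
      then have "continuous_on {0..1} (\<lambda>t. k t z)" by simp
      then have "integrable lborel (\<lambda>t. indicator {0..1} t *\<^sub>R k t z)"
        by (intro borel_integrable_compact) auto
      then show "integrable lborel (\<lambda>t. norm (indicator {0..1} t *\<^sub>R k t z))" by (rule integrable_norm)
      show "norm (indicator {0..1} t *\<^sub>R k t z) \<le> indicator {0..1::real} t *\<^sub>R B" for t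
        using kB[OF z, of t] by (auto simp: indicator_def)
    qed simp
    also have "\<dots> = B" by simp
    finally show "cmod (h z) \<le> B" .
  qed
  obtain f where f: "f \<in> bergman_space \<Omega>"
    "\<And>u. u \<in> bergman_space \<Omega> \<Longrightarrow> inner_L2 \<Omega> u f = inner_L2 unit_ball (\<lambda>z. J z * u (F z)) h"
    using descent[OF hB] by metis
  have "reproduces \<Omega> (F w) f"
    unfolding reproduces_def
  proof (intro conjI ballI f(1))
    fix u assume u: "u \<in> bergman_space \<Omega>"
    let ?G = "\<lambda>z. J z * u (F z)"
    have hu: "holo_on u \<Omega>" using u by (simp add: bergman_space_iff)
    have G: "?G \<in> bergman_space unit_ball" by (rule pullback_bergman[OF u])
    have hF: "holo_on (\<lambda>z. u (F z)) unit_ball" by (rule holo_on_compose[OF hu F(1)]) (use F(2) in auto)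
    have kt: "inner_L2 unit_ball ?G (k t) = ?V * u (F (c t))" for t
    proof -
      have rep: "reproduces unit_ball (c t) (ball_kernel (c t))" by (rule ball_kernel_reproduces[OF cB])
      have "inner_L2 unit_ball ?G (k t) = cnj (inverse (cnj (J (c t)))) * inner_L2 unit_ball ?G (ball_kernel (c t))"
        unfolding k_def by (rule inner_L2_cmult_right)
      also have "inner_L2 unit_ball ?G (ball_kernel (c t)) = ?V * ?G (c t)"
        using bspec[OF conjunct2[OF rep[unfolded reproduces_def]] G] by simp
      finally show ?thesis using cJ[of t] by simp
    qed
    have "inner_L2 \<Omega> u f = inner_L2 unit_ball ?G h" by (rule f(2)[OF u])
    also have "\<dots> = (LINT t:{0..1}|lborel. inner_L2 unit_ball ?G (k t))"
      unfolding h_def by (rule inner_L2_interval_average[OF G kcont kB])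
    also have "\<dots> = ?V * (LINT t:{0..1}|lborel. u (F (c t)))" unfolding kt by simp
    also have "(LINT t:{0..1}|lborel. u (F (c t))) = u (F w)"
    proof -
      have hol: "(\<lambda>t. u (F (w + t *s v))) holomorphic_on ball 0 2"
        by (rule holo_on_line[OF hF]) (use line in auto)
      have "(LINT t:{0..1}|lborel. u (F (w + (R * cis (2 * pi * t)) *s v))) = u (F (w + 0 *s v))"
      proof (rule circle_mean(1)[OF _ _ R(1)])
        show "continuous_on (cball 0 R) (\<lambda>t. u (F (w + t *s v)))"
          by (rule continuous_on_subset[OF holomorphic_on_imp_continuous_on[OF hol]]) (use R in auto)
        show "(\<lambda>t. u (F (w + t *s v))) holomorphic_on ball 0 R"
          by (rule holomorphic_on_subset[OF hol]) (use R in auto)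
      qed
      then show ?thesis by (simp add: c_def)
    qed
    finally show "?V * u (F w) = inner_L2 \<Omega> u f" by simp
  qed
  then show ?thesis by blast
qed

text \<open>Descent of the kernel \<open>k\<^sub>w\<close> of the ball: the adjointness gives
  \<open>\<langle>u, f\<rangle> = V(B) J(w) u(F w)\<close>, so \<open>f / cnj (J w)\<close> is the
  reproducing function at \<open>F w\<close>.\<close>

lemma kernel_formula:
  assumes w: "w \<in> unit_ball" "J w \<noteq> 0" and z: "z \<in> unit_ball" and k: "reproduces \<Omega> (F w) k"
  shows "J z * cnj (J w) * k (F z) = T (ball_kernel w) z"
proof -
  let ?V = "complex_of_real (measure lborel (unit_ball :: (complex^'n) set))"
  obtain f where f: "f \<in> bergman_space \<Omega>" "\<And>z. z \<in> unit_ball \<Longrightarrow> J z * f (F z) = T (ball_kernel w) z"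
    "\<And>u. u \<in> bergman_space \<Omega> \<Longrightarrow> inner_L2 \<Omega> u f = inner_L2 unit_ball (\<lambda>z. J z * u (F z)) (ball_kernel w)"
    by (rule descent[OF ball_kernel_bergman[OF w(1)]]) blast
  have "reproduces \<Omega> (F w) (\<lambda>y. inverse (cnj (J w)) * f y)"
    unfolding reproduces_def
  proof (intro conjI ballI bergman_space_cmult[OF f(1)])
    fix u assume u: "u \<in> bergman_space \<Omega>"
    have rep: "reproduces unit_ball w (ball_kernel w)" by (rule ball_kernel_reproduces[OF w(1)])
    have "inner_L2 \<Omega> u (\<lambda>y. inverse (cnj (J w)) * f y) = cnj (inverse (cnj (J w))) * inner_L2 \<Omega> u f"
      by (rule inner_L2_cmult_right)
    also have "inner_L2 \<Omega> u f = ?V * (J w * u (F w))"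
      unfolding f(3)[OF u] using bspec[OF conjunct2[OF rep[unfolded reproduces_def]] pullback_bergman[OF u]] by simp
    finally show "?V * u (F w) = inner_L2 \<Omega> u (\<lambda>y. inverse (cnj (J w)) * f y)" using w(2) by simp
  qed
  from reproduces_unique[OF k this F_in[OF z]] have "k (F z) = inverse (cnj (J w)) * f (F z)" .
  then have "J z * cnj (J w) * k (F z) = J z * f (F z)" using w(2) by simp
  then show ?thesis using f(2)[OF z] by simp
qed

end

section \<open>Polynomial functions\<close>

lemma poly_mapping_induct_single:
  assumes 0: "P 0" and step: "\<And>f a b. P f \<Longrightarrow> P (f + Poly_Mapping.single a b)"
  shows "P (f :: 'a \<Rightarrow>\<^sub>0 'b::comm_monoid_add)"
proof (induction f rule: Poly_Mapping.update_induct)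
  case const
  show ?case by (rule 0)
next
  case (update f a b)
  have "Poly_Mapping.update a b f = f + Poly_Mapping.single a b"
    using update(1)
    by (intro poly_mapping_eqI) (auto simp: lookup_update lookup_add lookup_single when_def in_keys_iff)
  then show ?case using step[OF update(3)] by simp
qed

definition monomial_val :: "('n \<Rightarrow>\<^sub>0 nat) \<Rightarrow> complex^'n \<Rightarrow> complex" where
  "monomial_val m z = (\<Prod>i\<in>UNIV. (z $ i) ^ Poly_Mapping.lookup m i)"

lemma cpoly_eval_superset:
  assumes "finite S" "Poly_Mapping.keys p \<subseteq> S"
  shows "cpoly_eval p z = (\<Sum>m\<in>S. Poly_Mapping.lookup p m * monomial_val m z)"
  unfolding cpoly_eval_def monomial_val_def[symmetric]
  by (rule sum.mono_neutral_left[OF assms]) (auto simp: in_keys_iff)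

lemma cpoly_eval_add: "cpoly_eval (p + q) z = cpoly_eval p z + cpoly_eval q z"
proof -
  let ?S = "Poly_Mapping.keys p \<union> Poly_Mapping.keys q"
  have "cpoly_eval (p + q) z = (\<Sum>m\<in>?S. Poly_Mapping.lookup (p + q) m * monomial_val m z)"
    by (rule cpoly_eval_superset) (use keys_add[of p q] in auto)
  also have "\<dots> = (\<Sum>m\<in>?S. Poly_Mapping.lookup p m * monomial_val m z) + (\<Sum>m\<in>?S. Poly_Mapping.lookup q m * monomial_val m z)"
    by (simp add: lookup_add distrib_right sum.distrib)
  also have "\<dots> = cpoly_eval p z + cpoly_eval q z"
    by (subst (1 2) cpoly_eval_superset[of ?S]) auto
  finally show ?thesis .
qed

lemma cpoly_eval_0: "cpoly_eval 0 z = 0"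
  by (simp add: cpoly_eval_def)

lemma cpoly_eval_single: "cpoly_eval (Poly_Mapping.single m c) z = c * monomial_val m z"
  by (subst cpoly_eval_superset[of "{m}"]) (auto simp: lookup_single)

lemma monomial_val_add: "monomial_val (m + n) z = monomial_val m z * monomial_val n z"
  by (simp add: monomial_val_def lookup_add power_add prod.distrib)

lemma cpoly_eval_single_mult:
  "cpoly_eval (Poly_Mapping.single m c * q) z = c * monomial_val m z * cpoly_eval q z"
proof (induction q rule: poly_mapping_induct_single)
  case 1
  show ?case by (simp add: cpoly_eval_0)
next
  case (2 f a b)
  then show ?case
    by (simp add: distrib_left mult_single cpoly_eval_add cpoly_eval_single monomial_val_add algebra_simps)
qed

lemma cpoly_eval_mult: "cpoly_eval (p * q) z = cpoly_eval p z * cpoly_eval q z"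
proof (induction p rule: poly_mapping_induct_single)
  case 1
  show ?case by (simp add: cpoly_eval_0)
next
  case (2 f a b)
  then show ?case
    by (simp add: distrib_right cpoly_eval_add cpoly_eval_single cpoly_eval_single_mult)
qed

lemma cpoly_eval_1: "cpoly_eval 1 z = 1"
proof -
  have "(1 :: 'a cpoly) = Poly_Mapping.single 0 1" by simp
  then have "cpoly_eval 1 z = 1 * monomial_val 0 z" using cpoly_eval_single by metis
  then show ?thesis by (simp add: monomial_val_def)
qed

lemma cpoly_eval_power: "cpoly_eval (p ^ n) z = cpoly_eval p z ^ n"
  by (induction n) (simp_all add: cpoly_eval_1 cpoly_eval_mult)

lemma cpoly_eval_prod: "cpoly_eval (\<Prod>i\<in>S. f i) z = (\<Prod>i\<in>S. cpoly_eval (f i) z)"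
  by (induction S rule: infinite_finite_induct) (simp_all add: cpoly_eval_1 cpoly_eval_mult)

lemma cpoly_eval_sum: "cpoly_eval (\<Sum>i\<in>S. f i) z = (\<Sum>i\<in>S. cpoly_eval (f i) z)"
  by (induction S rule: infinite_finite_induct) (simp_all add: cpoly_eval_0 cpoly_eval_add)

lemma cpoly_eval_subst: "cpoly_eval (cpoly_subst q p) z = cpoly_eval q (\<chi> i. cpoly_eval (p i) z)"
proof -
  have "monomial_val 0 z = 1" by (simp add: monomial_val_def)
  then show ?thesis
    unfolding cpoly_subst_def cpoly_eval_sum cpoly_eval_mult cpoly_eval_single cpoly_eval_prod cpoly_eval_power
    by (simp add: cpoly_eval_def)
qed

text \<open>Sums, products, derivatives and linear substitutions are simpler to form on the level of
  functions. The two directions of the correspondence with the formal polynomials are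
  \<open>polynomial_function_eval\<close> and \<open>polynomial_function_imp_cpoly\<close>.\<close>

inductive polynomial_function :: "(complex^'n \<Rightarrow> complex) \<Rightarrow> bool" where
  polynomial_function_const: "polynomial_function (\<lambda>z. c)"
| polynomial_function_nth: "polynomial_function (\<lambda>z. z $ i)"
| polynomial_function_add: "polynomial_function f \<Longrightarrow> polynomial_function g \<Longrightarrow> polynomial_function (\<lambda>z. f z + g z)"
| polynomial_function_mult: "polynomial_function f \<Longrightarrow> polynomial_function g \<Longrightarrow> polynomial_function (\<lambda>z. f z * g z)"

lemma polynomial_function_sum:
  "(\<And>i. i \<in> S \<Longrightarrow> polynomial_function (f i)) \<Longrightarrow> polynomial_function (\<lambda>z. \<Sum>i\<in>S. f i z)"
  by (induction S rule: infinite_finite_induct)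
     (auto intro: polynomial_function_const polynomial_function_add)

lemma polynomial_function_prod:
  "(\<And>i. i \<in> S \<Longrightarrow> polynomial_function (f i)) \<Longrightarrow> polynomial_function (\<lambda>z. \<Prod>i\<in>S. f i z)"
  by (induction S rule: infinite_finite_induct)
     (auto intro: polynomial_function_const polynomial_function_mult)

lemma polynomial_function_power: "polynomial_function f \<Longrightarrow> polynomial_function (\<lambda>z. f z ^ k)"
  by (induction k) (auto intro: polynomial_function_const polynomial_function_mult)

lemma polynomial_function_eval: "polynomial_function (cpoly_eval p)"
proof -
  have "polynomial_function (\<lambda>z. Poly_Mapping.lookup p m * (\<Prod>i\<in>UNIV. (z $ i) ^ Poly_Mapping.lookup m i))" for m
    by (rule polynomial_function_mult[OF polynomial_function_const polynomial_function_prod])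
       (rule polynomial_function_power[OF polynomial_function_nth])
  then show ?thesis unfolding cpoly_eval_def[abs_def] by (rule polynomial_function_sum)
qed

lemma polynomial_function_imp_cpoly: "polynomial_function f \<Longrightarrow> \<exists>p. \<forall>z. cpoly_eval p z = f z"
proof (induction rule: polynomial_function.induct)
  case (polynomial_function_const c)
  have "cpoly_eval (Poly_Mapping.single 0 c) z = c" for z
    by (simp add: cpoly_eval_single monomial_val_def)
  then show ?case by blast
next
  case (polynomial_function_nth i)
  have "cpoly_eval (Poly_Mapping.single (Poly_Mapping.single i 1) 1) z = z $ i" for z
  proof -
    have "(\<Prod>j\<in>UNIV. (z $ j) ^ Poly_Mapping.lookup (Poly_Mapping.single i (1::nat)) j) = (\<Prod>j\<in>UNIV. if j = i then z $ i else 1)"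
      by (rule prod.cong) (auto simp: lookup_single when_def)
    then show ?thesis by (simp add: cpoly_eval_single monomial_val_def)
  qed
  then show ?case by blast
next
  case (polynomial_function_add f g)
  then show ?case by (metis cpoly_eval_add)
next
  case (polynomial_function_mult f g)
  then show ?case by (metis cpoly_eval_mult)
qed

lemma polynomial_function_holo: "polynomial_function f \<Longrightarrow> holo_on f UNIV"
  by (induction rule: polynomial_function.induct)
     (simp_all add: holo_on_const holo_on_nth holo_on_add holo_on_mult)

lemma polynomial_function_matrix:
  fixes A :: "complex^'n^'n"
  assumes "polynomial_function f"
  shows "polynomial_function (\<lambda>z. f (A *v z))"
  using assms
proof (induction rule: polynomial_function.induct)
  case (polynomial_function_nth i)
  show ?case
    unfolding matrix_vector_mult_def vec_lambda_beta
    by (rule polynomial_function_sum)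
       (rule polynomial_function.polynomial_function_mult[OF polynomial_function_const polynomial_function.polynomial_function_nth])
qed (simp_all add: polynomial_function.intros)

lemma polynomial_function_partial_deriv:
  "polynomial_function f \<Longrightarrow> polynomial_function (partial_deriv f j)"
proof (induction rule: polynomial_function.induct)
  case (polynomial_function_const c)
  have "partial_deriv (\<lambda>z. c) j = (\<lambda>z. 0)" by (simp add: partial_deriv_def fun_eq_iff)
  then show ?case by (simp add: polynomial_function.polynomial_function_const)
next
  case (polynomial_function_nth i)
  have "partial_deriv (\<lambda>z. z $ i) j z = (axis i 1 :: complex^'a) $ j" for z :: "complex^'a"
  proof (rule partial_deriv_eq)
    have "(\<lambda>h::complex^'a. \<Sum>j\<in>UNIV. (axis i 1 :: complex^'a) $ j * h $ j) = (\<lambda>h. h $ i)"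
    proof
      fix h :: "complex^'a"
      have "(\<Sum>j\<in>UNIV. (axis i 1 :: complex^'a) $ j * h $ j) = (\<Sum>j\<in>UNIV. if j = i then h $ i else 0)"
        by (rule sum.cong) (auto simp: axis_def)
      then show "(\<Sum>j\<in>UNIV. (axis i 1 :: complex^'a) $ j * h $ j) = h $ i" by simp
    qed
    then show "((\<lambda>z::complex^'a. z $ i) has_derivative (\<lambda>h. \<Sum>j\<in>UNIV. (axis i 1 :: complex^'a) $ j * h $ j)) (at z)"
      by (simp add: bounded_linear_imp_has_derivative bounded_linear_vec_nth)
  qed
  then have "partial_deriv (\<lambda>z. z $ i) j = (\<lambda>z. (axis i 1 :: complex^'a) $ j)" by (simp add: fun_eq_iff)
  then show ?case by (simp add: polynomial_function.polynomial_function_const)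
next
  case (polynomial_function_add f g)
  have "partial_deriv (\<lambda>z. f z + g z) j z = (\<chi> j. partial_deriv f j z + partial_deriv g j z) $ j" for z
  proof (rule partial_deriv_eq)
    show "((\<lambda>z. f z + g z) has_derivative (\<lambda>h. \<Sum>j\<in>UNIV. (\<chi> j. partial_deriv f j z + partial_deriv g j z) $ j * h $ j)) (at z)"
      using has_derivative_add[OF holo_on_has_derivative[OF polynomial_function_holo[OF polynomial_function_add(1)] UNIV_I]
          holo_on_has_derivative[OF polynomial_function_holo[OF polynomial_function_add(2)] UNIV_I]]
      by (simp add: sum.distrib distrib_right)
  qed
  then have "partial_deriv (\<lambda>z. f z + g z) j = (\<lambda>z. partial_deriv f j z + partial_deriv g j z)"
    by (simp add: fun_eq_iff)
  then show ?case
    using polynomial_function.polynomial_function_add[OF polynomial_function_add(3,4)] by simp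
next
  case (polynomial_function_mult f g)
  have "partial_deriv (\<lambda>z. f z * g z) j z = (\<chi> j. f z * partial_deriv g j z + partial_deriv f j z * g z) $ j" for z
  proof (rule partial_deriv_eq)
    show "((\<lambda>z. f z * g z) has_derivative (\<lambda>h. \<Sum>j\<in>UNIV. (\<chi> j. f z * partial_deriv g j z + partial_deriv f j z * g z) $ j * h $ j)) (at z)"
      using has_derivative_mult[OF holo_on_has_derivative[OF polynomial_function_holo[OF polynomial_function_mult(1)] UNIV_I]
          holo_on_has_derivative[OF polynomial_function_holo[OF polynomial_function_mult(2)] UNIV_I]]
      by (simp add: sum.distrib sum_distrib_left sum_distrib_right algebra_simps)
  qed
  then have "partial_deriv (\<lambda>z. f z * g z) j = (\<lambda>z. f z * partial_deriv g j z + partial_deriv f j z * g z)"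
    by (simp add: fun_eq_iff)
  then show ?case
    using polynomial_function.polynomial_function_add[OF
        polynomial_function.polynomial_function_mult[OF polynomial_function_mult(1,4)]
        polynomial_function.polynomial_function_mult[OF polynomial_function_mult(3,2)]] by simp
qed

lemma polynomial_function_jacobian:
  assumes "\<And>i. polynomial_function (\<lambda>z. f z $ i)"
  shows "polynomial_function (complex_jacobian f)"
proof -
  have "polynomial_function (\<lambda>z. jacobian_matrix f z $ i $ j)" for i j
    unfolding jacobian_matrix_def vec_lambda_beta by (rule polynomial_function_partial_deriv[OF assms])
  then have "polynomial_function (\<lambda>z. of_int (sign p) * (\<Prod>i\<in>UNIV. jacobian_matrix f z $ i $ p i))" for p
    by (rule polynomial_function_mult[OF polynomial_function_const polynomial_function_prod])
  then have "polynomial_function (\<lambda>z. det (jacobian_matrix f z))"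
    unfolding det_def by (rule polynomial_function_sum)
  then show ?thesis by (simp add: complex_jacobian_det[abs_def])
qed

section \<open>Generic nonvanishing and critical values\<close>

text \<open>The identity theorem on the line joining \<open>x\<close> to a point of the given open set.\<close>

lemma entire_generically_nonzero:
  fixes f :: "complex^'n \<Rightarrow> complex"
  assumes f: "holo_on f UNIV" and x: "f x \<noteq> 0"
  shows "generically_nonzero f U"
  unfolding generically_nonzero_def
proof (intro allI impI, elim conjE)
  fix W :: "(complex^'n) set" assume W: "open W" "W \<noteq> {}"
  then obtain y where y: "y \<in> W" by blast
  show "\<exists>z\<in>W. f z \<noteq> 0"
  proof (rule ccontr)
    assume "\<not> (\<exists>z\<in>W. f z \<noteq> 0)"
    then have zero: "f z = 0" if "z \<in> W" for z using that by blast
    let ?l = "\<lambda>t. y + t *s (x - y)"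
    have hol: "(\<lambda>t. f (?l t)) holomorphic_on UNIV" by (rule holo_on_line[OF f]) simp
    have "continuous_on UNIV ?l" by (intro continuous_intros)
    then have "open (?l -` W)" by (rule open_vimage[OF W(1)])
    moreover have "0 \<in> ?l -` W" using y by simp
    then have "?l -` W \<noteq> {}" by (rule ex_in_conv[THEN iffD1, OF exI])
    ultimately have op: "open (?l -` W)" "?l -` W \<noteq> {}" by - assumption+
    have "f (?l 1) = 0"
      by (rule analytic_continuation_open[OF op(1) open_UNIV op(2) connected_UNIV subset_UNIV hol, of "\<lambda>_. 0"])
         (use zero in auto)
    then show False using x by simp
  qed
qed

lemma generically_nonzero_mult:
  assumes f: "holo_on f U" "generically_nonzero f U" and g: "generically_nonzero g U"
  shows "generically_nonzero (\<lambda>z. f z * g z) U"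
  unfolding generically_nonzero_def
proof (intro allI impI, elim conjE)
  fix W assume W: "open W" "W \<noteq> {}" "W \<subseteq> U"
  then obtain y where "y \<in> W" by blast
  from generically_nonzeroD[OF f(2) W(1) this W(3)] obtain z where z: "z \<in> W" "f z \<noteq> 0" by blast
  have op: "open {z \<in> W. f z \<noteq> 0}" by (rule zero_set_borel(2)[OF holo_on_subset[OF f(1) W(1,3)]])
  have "z \<in> {z \<in> W. f z \<noteq> 0}" using z by simp
  from generically_nonzeroD[OF g op this] W(3) obtain w where "w \<in> {z \<in> W. f z \<noteq> 0}" "g w \<noteq> 0" by blast
  then show "\<exists>z\<in>W. f z * g z \<noteq> 0" by auto
qed

lemma generically_nonzero_prod:
  assumes "open U" "finite S" "\<And>i. i \<in> S \<Longrightarrow> holo_on (f i) U" "\<And>i. i \<in> S \<Longrightarrow> generically_nonzero (f i) U"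
  shows "generically_nonzero (\<lambda>z. \<Prod>i\<in>S. f i z) U"
  using assms(2,3,4)
proof (induction S rule: finite_induct)
  case empty
  then show ?case by (auto simp: generically_nonzero_def)
next
  case (insert i S)
  have "generically_nonzero (\<lambda>z. f i z * (\<Prod>i\<in>S. f i z)) U"
    by (rule generically_nonzero_mult) (use insert in auto)
  then show ?case using insert(1,2) by simp
qed

text \<open>The easy case of Sard's theorem, transported to real coordinates.\<close>

lemma negligible_critical_values:
  fixes g :: "complex^'n \<Rightarrow> complex^'n"
  assumes g: "holo_map_on g U" and 0: "\<And>z. z \<in> U \<Longrightarrow> complex_jacobian g z = 0"
  shows "negligible (g ` U)"
proof -
  define h where "h v = coord (g (uncoord v))" for v
  define h' where "h' v = (\<lambda>u. coord (jacobian_matrix g (uncoord v) *v uncoord u))" for v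
  let ?T = "coord ` U"
  have "negligible (h ` ?T)"
  proof (rule baby_Sard[OF order_refl])
    fix v assume v: "v \<in> ?T"
    then have u: "uncoord v \<in> U" by auto
    have 1: "(uncoord has_derivative uncoord) (at v within ?T)"
      by (rule bounded_linear_imp_has_derivative[OF bounded_linear_uncoord])
    have 2: "(g has_derivative (*v) (jacobian_matrix g (uncoord v))) (at (uncoord v) within uncoord ` ?T)"
      by (rule has_derivative_at_withinI[OF holo_map_on_has_derivative[OF g u]])
    show "(h has_derivative h' v) (at v within ?T)"
      using bounded_linear.has_derivative[OF bounded_linear_coord diff_chain_within[OF 1 2]]
      unfolding o_def h_def[abs_def] h'_def .
    have "\<bar>rdet ((*v) (jacobian_matrix g (uncoord v)))\<bar> = 0"
      unfolding abs_rdet_matrix complex_jacobian_det[symmetric] using 0[OF u] by simp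
    then have "det (matrix (h' v)) = 0" by (simp add: rdet_def h'_def)
    then show "rank (matrix (h' v)) < CARD((complex^'n) basis_index)" by (simp add: det_eq_0_rank)
  qed
  moreover have "uncoord differentiable_on (h ` ?T)"
    by (rule bounded_linear_imp_differentiable_on[OF bounded_linear_uncoord])
  moreover have "DIM(real^((complex^'n) basis_index)) \<le> DIM(complex^'n)"
    using bij_betw_same_card[OF bij_Rep_basis_index[where 'a="complex^'n"]] by simp
  ultimately have "negligible (uncoord ` (h ` ?T))"
    using negligible_differentiable_image_negligible by blast
  moreover have "uncoord ` (h ` ?T) = g ` U" by (auto simp: h_def image_image)
  ultimately show ?thesis by simp
qed

section \<open>Invariants of finite reflection groups\<close>

lemma hermitian_inner_adjoint:
  "hermitian_inner (A *v z) w = hermitian_inner z (conj_transpose A *v w)"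
proof -
  have "hermitian_inner (A *v z) w = (\<Sum>i\<in>UNIV. \<Sum>j\<in>UNIV. A $ i $ j * z $ j * cnj (w $ i))"
    by (simp add: hermitian_inner_def matrix_vector_mult_def sum_distrib_right)
  also have "\<dots> = (\<Sum>j\<in>UNIV. \<Sum>i\<in>UNIV. A $ i $ j * z $ j * cnj (w $ i))" by (rule sum.swap)
  also have "\<dots> = hermitian_inner z (conj_transpose A *v w)"
    by (simp add: hermitian_inner_def matrix_vector_mult_def conj_transpose_def sum_distrib_left mult_ac)
  finally show ?thesis .
qed

lemma unitary_norm:
  assumes "conj_transpose A ** A = mat 1"
  shows "norm (A *v z) = norm (z::complex^'n)"
proof -
  have "hermitian_inner (A *v z) (A *v z) = hermitian_inner z z"
    unfolding hermitian_inner_adjoint matrix_vector_mul_assoc assms by simp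
  then have "(norm (A *v z))\<^sup>2 = (norm z)\<^sup>2" unfolding hermitian_inner_self by (simp only: of_real_eq_iff)
  then show ?thesis by simp
qed

lemma conj_transpose_mult: "conj_transpose (A ** B) = conj_transpose B ** conj_transpose A"
  by (simp add: conj_transpose_def matrix_matrix_mult_def vec_eq_iff mult.commute)

lemma conj_transpose_conj_transpose: "conj_transpose (conj_transpose A) = A"
  by (simp add: conj_transpose_def vec_eq_iff)

lemma group_unitary_group: "group (unitary_group :: (complex^'n^'n) monoid)"
proof (rule groupI)
  fix x y :: "complex^'n^'n"
  assume x: "x \<in> carrier unitary_group" and y: "y \<in> carrier unitary_group"
  have "conj_transpose (x ** y) ** (x ** y) = conj_transpose y ** ((conj_transpose x ** x) ** y)"
    by (simp add: conj_transpose_mult matrix_mul_assoc)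
  also have "\<dots> = mat 1" using x y by (simp add: unitary_group_def)
  finally show "x \<otimes>\<^bsub>unitary_group\<^esub> y \<in> carrier unitary_group" by (simp add: unitary_group_def)
next
  have "conj_transpose (mat 1) = (mat 1 :: complex^'n^'n)"
    by (auto simp: conj_transpose_def mat_def vec_eq_iff)
  then show "\<one>\<^bsub>unitary_group\<^esub> \<in> carrier (unitary_group :: (complex^'n^'n) monoid)"
    by (simp add: unitary_group_def)
next
  fix x :: "complex^'n^'n" assume x: "x \<in> carrier unitary_group"
  then have u: "conj_transpose x ** x = mat 1" by (simp add: unitary_group_def)
  then have "x ** conj_transpose x = mat 1" using matrix_left_right_inverse by blast
  then have "conj_transpose x \<in> carrier unitary_group"
    by (simp add: unitary_group_def conj_transpose_conj_transpose)
  then show "\<exists>y\<in>carrier unitary_group. y \<otimes>\<^bsub>unitary_group\<^esub> x = \<one>\<^bsub>unitary_group\<^esub>"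
    using u by (intro bexI[of _ "conj_transpose x"]) (simp_all add: unitary_group_def)
qed (simp_all add: unitary_group_def matrix_mul_assoc)

lemma reflection_group_facts:
  fixes G :: "(complex^'n^'n) set"
  assumes "finite_complex_reflection_group G"
  shows "finite G" "mat 1 \<in> G" "A \<in> G \<Longrightarrow> B \<in> G \<Longrightarrow> A ** B \<in> G" "A \<in> G \<Longrightarrow> matrix_inv A \<in> G"
    "A \<in> G \<Longrightarrow> conj_transpose A ** A = mat 1" "A \<in> G \<Longrightarrow> matrix_inv A ** A = mat 1"
    "A \<in> G \<Longrightarrow> A ** matrix_inv A = mat 1"
proof -
  interpret U: group "unitary_group :: (complex^'n^'n) monoid" by (rule group_unitary_group)
  show "finite G" using assms by (simp add: finite_complex_reflection_group_def)
  obtain S where S: "S \<subseteq> carrier unitary_group" "G = generate unitary_group S"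
    using assms by (auto simp: finite_complex_reflection_group_def)
  have sub: "subgroup G unitary_group" unfolding S(2) by (rule U.generate_is_subgroup[OF S(1)])
  show "mat 1 \<in> G" using subgroup.one_closed[OF sub] by (simp add: unitary_group_def)
  show "A \<in> G \<Longrightarrow> B \<in> G \<Longrightarrow> A ** B \<in> G" using subgroup.m_closed[OF sub, of A B] by (simp add: unitary_group_def)
  have car: "A \<in> carrier unitary_group" if "A \<in> G" for A using subgroup.mem_carrier[OF sub that] .
  show u: "A \<in> G \<Longrightarrow> conj_transpose A ** A = mat 1" for A using car[of A] by (simp add: unitary_group_def)
  have inv: "matrix_inv A ** A = mat 1 \<and> A ** matrix_inv A = mat 1" if A: "A \<in> G" for A
  proof -
    have "A ** conj_transpose A = mat 1" using u[OF A] matrix_left_right_inverse by blast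
    then have "invertible A" using u[OF A] unfolding invertible_def by blast
    then show ?thesis
      using someI_ex[of "\<lambda>A'. A ** A' = mat 1 \<and> A' ** A = mat 1"] unfolding invertible_def matrix_inv_def by blast
  qed
  then show "A \<in> G \<Longrightarrow> matrix_inv A ** A = mat 1" "A \<in> G \<Longrightarrow> A ** matrix_inv A = mat 1" by auto
  assume A: "A \<in> G"
  have "inv\<^bsub>unitary_group\<^esub> A \<in> G" using subgroup.m_inv_closed[OF sub A] .
  moreover have "inv\<^bsub>unitary_group\<^esub> A = matrix_inv A"
  proof -
    have "inv\<^bsub>unitary_group\<^esub> A ** A = mat 1" using U.l_inv[OF car[OF A]] by (simp add: unitary_group_def)
    then have "inv\<^bsub>unitary_group\<^esub> A ** (A ** matrix_inv A) = matrix_inv A"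
      by (simp add: matrix_mul_assoc)
    then show ?thesis using inv[OF A] by simp
  qed
  ultimately show "matrix_inv A \<in> G" by simp
qed

text \<open>The invariants of a finite group separate its orbits. The polynomial \<open>L\<close> is zero on
  the orbit of \<open>x\<close> and one at \<open>y\<close>, and the product of \<open>1 -
  L\<close> over the group is invariant, one at \<open>x\<close> and zero at \<open>y\<close>.\<close>

lemma separating_invariant:
  fixes G :: "(complex^'n^'n) set"
  assumes G: "finite_complex_reflection_group G" and y: "\<And>A. A \<in> G \<Longrightarrow> y \<noteq> A *v x"
  obtains f where "polynomial_function f" "\<And>A z. A \<in> G \<Longrightarrow> f (A *v z) = f z" "f x \<noteq> f y"
proof -
  note G = reflection_group_facts[OF G]
  define L where "L z = (\<Prod>A\<in>G. hermitian_inner (z - A *v x) (y - A *v x) / of_real ((norm (y - A *v x))\<^sup>2))" for z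
  have Lx: "L (A *v x) = 0" if A: "A \<in> G" for A
    unfolding L_def by (rule prod_zero[OF G(1)]) (use A in \<open>auto intro!: bexI[of _ A] simp: hermitian_inner_def\<close>)
  have "hermitian_inner (y - A *v x) (y - A *v x) / of_real ((norm (y - A *v x))\<^sup>2) = 1" if "A \<in> G" for A
    unfolding hermitian_inner_self using y[OF that] by simp
  then have Ly: "L y = 1" unfolding L_def by (intro prod.neutral) blast
  have pL: "polynomial_function L"
    unfolding L_def[abs_def]
  proof (rule polynomial_function_prod)
    fix A
    let ?c = "\<lambda>i. cnj ((y - A *v x) $ i) / of_real ((norm (y - A *v x))\<^sup>2)"
    have "polynomial_function (\<lambda>z. \<Sum>i\<in>UNIV. (z $ i + (- (A *v x) $ i)) * ?c i)"
      by (rule polynomial_function_sum)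
         (rule polynomial_function_mult[OF polynomial_function_add[OF polynomial_function_nth polynomial_function_const] polynomial_function_const])
    moreover have "(\<lambda>z. \<Sum>i\<in>UNIV. (z $ i + (- (A *v x) $ i)) * ?c i)
        = (\<lambda>z. hermitian_inner (z - A *v x) (y - A *v x) / of_real ((norm (y - A *v x))\<^sup>2))"
      by (simp add: hermitian_inner_def sum_divide_distrib)
    ultimately show "polynomial_function (\<lambda>z. hermitian_inner (z - A *v x) (y - A *v x) / of_real ((norm (y - A *v x))\<^sup>2))"
      by (simp only:)
  qed
  define f where "f z = (\<Prod>B\<in>G. 1 + (- 1) * L (B *v z))" for z
  show ?thesis
  proof (rule that[of f])
    show "polynomial_function f"
      unfolding f_def[abs_def]
      by (rule polynomial_function_prod, rule polynomial_function_add[OF polynomial_function_const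
            polynomial_function_mult[OF polynomial_function_const polynomial_function_matrix[OF pL]]])
    show "f (A *v z) = f z" if A: "A \<in> G" for A z
    proof -
      have bij: "bij_betw (\<lambda>B. B ** A) G G"
        by (rule bij_betw_byWitness[where f'="\<lambda>B. B ** matrix_inv A"])
           (use A G in \<open>auto simp flip: matrix_mul_assoc\<close>)
      have "f (A *v z) = (\<Prod>B\<in>G. 1 + (- 1) * L ((B ** A) *v z))"
        unfolding f_def by (simp only: matrix_vector_mul_assoc)
      also have "\<dots> = f z" unfolding f_def by (rule prod.reindex_bij_betw[OF bij])
      finally show ?thesis .
    qed
    have "f x = 1" unfolding f_def by (rule prod.neutral) (simp add: Lx)
    moreover have "f y = 0"
      unfolding f_def by (rule prod_zero[OF G(1)]) (use G(2) Ly in \<open>auto intro!: bexI[of _ "mat 1"]\<close>)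
    ultimately show "f x \<noteq> f y" by simp
  qed
qed

lemma matrix_id_on_ball:
  fixes A :: "complex^'n^'n"
  assumes r: "r > 0" and id: "\<And>x. x \<in> ball y r \<Longrightarrow> A *v x = x"
  shows "A = mat 1"
proof -
  have "A *v h = h" for h
  proof (cases "h = 0")
    case False
    define e where "e = r / (2 * norm h)"
    have e: "e > 0" "e * norm h < r" using r False by (auto simp: e_def)
    have "y + e *\<^sub>R h \<in> ball y r" using e by (simp add: dist_norm)
    from id[OF this] id[of y] r have "A *v (e *\<^sub>R h) = e *\<^sub>R h"
      by (simp add: matrix_vector_right_distrib)
    then have "e *\<^sub>R (A *v h) = e *\<^sub>R h"
      using linear_scale[OF linear_matrix_cvec, of A e h] by simp
    then show ?thesis using e by simp
  qed (simp add: matrix_vector_mult_0_right)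
  then have "A *v h = mat 1 *v h" for h by simp
  then show ?thesis by (simp add: matrix_eq)
qed

section \<open>Rudin's factorization and the kernel formula\<close>

lemma biholomorphicD:
  assumes "biholomorphic f U V"
  shows "bij_betw f U V" "holo_map_on f U" "holo_map_on (inv_into U f) V" "open U" "open V"
    "z \<in> U \<Longrightarrow> complex_jacobian f z \<noteq> 0"
proof -
  show b: "bij_betw f U V" and f: "holo_map_on f U" and i: "holo_map_on (inv_into U f) V"
    using assms by (auto simp: biholomorphic_def)
  show "open U" "open V" using f i holo_map_on_open by auto
  assume z: "z \<in> U"
  have "complex_jacobian (\<lambda>w. inv_into U f (f w)) z = complex_jacobian (inv_into U f) (f z) * complex_jacobian f z"
    by (rule complex_jacobian_compose[OF i bij_betw_apply[OF b z] f z])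
  moreover have "complex_jacobian (\<lambda>w. inv_into U f (f w)) z = complex_jacobian (\<lambda>w. w) z"
    by (rule complex_jacobian_cong[OF holo_map_on_id[OF \<open>open U\<close>] z]) (rule bij_betw_inv_into_left[OF b])
  ultimately show "complex_jacobian f z \<noteq> 0" by (auto simp: complex_jacobian_id)
qed

lemma unitary_ball: "conj_transpose A ** A = mat 1 \<Longrightarrow> A *v z \<in> ball 0 r \<longleftrightarrow> z \<in> ball 0 r"
  by (simp add: unitary_norm)

text \<open>The components of \<open>\<theta>\<close> generate the invariants, which separate orbits, so the
  fibres of \<open>\<theta>\<close> are the orbits of \<open>G\<close>. The Jacobian
  \<open>J\<^sub>\<theta>\<close> is not identically zero by Sard's theorem, since
  \<open>\<theta>\<close> maps the ball onto an open set. The product \<open>D\<close> of its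
  translates is an invariant polynomial that vanishes at the critical points of
  \<open>\<theta>\<close>; as such it is a polynomial in \<open>\<theta>\<close>, and this
  polynomial, moved to \<open>\<Omega>\<close> by \<open>\<Phi>\<close>, is the discriminant
  \<open>\<Delta>\<close>.\<close>

lemma rudin_deck_group:
  fixes F \<Phi> \<theta> \<Psi> :: "complex^'n \<Rightarrow> complex^'n"
  assumes \<Omega>: "open \<Omega>" and F: "holo_map_on F unit_ball"
    and rudin: "rudin_factorization F \<Omega> G \<Phi> \<theta> \<Psi>"
  obtains \<Delta> where "deck_group F \<Omega> G (conj_aut \<Psi>) \<Delta>"
proof -
  let ?B = "unit_ball :: (complex^'n) set"
  have G: "finite_complex_reflection_group G" and \<Psi>: "biholomorphic \<Psi> ?B ?B"
    and basic: "basic_polynomial_map G \<theta>" and \<Phi>: "biholomorphic \<Phi> (\<theta> ` ?B) \<Omega>"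
    and Feq: "\<And>z. z \<in> ?B \<Longrightarrow> F z = \<Phi> (\<theta> (\<Psi> z))"
    using rudin by (auto simp: rudin_factorization_def)
  note \<Psi> = biholomorphicD[OF \<Psi>] and \<Phi> = biholomorphicD[OF \<Phi>] and GG = reflection_group_facts[OF G]
  let ?\<Psi>i = "inv_into ?B \<Psi>"
  have \<Psi>B: "\<Psi> z \<in> ?B" if "z \<in> ?B" for z by (rule bij_betw_apply[OF \<Psi>(1) that])
  have \<Psi>i: "?\<Psi>i z \<in> ?B" "\<Psi> (?\<Psi>i z) = z" if "z \<in> ?B" for z
    using bij_betw_apply[OF bij_betw_inv_into[OF \<Psi>(1)] that] bij_betw_inv_into_right[OF \<Psi>(1) that] by auto
  have \<Psi>i': "?\<Psi>i (\<Psi> z) = z" if "z \<in> ?B" for z by (rule bij_betw_inv_into_left[OF \<Psi>(1) that])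
  have GB: "A *v z \<in> ?B" if "A \<in> G" "z \<in> ?B" for A z
    using unitary_ball[OF GG(5)[OF that(1)]] that(2) by blast
  \<comment> \<open>The two inverses in \<open>\<Psi>\<^sub>\<sigma>\<close>, that of the action and
    that of \<open>\<sigma>\<close>, cancel.\<close>
  have act: "refl_act (matrix_inv A) z = A *v z" if A: "A \<in> G" for A and z :: "complex^'n"
  proof -
    have i: "matrix_inv A \<in> G" by (rule GG(4)[OF A])
    have "A ** (matrix_inv A ** matrix_inv (matrix_inv A)) = A" by (simp add: GG(7)[OF i])
    then have "matrix_inv (matrix_inv A) = A" by (simp add: matrix_mul_assoc GG(7)[OF A])
    then show ?thesis by (simp add: refl_act_def)
  qed
  have g: "conj_aut \<Psi> A z = ?\<Psi>i (A *v \<Psi> z)" if "A \<in> G" for A z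
    by (simp add: conj_aut_def act[OF that])
  obtain p where inv: "invariant_cpolys G = range (\<lambda>q. cpoly_subst q p)"
    and \<theta>: "\<theta> = (\<lambda>z. \<chi> i. cpoly_eval (p i) z)"
    using basic by (auto simp: basic_polynomial_map_def)
  have invI: "f \<in> invariant_cpolys G" if "\<And>A z. A \<in> G \<Longrightarrow> cpoly_eval f (A *v z) = cpoly_eval f z" for f
    using that GG(4) by (auto simp: invariant_cpolys_def refl_act_def)
  have invD: "cpoly_eval f (A *v z) = cpoly_eval f z" if "f \<in> invariant_cpolys G" "A \<in> G" for f A z
    using that(1) act[OF that(2)] GG(4)[OF that(2)] unfolding invariant_cpolys_def by (metis (mono_tags, lifting) mem_Collect_eq)
  have sub: "cpoly_eval (cpoly_subst q p) z = cpoly_eval q (\<theta> z)" for q z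
    by (simp add: cpoly_eval_subst \<theta>)
  \<comment> \<open>The equality of rings of formal polynomials in the definition of a basic map, in
    terms of functions.\<close>
  have factor: "\<exists>q. \<forall>z. f z = cpoly_eval q (\<theta> z)"
    if f: "polynomial_function f" and fi: "\<And>A z. A \<in> G \<Longrightarrow> f (A *v z) = f z" for f
  proof -
    obtain f' where f': "\<And>z. cpoly_eval f' z = f z" using polynomial_function_imp_cpoly[OF f] by blast
    have "f' \<in> invariant_cpolys G" by (rule invI) (simp add: f' fi)
    then obtain q where "f' = cpoly_subst q p" unfolding inv by blast
    then have "f z = cpoly_eval q (\<theta> z)" for z using f' sub by metis
    then show ?thesis by blast
  qed
  have \<theta>inv: "\<theta> (A *v z) = \<theta> z" if A: "A \<in> G" for A z
  proof -
    have "\<theta> (A *v z) $ i = \<theta> z $ i" for i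
    proof -
      obtain q where q: "\<And>z::complex^'n. cpoly_eval q z = z $ i"
        using polynomial_function_imp_cpoly[OF polynomial_function_nth] by blast
      have "cpoly_subst q p \<in> invariant_cpolys G" unfolding inv by blast
      from invD[OF this A] show ?thesis by (simp add: sub q)
    qed
    then show ?thesis by (simp add: vec_eq_iff)
  qed
  have \<theta>poly: "polynomial_function (\<lambda>z. \<theta> z $ i)" for i
    unfolding \<theta> vec_lambda_beta using polynomial_function_eval[of "p i"] by simp
  have h\<theta>: "holo_map_on \<theta> U" if "open U" for U
    unfolding holo_map_on_def
    using holo_on_subset[OF polynomial_function_holo[OF \<theta>poly] that] by blast
  let ?J = "complex_jacobian \<theta>"
  have Jpoly: "polynomial_function ?J" by (rule polynomial_function_jacobian[OF \<theta>poly])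
  have "\<exists>x. ?J x \<noteq> 0"
  proof (rule ccontr)
    assume "\<nexists>x. ?J x \<noteq> 0"
    then have "negligible (\<theta> ` ?B)" by (intro negligible_critical_values[OF h\<theta>]) auto
    moreover have "\<theta> ` ?B \<noteq> {}" by simp
    ultimately show False using open_not_negligible[OF \<Phi>(4)] by blast
  qed
  then obtain x where x: "?J x \<noteq> 0" by blast
  define D where "D z = (\<Prod>A\<in>G. ?J (A *v z))" for z
  have Dpoly: "polynomial_function D"
    unfolding D_def[abs_def] by (rule polynomial_function_prod) (rule polynomial_function_matrix[OF Jpoly])
  have Dinv: "D (A *v z) = D z" if A: "A \<in> G" for A z
  proof -
    have bij: "bij_betw (\<lambda>B. B ** A) G G"
      by (rule bij_betw_byWitness[where f'="\<lambda>B. B ** matrix_inv A"])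
         (use A GG in \<open>auto simp flip: matrix_mul_assoc\<close>)
    have "D (A *v z) = (\<Prod>B\<in>G. ?J ((B ** A) *v z))"
      unfolding D_def by (simp only: matrix_vector_mul_assoc)
    also have "\<dots> = D z" unfolding D_def by (rule prod.reindex_bij_betw[OF bij])
    finally show ?thesis .
  qed
  obtain q where q: "\<And>z. D z = cpoly_eval q (\<theta> z)" using factor[OF Dpoly Dinv] by blast
  have D0: "D z = 0" if "?J z = 0" for z
    unfolding D_def by (rule prod_zero[OF GG(1)]) (use GG(2) that in \<open>auto intro!: bexI[of _ "mat 1"]\<close>)
  have Dgen: "generically_nonzero D U" if "open U" for U
    unfolding D_def[abs_def]
  proof (rule generically_nonzero_prod[OF that GG(1)])
    fix A assume A: "A \<in> G"
    have h: "holo_on (\<lambda>z. ?J (A *v z)) UNIV" by (rule polynomial_function_holo[OF polynomial_function_matrix[OF Jpoly]])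
    then show "holo_on (\<lambda>z. ?J (A *v z)) U" using that by (rule holo_on_subset) simp
    show "generically_nonzero (\<lambda>z. ?J (A *v z)) U"
      by (rule entire_generically_nonzero[OF h, of "matrix_inv A *v x"]) (simp add: matrix_vector_mul_assoc GG(7)[OF A] x)
  qed
  let ?\<Phi>i = "inv_into (\<theta> ` ?B) \<Phi>"
  define \<Delta> where "\<Delta> y = cpoly_eval q (?\<Phi>i y)" for y
  have \<Delta>F: "\<Delta> (F z) = D (\<Psi> z)" if z: "z \<in> ?B" for z
  proof -
    have "\<theta> (\<Psi> z) \<in> \<theta> ` ?B" using \<Psi>B[OF z] by blast
    then have "?\<Phi>i (F z) = \<theta> (\<Psi> z)" unfolding Feq[OF z] by (rule bij_betw_inv_into_left[OF \<Phi>(1)])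
    then show ?thesis by (simp add: \<Delta>_def q)
  qed
  have J: "complex_jacobian F z = complex_jacobian \<Phi> (\<theta> (\<Psi> z)) * (?J (\<Psi> z) * complex_jacobian \<Psi> z)"
    if z: "z \<in> ?B" for z
  proof -
    have \<theta>z: "\<theta> (\<Psi> z) \<in> \<theta> ` ?B" using \<Psi>B[OF z] by blast
    have h\<theta>\<Psi>: "holo_map_on (\<lambda>z. \<theta> (\<Psi> z)) ?B"
      by (rule holo_map_on_compose[OF h\<theta>[OF open_ball] \<Psi>(2)]) (use \<Psi>B in blast)
    have "complex_jacobian F z = complex_jacobian (\<lambda>z. \<Phi> (\<theta> (\<Psi> z))) z"
      by (rule complex_jacobian_cong[OF holo_map_on_compose[OF \<Phi>(2) h\<theta>\<Psi>] z Feq]) (use \<Psi>B in auto)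
    also have "\<dots> = complex_jacobian \<Phi> (\<theta> (\<Psi> z)) * complex_jacobian (\<lambda>z. \<theta> (\<Psi> z)) z"
      by (rule complex_jacobian_compose[OF \<Phi>(2) \<theta>z h\<theta>\<Psi> z])
    also have "complex_jacobian (\<lambda>z. \<theta> (\<Psi> z)) z = ?J (\<Psi> z) * complex_jacobian \<Psi> z"
      by (rule complex_jacobian_compose[OF h\<theta>[OF open_ball] \<Psi>B[OF z] \<Psi>(2) z])
    finally show ?thesis .
  qed
  have J0: "?J (\<Psi> z) = 0 \<longleftrightarrow> complex_jacobian F z = 0" if z: "z \<in> ?B" for z
  proof -
    have "\<theta> (\<Psi> z) \<in> \<theta> ` ?B" using \<Psi>B[OF z] by blast
    then show ?thesis using \<Phi>(6) \<Psi>(6)[OF z] by (simp add: J[OF z])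
  qed
  have "deck_group F \<Omega> G (conj_aut \<Psi>) \<Delta>"
  proof
    show "holo_map_on F ?B" by (rule F)
    have "F ` ?B = \<Phi> ` (\<theta> ` (\<Psi> ` ?B))" unfolding image_image by (rule image_cong[OF refl Feq])
    also have "\<dots> = \<Omega>" using \<Psi>(1) \<Phi>(1) by (simp add: bij_betw_def)
    finally show "F ` ?B = \<Omega>" .
    show "open \<Omega>" by (rule \<Omega>)
    show "finite G" by (rule GG(1))
    show "holo_map_on (conj_aut \<Psi> A) ?B" if A: "A \<in> G" for A
    proof -
      have "holo_map_on (\<lambda>z. A *v \<Psi> z) ?B"
        by (rule holo_map_on_compose[OF holo_map_on_matrix[OF open_UNIV] \<Psi>(2)]) simp
      then have "holo_map_on (\<lambda>z. ?\<Psi>i (A *v \<Psi> z)) ?B"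
        by (rule holo_map_on_compose[OF \<Psi>(3)]) (use GB[OF A] \<Psi>B in auto)
      then show ?thesis by (rule holo_map_on_cong) (rule g[OF A])
    qed
    have gmul: "conj_aut \<Psi> A (conj_aut \<Psi> C z) = conj_aut \<Psi> (A ** C) z"
      if "A \<in> G" "C \<in> G" "z \<in> ?B" for A C z
      using that by (simp add: g GG(3) \<Psi>i(2)[OF GB[OF that(2) \<Psi>B[OF that(3)]]] matrix_vector_mul_assoc)
    have g1: "conj_aut \<Psi> (mat 1) z = z" if "z \<in> ?B" for z
      using \<Psi>i'[OF that] by (simp add: g[OF GG(2)])
    have gB: "conj_aut \<Psi> A z \<in> ?B" if "A \<in> G" "z \<in> ?B" for A z
      unfolding g[OF that(1)] by (rule \<Psi>i(1)[OF GB[OF that(1) \<Psi>B[OF that(2)]]])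
    show "bij_betw (conj_aut \<Psi> A) ?B ?B" if A: "A \<in> G" for A
      by (rule bij_betw_byWitness[where f'="conj_aut \<Psi> (matrix_inv A)"])
         (use gmul[OF A GG(4)[OF A]] gmul[OF GG(4)[OF A] A] g1 gB A GG in auto)
    show "F (conj_aut \<Psi> A z) = F z" if A: "A \<in> G" and z: "z \<in> ?B" for A z
    proof -
      have "F (conj_aut \<Psi> A z) = \<Phi> (\<theta> (A *v \<Psi> z))"
        unfolding Feq[OF gB[OF A z]] unfolding g[OF A] \<Psi>i(2)[OF GB[OF A \<Psi>B[OF z]]] ..
      then show ?thesis by (simp add: \<theta>inv[OF A] Feq[OF z])
    qed
    show "\<exists>A\<in>G. w = conj_aut \<Psi> A z" if z: "z \<in> ?B" and w: "w \<in> ?B" and eq: "F z = F w" for z w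
    proof -
      have inj: "inj_on \<Phi> (\<theta> ` ?B)" using \<Phi>(1) by (rule bij_betw_imp_inj_on)
      have \<theta>eq: "\<theta> (\<Psi> z) = \<theta> (\<Psi> w)"
        by (rule inj_onD[OF inj]) (use eq Feq z w \<Psi>B in auto)
      have "\<exists>A\<in>G. \<Psi> w = A *v \<Psi> z"
      proof (rule ccontr)
        assume "\<not> (\<exists>A\<in>G. \<Psi> w = A *v \<Psi> z)"
        then have "\<And>A. A \<in> G \<Longrightarrow> \<Psi> w \<noteq> A *v \<Psi> z" by blast
        then obtain f where f: "polynomial_function f" "\<And>A z. A \<in> G \<Longrightarrow> f (A *v z) = f z" "f (\<Psi> z) \<noteq> f (\<Psi> w)"
          using separating_invariant[OF G] by metis
        obtain q where "\<And>z. f z = cpoly_eval q (\<theta> z)" using factor[OF f(1,2)] by blast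
        then have "f (\<Psi> z) = f (\<Psi> w)" by (simp add: \<theta>eq)
        with f(3) show False by simp
      qed
      then obtain A where A: "A \<in> G" "\<Psi> w = A *v \<Psi> z" by blast
      have "conj_aut \<Psi> A z = w" unfolding g[OF A(1)] A(2)[symmetric] by (rule \<Psi>i'[OF w])
      then show ?thesis using A(1) by blast
    qed
    \<comment> \<open>If two elements agree at a point \<open>y\<close> where
      \<open>\<theta>\<close> is a local diffeomorphism, then \<open>M = C\<^sup>-\<^sup>1 A\<close>
      fixes \<open>y\<close>, maps balls around \<open>y\<close> to themselves and preserves
      \<open>\<theta>\<close>, which is injective on a small one; so \<open>M\<close> is the
      identity there.\<close>
    show "A = C" if A: "A \<in> G" and C: "C \<in> G" and z: "z \<in> ?B" and J: "complex_jacobian F z \<noteq> 0"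
      and eq: "conj_aut \<Psi> A z = conj_aut \<Psi> C z" for A C z
    proof -
      define y where "y = \<Psi> z"
      have Jy: "?J y \<noteq> 0" using J J0[OF z] by (simp add: y_def)
      have yB: "y \<in> ?B" unfolding y_def by (rule \<Psi>B[OF z])
      have "\<Psi> (conj_aut \<Psi> A z) = \<Psi> (conj_aut \<Psi> C z)" using eq by simp
      then have Ay: "A *v y = C *v y"
        unfolding g[OF A] g[OF C] y_def \<Psi>i(2)[OF GB[OF A \<Psi>B[OF z]]] \<Psi>i(2)[OF GB[OF C \<Psi>B[OF z]]] .
      define M where "M = matrix_inv C ** A"
      have M: "M \<in> G" unfolding M_def by (rule GG(3)[OF GG(4)[OF C] A])
      have "M *v y = matrix_inv C *v (A *v y)" by (simp add: M_def matrix_vector_mul_assoc)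
      also have "\<dots> = y" unfolding Ay by (simp add: matrix_vector_mul_assoc GG(6)[OF C])
      finally have My: "M *v y = y" .
      obtain r where r: "r > 0" "inj_on \<theta> (ball y r)"
        using holo_map_local_inverse[OF h\<theta>[OF open_UNIV] UNIV_I Jy] by metis
      have "M *v x = x" if x: "x \<in> ball y r" for x
      proof (rule inj_onD[OF r(2) \<theta>inv[OF M] _ x])
        have "norm (M *v (x - y)) = norm (x - y)" by (rule unitary_norm[OF GG(5)[OF M]])
        then have "norm (M *v x - y) = norm (x - y)" by (simp add: matrix_vector_mult_diff_distrib My)
        then show "M *v x \<in> ball y r" using x by (simp add: dist_norm norm_minus_commute)
      qed
      then have "M = mat 1" by (rule matrix_id_on_ball[OF r(1)])
      then have "C ** (matrix_inv C ** A) = C" by (simp add: M_def)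
      then show "A = C" by (simp add: matrix_mul_assoc GG(7)[OF C])
    qed
    show "\<exists>\<pi>. bij_betw \<pi> G G \<and> (\<forall>A\<in>G. \<forall>z\<in>?B. conj_aut \<Psi> A (conj_aut \<Psi> C z) = conj_aut \<Psi> (\<pi> A) z)"
      if C: "C \<in> G" for C
    proof (intro exI conjI ballI)
      show "bij_betw (\<lambda>A. A ** C) G G"
        by (rule bij_betw_byWitness[where f'="\<lambda>B. B ** matrix_inv C"])
           (use C GG in \<open>auto simp flip: matrix_mul_assoc\<close>)
      show "conj_aut \<Psi> A (conj_aut \<Psi> C z) = conj_aut \<Psi> (A ** C) z" if "A \<in> G" "z \<in> ?B" for A z
        by (rule gmul[OF that(1) C that(2)])
    qed
    have hq: "holo_on (cpoly_eval q) UNIV" by (rule polynomial_function_holo[OF polynomial_function_eval])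
    show "holo_on \<Delta> \<Omega>" unfolding \<Delta>_def[abs_def] by (rule holo_on_compose[OF hq \<Phi>(3)]) simp
    show "generically_nonzero (\<lambda>z. \<Delta> (F z)) ?B"
      unfolding generically_nonzero_def
    proof (intro allI impI, elim conjE)
      fix W :: "(complex^'n) set" assume W: "open W" "W \<noteq> {}" "W \<subseteq> ?B"
      have "open (\<Psi> ` W)"
        by (rule invariance_of_domain[OF continuous_on_subset[OF holo_map_on_continuous_on[OF \<Psi>(2)] W(3)] W(1)
              inj_on_subset[OF bij_betw_imp_inj_on[OF \<Psi>(1)] W(3)]])
      moreover obtain y where "y \<in> \<Psi> ` W" using W(2) by blast
      ultimately obtain z where "z \<in> W" "D (\<Psi> z) \<noteq> 0"
        using generically_nonzeroD[OF Dgen[OF open_UNIV], of "\<Psi> ` W" y] by auto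
      then show "\<exists>z\<in>W. \<Delta> (F z) \<noteq> 0" using \<Delta>F W(3) by (intro bexI[of _ z]) auto
    qed
    show "\<Delta> (F z) = 0" if "z \<in> ?B" "complex_jacobian F z = 0" for z
      using \<Delta>F[OF that(1)] D0 J0[OF that(1)] that(2) by simp
  qed
  then show ?thesis by (rule that)
qed

theorem theorem5p1:
  fixes F \<Phi> \<theta> \<Psi> :: "complex^'n \<Rightarrow> complex^'n"
    and \<Omega> :: "(complex^'n) set"
    and G :: "(complex^'n^'n) set"
  assumes d: "CARD('n) > 1"
    and domain: "open \<Omega>" "connected \<Omega>" "\<Omega> \<noteq> {}"
    and F: "holo_map_on F unit_ball" "proper_on F unit_ball \<Omega>"
    and rudin: "rudin_factorization F \<Omega> G \<Phi> \<theta> \<Psi>"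
  defines "R \<equiv> (\<lambda>z w. 1 / (complex_jacobian F z * cnj (complex_jacobian F w)) *
      (\<Sum>\<sigma>\<in>G. complex_jacobian (conj_aut \<Psi> \<sigma>) z /
         (1 - hermitian_inner (conj_aut \<Psi> \<sigma> z) w) ^ (CARD('n) + 1)))"
  shows "(\<exists>H. sesquiholo_extension unit_ball {z. complex_jacobian F z \<noteq> 0} R H) \<and>
    (\<forall>H. sesquiholo_extension unit_ball {z. complex_jacobian F z \<noteq> 0} R H \<longrightarrow>
      (\<forall>z\<in>unit_ball. \<forall>w\<in>unit_ball. bergman_kernel \<Omega> (F z) (F w) = H z w))"
proof -
  obtain \<Delta> where deck: "deck_group F \<Omega> G (conj_aut \<Psi>) \<Delta>"
    by (rule rudin_deck_group[OF domain(1) F(1) rudin])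
  interpret deck_group F \<Omega> G "conj_aut \<Psi>" \<Delta> by (rule deck)
  define H where "H z w = bergman_kernel \<Omega> (F z) (F w)" for z w
  have rep: "reproduces \<Omega> y (\<lambda>x. bergman_kernel \<Omega> x y)" if y: "y \<in> \<Omega>" for y
  proof (rule bergman_kernel_reproduces[OF _ y])
    fix y assume "y \<in> \<Omega>"
    then obtain w where "w \<in> unit_ball" "y = F w" using deck_group.F(2)[OF deck] by blast
    then show "\<exists>k. reproduces \<Omega> y k" using reproducing_exists by blast
  qed
  have H1: "holo_on (\<lambda>z. H z w) unit_ball" if w: "w \<in> unit_ball" for w
  proof -
    have "holo_on (\<lambda>x. bergman_kernel \<Omega> x (F w)) \<Omega>"
      using rep[OF F_in[OF w]] by (simp add: reproduces_def bergman_space_iff)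
    from holo_on_compose[OF this F(1)] deck_group.F(2)[OF deck] show ?thesis by (simp add: H_def)
  qed
  have sym: "H z w = cnj (H w z)" if "z \<in> unit_ball" "w \<in> unit_ball" for z w
    unfolding H_def using reproduces_hermitian[OF rep[OF F_in[OF that(2)]] rep[OF F_in[OF that(1)]]] .
  have H2: "holo_on (\<lambda>w. cnj (H z w)) unit_ball" if z: "z \<in> unit_ball" for z
    by (rule holo_on_cong[OF H1[OF z]]) (use sym[OF z] in simp)
  have HR: "H z w = R z w" if z: "z \<in> unit_ball" "J z \<noteq> 0" and w: "w \<in> unit_ball" "J w \<noteq> 0" for z w
  proof -
    have "J z * cnj (J w) * H z w = T (ball_kernel w) z"
      unfolding H_def by (rule kernel_formula[OF w z(1) rep[OF F_in[OF w(1)]]])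
    also have "\<dots> = (\<Sum>\<sigma>\<in>G. complex_jacobian (conj_aut \<Psi> \<sigma>) z /
         (1 - hermitian_inner (conj_aut \<Psi> \<sigma> z) w) ^ (CARD('n) + 1))"
      by (simp add: T_def ball_kernel_def)
    finally show ?thesis unfolding R_def using z(2) w(2) by (simp add: field_simps)
  qed
  \<comment> \<open>Existence: the pulled back kernel is itself the extension.\<close>
  have ext: "sesquiholo_extension unit_ball {z. J z \<noteq> 0} R H"
    unfolding sesquiholo_extension_def using H1 H2 HR by auto
  \<comment> \<open>Uniqueness: the zeros of \<open>J\<close> are a null set, and both functions are
    continuous in each variable separately.\<close>
  have "H z w = H' z w" if H': "sesquiholo_extension unit_ball {z. J z \<noteq> 0} R H'"
    and z: "z \<in> unit_ball" and w: "w \<in> unit_ball" for H' z w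
  proof -
    have H1': "holo_on (\<lambda>z. H' z w) unit_ball" if "w \<in> unit_ball" for w
      using H' that by (simp add: sesquiholo_extension_def)
    have H2': "holo_on (\<lambda>w. cnj (H' z w)) unit_ball" if "z \<in> unit_ball" for z
      using H' that by (simp add: sesquiholo_extension_def)
    have HR': "H' z w = R z w" if "z \<in> unit_ball" "J z \<noteq> 0" "w \<in> unit_ball" "J w \<noteq> 0" for z w
      using H' that by (simp add: sesquiholo_extension_def)
    have null: "{z \<in> unit_ball. J z = 0} \<in> null_sets lborel" by (rule zero_set_null[OF holo_J generically_nonzero_J])
    have reg: "H z w = H' z w" if w: "w \<in> unit_ball" "J w \<noteq> 0" and z: "z \<in> unit_ball" for z w
    proof (rule AE_eq_imp_eq_on[OF open_ball _ _ _ z])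
      show "continuous_on unit_ball (\<lambda>z. H z w)" by (rule holo_on_continuous_on[OF H1[OF w(1)]])
      show "continuous_on unit_ball (\<lambda>z. H' z w)" by (rule holo_on_continuous_on[OF H1'[OF w(1)]])
      show "AE x in lborel. x \<in> unit_ball \<longrightarrow> H x w = H' x w"
        using AE_not_in[OF null] by eventually_elim (use HR[OF _ _ w] HR'[OF _ _ w] in auto)
    qed
    have "cnj (H z w) = cnj (H' z w)"
    proof (rule AE_eq_imp_eq_on[OF open_ball _ _ _ w])
      show "continuous_on unit_ball (\<lambda>w. cnj (H z w))" by (rule holo_on_continuous_on[OF H2[OF z]])
      show "continuous_on unit_ball (\<lambda>w. cnj (H' z w))" by (rule holo_on_continuous_on[OF H2'[OF z]])
      show "AE x in lborel. x \<in> unit_ball \<longrightarrow> cnj (H z x) = cnj (H' z x)"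
        using AE_not_in[OF null] by eventually_elim (use reg[OF _ _ z] in auto)
    qed
    then show ?thesis by simp
  qed
  then show ?thesis using ext unfolding H_def by blast
qed

end
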